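(* Suppose assumptions (A1)--(A4) stated in the context hold. Let $\bar K_n$ be an upper bound on the true number of change-points $K_n$, let $$\zeta_n=\bar K_n^{3}(\log\bar K_n)^2(\log n)^{2+c}$$ with any constant $c>0$, and suppose $\lambda_n/(\bar K_n\zeta_n)\to\infty$. Let $\widehat K_n=\arg\min_{1\le L\le\bar K_n}\mathrm{BIC}_L$. Then $$\Pr(\widehat K_n=K_n)\to1\qquad\text{as } n\to\infty .$$
   Context: Model. For each $n$, $X_1,\ldots,X_n$ are independent real random variables with $X_i\sim F_k$ for $\tau_{k-1}\le i\le \tau_k-1$, $k=1,\ldots,K_n+1$, where $K_n\ge1$ is the number of change-points, $1=\tau_0<\tau_1<\cdots<\tau_{K_n}<\tau_{K_n+1}=n+1$ are integers, and $F_k$ is the C.D.F. of segment $k$. $K_n$, the $\tau_k$ and the $F_k$ may depend on $n$. Let $\lambda_n=\min_{1\le k\le K_n+1}(\tau_k-\tau_{k-1})$. Notation. $\widehat F_n$ is the empirical C.D.F. of $X_1,\ldots,X_n$; $\widehat F_{k}^{l}$ is the empirical C.D.F. of $X_k,\ldots,X_{l-1}$ for $k<l$; $X_{(1)}<\cdots<X_{(n)}$ are the order statistics; $0\log 0=0$. Objective function. For integers $1<\tau_1'<\cdots<\tau_L'\le n$, with $\tau_0'=1$, $\tau_{L+1}'=n+1$ and $\widehat F_{kl}=\widehat F_{\tau_k'}^{\tau_{k+1}'}(X_{(l)})$, $$R_n(\tau_1',\ldots,\tau_L')=n\sum_{k=0}^{L}\sum_{l=2}^{n-1}(\tau_{k+1}'-\tau_k')\frac{\widehat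 F_{kl}\log\widehat F_{kl}+(1-\widehat F_{kl})\log(1-\widehat F_{kl})}{l(n-l)},$$ and $$\mathrm{BIC}_L=-\max_{1<\tau_1'<\cdots<\tau_L'\le n}R_n(\tau_1',\ldots,\tau_L')+L\zeta_n .$$ Signal strength. For $0<\theta<1$ let $F_{r,\theta}=\theta F_r+(1-\theta)F_{r+1}$, and for C.D.F.s $G,H$ let $\eta(u;G,H)=G(u)\log\frac{G(u)}{H(u)}+(1-G(u))\log\frac{1-G(u)}{1-H(u)}$. For $r=1,\ldots,K_n$ let $\eta_r(u)=\eta(u;F_r,F_{r,1/2})+\eta(u;F_{r+1},F_{r,1/2})$. Assumptions. (A1) $F_1,\ldots,F_{K_n+1}$ are continuous and $F_k\ne F_{k+1}$ for $k=1,\ldots,K_n$. (A2) $\lambda_n\to\infty$ as $n\to\infty$. (A3) $\widehat F_n(u)\to F(u)$ almost surely, uniformly in $u$, where $F$ is the C.D.F. of the pooled sample. (A4) $\eta_{\min}=\min_{1\le r\le K_n}\int \frac{\eta_r(u)}{F(u)(1-F(u))}\,dF(u)$ is a positive constant, i.e. bounded away from zero as $n\to\infty$ (integral over the whole range of the data). *)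

theory Defs
  imports "HOL-Probability.Probability"
begin

text \<open>
  A sample of size n is given as a function \<open>x :: nat \<Rightarrow> real\<close> of which only the
  values \<open>x 1, \<dots>, x n\<close> are used.
\<close>

text \<open>Empirical C.D.F. of \<open>x k, \<dots>, x (l - 1)\<close>, for \<open>k < l\<close>.\<close>

definition ecdf :: "(nat \<Rightarrow> real) \<Rightarrow> nat \<Rightarrow> nat \<Rightarrow> real \<Rightarrow> real" where
  "ecdf x k l u = real (card {i \<in> {k..<l}. x i \<le> u}) / real (l - k)"

text \<open>The l-th smallest of \<open>x 1, \<dots>, x n\<close>, for \<open>1 \<le> l \<le> n\<close>.\<close>

definition order_stat :: "nat \<Rightarrow> (nat \<Rightarrow> real) \<Rightarrow> nat \<Rightarrow> real" where
  "order_stat n x l = sort (map x [1..<n + 1]) ! (l - 1)"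

text \<open>
  The convention \<open>0 log 0 = 0\<close> holds automatically here and in \<open>eta\<close> below, as a product
  with a zero factor.
\<close>

definition neg_entropy :: "real \<Rightarrow> real" where
  "neg_entropy p = p * ln p + (1 - p) * ln (1 - p)"

text \<open>
  The objective function; the list \<open>ts\<close> contains the L proposed change-points, and
  \<open>1 # ts @ [n + 1]\<close> adds the conventional end points with indices 0 and L + 1.
\<close>

definition R_obj :: "nat \<Rightarrow> (nat \<Rightarrow> real) \<Rightarrow> nat list \<Rightarrow> real" where
  "R_obj n x ts = (let t = (\<lambda>k. (1 # ts @ [n + 1]) ! k) in
     real n * (\<Sum>k = 0..length ts. \<Sum>l = 2..n - 1.
       real (t (k + 1) - t k) *
       neg_entropy (ecdf x (t k) (t (k + 1)) (order_stat n x l)) / (real l * real (n - l))))"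

definition candidates :: "nat \<Rightarrow> nat \<Rightarrow> nat list set" where
  "candidates n L = {ts. length ts = L \<and> sorted_wrt (<) ts \<and> (\<forall>t\<in>set ts. 1 < t \<and> t \<le> n)}"

text \<open>Meaningful for \<open>L < n\<close> only, since there are no candidates otherwise.\<close>

definition BIC :: "nat \<Rightarrow> real \<Rightarrow> (nat \<Rightarrow> real) \<Rightarrow> nat \<Rightarrow> real" where
  "BIC n \<zeta> x L = - Max (R_obj n x ` candidates n L) + real L * \<zeta>"

definition K_hat :: "nat \<Rightarrow> real \<Rightarrow> nat \<Rightarrow> (nat \<Rightarrow> real) \<Rightarrow> nat" where
  "K_hat n \<zeta> Kbar x = arg_min (BIC n \<zeta> x) (\<lambda>L. 1 \<le> L \<and> L \<le> Kbar)"

definition zeta :: "real \<Rightarrow> nat \<Rightarrow> nat \<Rightarrow> real" where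
  "zeta c Kbar n = real Kbar ^ 3 * (ln (real Kbar))\<^sup>2 * ln (real n) powr (2 + c)"

text \<open>
  For a fixed sample size: \<open>K\<close> is the number of change-points, \<open>\<tau> 0, \<dots>, \<tau> (K + 1)\<close> are the
  segment boundaries and \<open>F k\<close> is the C.D.F. on segment \<open>k \<in> {1..K + 1}\<close>.
\<close>

definition min_segment :: "nat \<Rightarrow> (nat \<Rightarrow> nat) \<Rightarrow> nat" where
  "min_segment K \<tau> = Min ((\<lambda>k. \<tau> k - \<tau> (k - 1)) ` {1..K + 1})"

text \<open>
  C.D.F. of the pooled sample: the segment C.D.F.s weighted by the segments' shares of the
  n observations, that is, the average of the C.D.F.s of the n observations.
\<close>

definition pooled_cdf ::
  "nat \<Rightarrow> nat \<Rightarrow> (nat \<Rightarrow> nat) \<Rightarrow> (nat \<Rightarrow> real \<Rightarrow> real) \<Rightarrow> real \<Rightarrow> real" where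
  "pooled_cdf n K \<tau> F u = (\<Sum>k = 1..K + 1. real (\<tau> k - \<tau> (k - 1)) * F k u) / real n"

definition mix_cdf :: "real \<Rightarrow> (real \<Rightarrow> real) \<Rightarrow> (real \<Rightarrow> real) \<Rightarrow> real \<Rightarrow> real" where
  "mix_cdf \<theta> G H u = \<theta> * G u + (1 - \<theta>) * H u"

definition eta :: "(real \<Rightarrow> real) \<Rightarrow> (real \<Rightarrow> real) \<Rightarrow> real \<Rightarrow> real" where
  "eta G H u = G u * ln (G u / H u) + (1 - G u) * ln ((1 - G u) / (1 - H u))"

definition eta_r :: "(nat \<Rightarrow> real \<Rightarrow> real) \<Rightarrow> nat \<Rightarrow> real \<Rightarrow> real" where
  "eta_r F r u = eta (F r) (mix_cdf (1/2) (F r) (F (r + 1))) u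
               + eta (F (r + 1)) (mix_cdf (1/2) (F r) (F (r + 1))) u"

text \<open>
  \<open>interval_measure P\<close> is the Lebesgue--Stieltjes measure of the C.D.F. P. For the pooled C.D.F.
  of continuous C.D.F.s the set where \<open>P u * (1 - P u) = 0\<close> has measure zero and the
  integrand is bounded, so the integral never takes its default value 0 for want of integrability.
\<close>

definition eta_min ::
  "nat \<Rightarrow> nat \<Rightarrow> (nat \<Rightarrow> nat) \<Rightarrow> (nat \<Rightarrow> real \<Rightarrow> real) \<Rightarrow> real" where
  "eta_min n K \<tau> F = (let P = pooled_cdf n K \<tau> F in
     Min ((\<lambda>r. \<integral>u. eta_r F r u / (P u * (1 - P u)) \<partial>(interval_measure P)) ` {1..K}))"

end

theory Submission
  imports Defs
begin

text \<open>
  For a threshold \<open>u\<close>, the indicators of \<open>x i \<le> u\<close> are independent Bernoulli variables whose parameter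
  is constant on the true segments. The objective function adds up, over the observed thresholds
  with weights of total mass \<open>O(ln n)\<close>, the maximised Bernoulli log-likelihoods of a proposed partition.
  So the proof compares log-likelihoods at one threshold and only afterwards adds up thresholds.

  At one threshold, cut the proposed blocks along the true segments. The maximised log-likelihood
  of the proposal equals that of the pieces minus the divergences of the pieces from their
  blocks (the loss), and that of the pieces exceeds the maximised log-likelihood of the true partition
  by at most the divergences of the pieces from fixed reference probabilities (the noise);
  see \<open>partition_entropy_comparison\<close>.

  A Chernoff bound in divergence form, applied to all stretches of all segments and to a grid of
  quantiles, bounds every noise term by \<open>O(ln n)\<close> simultaneously for all thresholds
  (\<open>prob_bkl_frac_below_gt\<close>, \<open>bkl_grid_point_le\<close>). Since there are at most \<open>4 Kbar\<^sup>2\<close> pieces, no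
  proposal has an objective value that exceeds the one of the true change-points by more than
  \<open>O(Kbar\<^sup>2 (ln n)\<^sup>2)\<close>, which is less than a single penalty \<open>\<zeta>\<close>. Hence the
  number of change-points is not overestimated.

  If a proposal has too few change-points, it stays away from some true one by half the minimal
  segment length, and one of its blocks contains long parts of both adjacent segments. The loss
  there is at least a multiple of the minimal segment length times the weighted sum, over the
  observed thresholds, of the squared Hellinger distances between the two adjacent C.D.F.s. This sum is
  bounded below by the signal strength: the fit of the segments implies that
  the ranks of the observations are at most of the order predicted by the pooled C.D.F. \<open>P\<close>, so the
  weights dominate \<open>1 / (n P (1 - P))\<close> outside the extreme tails (\<open>weighted_sum_ge\<close>); what
  remains is an average of independent bounded variables whose mean is the
  integral with respect to \<open>P\<close> that defines the signal strength, up to its extreme tails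
  (\<open>mean_trimmed_signal_ge\<close>, \<open>prob_sum_le_quarter_mean\<close>). The tails do not matter, because a segment is
  a fraction of the sample that is not too small, which bounds its C.D.F. by a multiple of \<open>P\<close>. By
  the rate assumption the loss therefore exceeds all penalties saved, and the number is not
  underestimated either.

  This gives an error probability of at most \<open>5 / n\<close> for large \<open>n\<close> with \<open>Kbar \<ge> 2\<close>
  (\<open>prob_K_hat_eq_ge\<close>); for \<open>Kbar = 1\<close> the estimator has only one possible value.
\<close>

section \<open>Bernoulli divergences\<close>

text \<open>
  The Kullback-Leibler divergence of the Bernoulli distribution with parameter \<open>p\<close> from the
  one with parameter \<open>q\<close>, and twice their squared Hellinger distance.

  The likelihood produces \<open>bkl\<close>, for which there is no triangle inequality. The square root of
  \<open>hel\<close> is a metric, and \<open>hel\<close> is a lower bound of \<open>bkl\<close>, so estimates for the data are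
  carried over to the true probabilities in terms of \<open>hel\<close>.
\<close>

definition bkl :: "real \<Rightarrow> real \<Rightarrow> real" where
  "bkl p q = p * ln (p / q) + (1 - p) * ln ((1 - p) / (1 - q))"

definition hel :: "real \<Rightarrow> real \<Rightarrow> real" where
  "hel p q = (sqrt p - sqrt q)\<^sup>2 + (sqrt (1 - p) - sqrt (1 - q))\<^sup>2"

lemma hel_nonneg: "0 \<le> hel p q"
  by (simp add: hel_def)

lemma hel_commute: "hel p q = hel q p"
  by (simp add: hel_def power2_commute)

lemma hel_triangle: "hel p r \<le> 2 * hel p q + 2 * hel q r"
proof -
  have *: "(x - z)\<^sup>2 \<le> 2 * (x - y)\<^sup>2 + 2 * (y - z)\<^sup>2" for x y z :: real
    using zero_le_power2[of "(x - y) - (y - z)"] by (simp add: power2_eq_square algebra_simps)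
  have "hel p r \<le> (2 * (sqrt p - sqrt q)\<^sup>2 + 2 * (sqrt q - sqrt r)\<^sup>2)
      + (2 * (sqrt (1 - p) - sqrt (1 - q))\<^sup>2 + 2 * (sqrt (1 - q) - sqrt (1 - r))\<^sup>2)"
    unfolding hel_def by (intro add_mono *)
  then show ?thesis
    by (simp add: hel_def)
qed

lemma sqrt_diff_square_le:
  assumes "0 \<le> a" "0 \<le> b"
  shows "(sqrt a - sqrt b)\<^sup>2 \<le> \<bar>a - b\<bar>"
proof -
  have "\<bar>sqrt a - sqrt b\<bar> * \<bar>sqrt a - sqrt b\<bar> \<le> \<bar>sqrt a - sqrt b\<bar> * (sqrt a + sqrt b)"
    using assms by (intro mult_left_mono) (auto simp: abs_le_iff)
  also have "\<dots> = \<bar>(sqrt a - sqrt b) * (sqrt a + sqrt b)\<bar>"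
    using assms by (simp add: abs_mult)
  also have "(sqrt a - sqrt b) * (sqrt a + sqrt b) = a - b"
    using assms by (simp add: algebra_simps)
  finally show ?thesis
    by (simp add: power2_eq_square)
qed

lemma hel_le_abs_diff:
  assumes "0 \<le> p" "p \<le> 1" "0 \<le> q" "q \<le> 1"
  shows "hel p q \<le> 2 * \<bar>p - q\<bar>"
proof -
  have "hel p q \<le> \<bar>p - q\<bar> + \<bar>(1 - p) - (1 - q)\<bar>"
    unfolding hel_def using assms by (intro add_mono sqrt_diff_square_le) auto
  then show ?thesis
    by (simp add: abs_minus_commute)
qed

lemma hel_le_max:
  assumes "0 \<le> p" "p \<le> 1" "0 \<le> q" "q \<le> 1"
  shows "hel p q \<le> 2 * max p q" "hel p q \<le> 2 * max (1 - p) (1 - q)"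
  using hel_le_abs_diff[OF assms] assms by (auto simp: max_def abs_if split: if_splits)

text \<open>
  An upper bound on \<open>p\<close> of the right multiplicative order even for tiny \<open>q\<close>: it later turns
  the fit of the empirical frequencies into bounds on the ranks of extreme observations, which
  an additive error bound could not do.
\<close>

lemma le_twice_plus_hel:
  assumes "0 \<le> p" "p \<le> 1" "0 \<le> q" "q \<le> 1"
  shows "p \<le> 2 * q + 2 * hel p q" "1 - p \<le> 2 * (1 - q) + 2 * hel p q"
proof -
  have *: "a \<le> 2 * b + 2 * (sqrt a - sqrt b)\<^sup>2" if "0 \<le> a" "0 \<le> b" for a b :: real
  proof -
    have "(sqrt a)\<^sup>2 \<le> 2 * (sqrt b)\<^sup>2 + 2 * (sqrt a - sqrt b)\<^sup>2"
      using zero_le_power2[of "sqrt b - (sqrt a - sqrt b)"]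
      by (simp add: power2_eq_square algebra_simps del: real_sqrt_mult_self)
    then show ?thesis
      using that by simp
  qed
  show "p \<le> 2 * q + 2 * hel p q"
    using *[OF assms(1,3)] zero_le_power2[of "sqrt (1 - p) - sqrt (1 - q)"]
    unfolding hel_def by (smt (verit))
  show "1 - p \<le> 2 * (1 - q) + 2 * hel p q"
    using *[of "1 - p" "1 - q"] assms(2,4) zero_le_power2[of "sqrt p - sqrt q"]
    unfolding hel_def by (smt (verit))
qed

text \<open>
  From \<open>ln s \<le> s - 1\<close> at \<open>s = sqrt (b / a)\<close>; adding the bounds for
  \<open>(p, q)\<close> and \<open>(1 - p, 1 - q)\<close> compares the two divergences.
\<close>

lemma xlogx_ratio_ge:
  fixes a b :: real
  assumes "0 \<le> a" "0 \<le> b" "b = 0 \<Longrightarrow> a = 0"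
  shows "2 * a - 2 * (sqrt a * sqrt b) \<le> a * ln (a / b)"
proof (cases "a = 0")
  case False
  then have ab: "0 < a" "0 < b"
    using assms by (auto simp: order_less_le)
  have "ln (sqrt (b / a)) \<le> sqrt (b / a) - 1"
    using ab by (intro ln_le_minus_one) auto
  moreover have "ln (sqrt (b / a)) = - ln (a / b) / 2"
    using ab by (simp add: ln_sqrt ln_div)
  ultimately have "a * ln (a / b) \<ge> a * (2 - 2 * sqrt (b / a))"
    using ab by (intro mult_left_mono) auto
  moreover have "a * sqrt (b / a) = sqrt a * sqrt b"
    using ab by (simp add: real_sqrt_divide times_divide_eq_left[symmetric] real_div_sqrt
      del: times_divide_eq_left)
  ultimately show ?thesis
    by (simp add: algebra_simps)
qed simp

lemma hel_le_bkl:
  assumes "0 \<le> p" "p \<le> 1" "0 \<le> q" "q \<le> 1" "q = 0 \<Longrightarrow> p = 0" "q = 1 \<Longrightarrow> p = 1"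
  shows "hel p q \<le> bkl p q"
proof -
  have "hel p q = 2 * p - 2 * (sqrt p * sqrt q)
      + (2 * (1 - p) - 2 * (sqrt (1 - p) * sqrt (1 - q)))"
    using assms by (simp add: hel_def power2_diff algebra_simps)
  also have "\<dots> \<le> bkl p q"
    unfolding bkl_def using assms
    by (intro add_mono xlogx_ratio_ge) auto
  finally show ?thesis .
qed

lemma bkl_nonneg:
  assumes "0 \<le> p" "p \<le> 1" "0 \<le> q" "q \<le> 1" "q = 0 \<Longrightarrow> p = 0" "q = 1 \<Longrightarrow> p = 1"
  shows "0 \<le> bkl p q"
  using hel_le_bkl[OF assms] hel_nonneg[of p q] by linarith

lemma bkl_self: "bkl p p = 0"
  by (cases "p = 0"; cases "p = 1") (simp_all add: bkl_def)

lemma bkl_reflect: "bkl (1 - p) (1 - q) = bkl p q"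
  by (simp add: bkl_def)

lemma bkl_le_chi_square:
  assumes "0 \<le> p" "p \<le> 1" "0 < m" "m < 1"
  shows "bkl p m \<le> (p - m)\<^sup>2 / (m * (1 - m))"
proof -
  have *: "a * ln (a / b) \<le> a * (a / b - 1)" if "0 \<le> a" "0 < b" for a b :: real
    using that ln_le_minus_one[of "a / b"] by (cases "a = 0") (auto intro: mult_left_mono)
  have "bkl p m \<le> p * (p / m - 1) + (1 - p) * ((1 - p) / (1 - m) - 1)"
    unfolding bkl_def using assms by (intro add_mono *) auto
  also have "\<dots> = (p - m)\<^sup>2 / (m * (1 - m))"
    using assms by (simp add: field_simps power2_eq_square)
  finally show ?thesis .
qed

text \<open>
  The chi-square bounds of both divergences have the same value
  \<open>(p - q)\<^sup>2 / 4 * (1 / m + 1 / (1 - m))\<close>, and \<open>(p - q)\<^sup>2\<close> factors as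
  \<open>(sqrt p + sqrt q)\<^sup>2 * (sqrt p - sqrt q)\<^sup>2\<close>, where the first factor is at most
  \<open>2 * (p + q) = 4 * m\<close>; similarly for \<open>1 - p\<close> and \<open>1 - q\<close>.
\<close>

lemma bkl_midpoint_le_hel:
  assumes "0 \<le> p" "p \<le> 1" "0 \<le> q" "q \<le> 1" and m: "m = (p + q) / 2"
  shows "bkl p m + bkl q m \<le> 2 * hel p q"
proof (cases "m = 0 \<or> m = 1")
  case True
  then have "p = m" "q = m"
    using assms by auto
  then show ?thesis
    using True by (auto simp: bkl_def hel_def)
next
  case False
  then have m01: "0 < m" "m < 1"
    using assms by auto
  have *: "(a - b)\<^sup>2 \<le> 2 * (a + b) * (sqrt a - sqrt b)\<^sup>2" if "0 \<le> a" "0 \<le> b" for a b :: real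
  proof -
    have "(a - b)\<^sup>2 = ((sqrt a + sqrt b) * (sqrt a - sqrt b))\<^sup>2"
      using that by (simp add: algebra_simps)
    also have "\<dots> = (sqrt a + sqrt b)\<^sup>2 * (sqrt a - sqrt b)\<^sup>2"
      by (simp add: power_mult_distrib)
    also have "(sqrt a + sqrt b)\<^sup>2 \<le> 2 * (a + b)"
      using that zero_le_power2[of "sqrt a - sqrt b"]
      by (simp add: power2_sum power2_diff)
    finally show ?thesis
      by (simp add: mult_right_mono)
  qed
  have pq: "p + q = 2 * m" and pq': "(1 - p) + (1 - q) = 2 * (1 - m)"
    using m by auto
  have 1: "(p - q)\<^sup>2 / (4 * m) \<le> (sqrt p - sqrt q)\<^sup>2"
    using *[of p q] assms(1,3) m01 unfolding pq by (simp add: divide_le_eq mult.commute)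
  have 2: "(p - q)\<^sup>2 / (4 * (1 - m)) \<le> (sqrt (1 - p) - sqrt (1 - q))\<^sup>2"
    using *[of "1 - p" "1 - q"] assms(2,4) m01 unfolding pq'
    by (simp add: divide_le_eq mult.commute power2_commute)
  have "bkl p m + bkl q m \<le> (p - m)\<^sup>2 / (m * (1 - m)) + (q - m)\<^sup>2 / (m * (1 - m))"
    using assms m01 by (intro add_mono bkl_le_chi_square) auto
  also have "p - m = (p - q) / 2"
    using m by simp
  also have "q - m = (q - p) / 2"
    using m by simp
  also have "((p - q) / 2)\<^sup>2 / (m * (1 - m)) + ((q - p) / 2)\<^sup>2 / (m * (1 - m))
      = 2 * ((p - q)\<^sup>2 / (4 * m) + (p - q)\<^sup>2 / (4 * (1 - m)))"
  proof -
    have "X / 4 / (m * (1 - m)) + X / 4 / (m * (1 - m)) = 2 * (X / (4 * m) + X / (4 * (1 - m)))"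
      for X
      using m01 by (simp add: divide_simps) (simp add: algebra_simps)
    from this[of "(p - q)\<^sup>2"] show ?thesis
      by (simp add: power_divide power2_commute)
  qed
  also have "\<dots> \<le> 2 * hel p q"
    using 1 2 by (simp add: hel_def)
  finally show ?thesis .
qed

lemma bkl_mono_left:
  assumes "0 < q" "q \<le> a" "a \<le> b" "b \<le> 1" "q < 1"
  shows "bkl a q \<le> bkl b q"
proof -
  have 1: "bkl b q - bkl a q = bkl b a + (b - a) * (ln (a / q) - ln ((1 - a) / (1 - q)))"
    if "a < 1"
  proof -
    have *: "x * ln (x / y) = x * (ln x - ln y)" if "0 \<le> x" "0 < y" for x y :: real
      using that by (cases "x = 0") (auto simp: ln_div)
    have "bkl b q = b * (ln b - ln q) + (1 - b) * (ln (1 - b) - ln (1 - q))"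
      "bkl a q = a * (ln a - ln q) + (1 - a) * (ln (1 - a) - ln (1 - q))"
      "bkl b a = b * (ln b - ln a) + (1 - b) * (ln (1 - b) - ln (1 - a))"
      unfolding bkl_def using assms that by (simp_all add: *)
    moreover have "ln (a / q) = ln a - ln q" "ln ((1 - a) / (1 - q)) = ln (1 - a) - ln (1 - q)"
      using assms that by (simp_all add: ln_div)
    ultimately show ?thesis
      by (simp only:) (simp add: algebra_simps)
  qed
  show ?thesis
  proof (cases "a < 1")
    case True
    have "0 \<le> ln (a / q)"
      using assms by simp
    moreover have "ln ((1 - a) / (1 - q)) \<le> 0"
      using assms True by (simp add: ln_le_zero_iff)
    ultimately have "0 \<le> (b - a) * (ln (a / q) - ln ((1 - a) / (1 - q)))"
      using assms by (intro mult_nonneg_nonneg) linarith+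
    moreover have "0 \<le> bkl b a"
      using assms True by (intro bkl_nonneg) auto
    ultimately show ?thesis
      using 1 True by linarith
  next
    case False
    then have "a = b"
      using assms by simp
    then show ?thesis
      by simp
  qed
qed

lemma bkl_mono_right_side:
  assumes "0 < q" "q < 1" "0 \<le> b" "b \<le> a" "a \<le> q"
  shows "bkl a q \<le> bkl b q"
  using bkl_mono_left[of "1 - q" "1 - a" "1 - b"] assms by (simp add: bkl_reflect)


text \<open>
  Moving the reference probability up to a nearby grid point \<open>hi\<close> costs at most four times the
  gap: above \<open>hi\<close> the divergence is monotone, below \<open>lo\<close> it differs from the
  divergence to \<open>lo\<close> by at most \<open>ln ((1 - lo) / (1 - hi))\<close>, and in between the
  chi-square bound is of the order of the gap.
\<close>

lemma bkl_le_of_grid: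
  assumes hi: "0 < hi" "hi \<le> 3 / 4" and "lo < hi"
    and a: "0 \<le> alo" "alo \<le> a" "a \<le> ahi" "ahi \<le> 1" and "0 \<le> s"
    and upper: "bkl ahi hi \<le> s" and lower: "0 < lo \<Longrightarrow> bkl alo lo \<le> s"
  shows "bkl a hi \<le> s + 4 * (hi - lo)"
proof -
  consider "hi \<le> a" | "a < hi" "0 < lo" "a \<le> lo" | "a < hi" "lo < a \<or> lo \<le> 0"
    by linarith
  then show ?thesis
  proof cases
    case 1
    then have "bkl a hi \<le> bkl ahi hi"
      using assms by (intro bkl_mono_left) auto
    then show ?thesis
      using upper \<open>lo < hi\<close> by simp
  next
    case 2
    have *: "x * ln (x / y) = x * (ln x - ln y)" if "0 \<le> x" "0 < y" for x y :: real
      using that by (cases "x = 0") (auto simp: ln_div)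
    have "bkl a hi = a * (ln a - ln hi) + (1 - a) * (ln (1 - a) - ln (1 - hi))"
      "bkl a lo = a * (ln a - ln lo) + (1 - a) * (ln (1 - a) - ln (1 - lo))"
      unfolding bkl_def using assms 2 by (simp_all add: *)
    then have "bkl a hi - bkl a lo = a * (ln lo - ln hi) + (1 - a) * (ln (1 - lo) - ln (1 - hi))"
      by (simp add: algebra_simps)
    also have "\<dots> \<le> 0 + 1 * (ln (1 - lo) - ln (1 - hi))"
      using assms 2 by (intro add_mono mult_right_mono) (auto simp: mult_le_0_iff)
    also have "ln (1 - lo) - ln (1 - hi) = ln ((1 - lo) / (1 - hi))"
      using assms by (subst ln_div) auto
    also have "\<dots> \<le> (1 - lo) / (1 - hi) - 1"
      using assms by (intro ln_le_minus_one) auto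
    also have "\<dots> = (hi - lo) / (1 - hi)"
      using assms by (simp add: field_simps)
    also have "\<dots> \<le> (hi - lo) / (1 / 4)"
      using assms by (intro divide_left_mono) auto
    finally have "bkl a hi \<le> bkl a lo + 4 * (hi - lo)"
      by simp
    moreover have "bkl a lo \<le> bkl alo lo"
      using assms 2 by (intro bkl_mono_right_side) auto
    ultimately show ?thesis
      using lower[OF 2(2)] by linarith
  next
    case 3
    have "bkl a hi \<le> (a - hi)\<^sup>2 / (hi * (1 - hi))"
      using assms 3 by (intro bkl_le_chi_square) auto
    also have "\<dots> = (hi - a) * ((hi - a) / (hi * (1 - hi)))"
      by (simp add: power2_eq_square minus_diff_eq[of hi a, symmetric] del: minus_diff_eq)
    also have "\<dots> \<le> (hi - lo) * (hi / (hi * (1 / 4)))"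
      using assms 3 by (intro mult_mono frac_le mult_left_mono) auto
    also have "\<dots> = 4 * (hi - lo)"
      using hi by simp
    finally show ?thesis
      using \<open>0 \<le> s\<close> by simp
  qed
qed

section \<open>Pointwise log-likelihoods of partitions\<close>

text \<open>
  Everything up to the choice of the order statistics happens for one threshold \<open>u\<close> at a time,
  where the data are the indicators of \<open>x i \<le> u\<close>. The Bernoulli log-likelihood of a block is
  written as a sum over observations, because then it is additive over disjoint blocks.
\<close>

definition frac_below :: "(nat \<Rightarrow> real) \<Rightarrow> real \<Rightarrow> nat set \<Rightarrow> real" where
  "frac_below x u I = real (card {i \<in> I. x i \<le> u}) / real (card I)"

definition loglik :: "(nat \<Rightarrow> real) \<Rightarrow> real \<Rightarrow> real \<Rightarrow> nat set \<Rightarrow> real" where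
  "loglik x u q I = (\<Sum>i\<in>I. if x i \<le> u then ln q else ln (1 - q))"

lemma ecdf_eq_frac_below: "ecdf x a b u = frac_below x u {a..<b}"
  by (simp add: ecdf_def frac_below_def)

lemma frac_below_nonneg: "0 \<le> frac_below x u I"
  by (simp add: frac_below_def)

lemma frac_below_le_1: "frac_below x u I \<le> 1"
proof (cases "finite I")
  case True
  then show ?thesis
    unfolding frac_below_def by (auto simp: divide_le_eq_1 card_gt_0_iff intro!: card_mono)
qed (simp add: frac_below_def)

lemma frac_below_mono:
  assumes "u \<le> v"
  shows "frac_below x u I \<le> frac_below x v I"
proof (cases "finite I")
  case True
  then have "card {i \<in> I. x i \<le> u} \<le> card {i \<in> I. x i \<le> v}"
    using assms by (intro card_mono) auto
  then show ?thesis
    by (simp add: frac_below_def divide_right_mono)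
qed (simp add: frac_below_def)

lemma card_times_frac_below:
  assumes "finite I"
  shows "real (card I) * frac_below x u I = real (card {i \<in> I. x i \<le> u})"
  using assms by (cases "I = {}") (auto simp: frac_below_def)

lemma loglik_eq_frac_below:
  assumes "finite I"
  shows "loglik x u q I = real (card I) * (frac_below x u I * ln q + (1 - frac_below x u I) * ln (1 - q))"
proof -
  have "card (I - {i \<in> I. x i \<le> u}) = card I - card {i \<in> I. x i \<le> u}"
    using assms by (intro card_Diff_subset) auto
  moreover have "card {i \<in> I. x i \<le> u} \<le> card I"
    using assms by (intro card_mono) auto
  ultimately have *: "real (card (I - {i \<in> I. x i \<le> u})) = real (card I) - real (card {i \<in> I. x i \<le> u})"
    by simp
  have "loglik x u q I = (\<Sum>i\<in>{i \<in> I. x i \<le> u}. ln q) + (\<Sum>i\<in>I - {i \<in> I. x i \<le> u}. ln (1 - q))"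
    unfolding loglik_def using assms by (subst sum.If_cases) 
      (auto simp del: sum_constant intro!: arg_cong2[of _ _ _ _ "(+)"] sum.cong)
  also have "\<dots> = real (card {i \<in> I. x i \<le> u}) * ln q
      + (real (card I) - real (card {i \<in> I. x i \<le> u})) * ln (1 - q)"
    by (simp only: sum_constant *)
  also have "\<dots> = real (card I) * (frac_below x u I * ln q + (1 - frac_below x u I) * ln (1 - q))"
    unfolding card_times_frac_below[OF assms, symmetric] by (simp add: algebra_simps)
  finally show ?thesis .
qed

lemma neg_entropy_eq_cross_plus_bkl:
  assumes "0 \<le> p" "p \<le> 1" "0 \<le> q" "q \<le> 1" "q = 0 \<Longrightarrow> p = 0" "q = 1 \<Longrightarrow> p = 1"
  shows "neg_entropy p = p * ln q + (1 - p) * ln (1 - q) + bkl p q"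
proof -
  have *: "a * ln a = a * ln b + a * ln (a / b)" if "0 \<le> a" "0 \<le> b" "b = 0 \<Longrightarrow> a = 0" for a b :: real
    using that by (cases "a = 0") (auto simp: ln_div algebra_simps)
  show ?thesis
    using *[of p q] *[of "1 - p" "1 - q"] assms by (simp add: neg_entropy_def bkl_def)
qed

lemma card_neg_entropy_eq_loglik:
  assumes "finite I" "0 \<le> q" "q \<le> 1"
    and "q = 0 \<Longrightarrow> I \<noteq> {} \<Longrightarrow> frac_below x u I = 0" "q = 1 \<Longrightarrow> I \<noteq> {} \<Longrightarrow> frac_below x u I = 1"
  shows "real (card I) * neg_entropy (frac_below x u I)
    = loglik x u q I + real (card I) * bkl (frac_below x u I) q"
proof (cases "I = {}")
  case False
  then have "neg_entropy (frac_below x u I) = frac_below x u I * ln q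
      + (1 - frac_below x u I) * ln (1 - q) + bkl (frac_below x u I) q"
    using assms by (intro neg_entropy_eq_cross_plus_bkl frac_below_nonneg frac_below_le_1) auto
  then show ?thesis
    by (simp only: loglik_eq_frac_below[OF assms(1)] distrib_left)
qed (simp add: loglik_def)

text \<open>
  So the divergence of a part of a block from the whole block is never infinite, and the
  values that are assigned to division by 0 and to the logarithm of 0 do not matter.
\<close>

lemma frac_below_subset_extreme:
  assumes "finite J" "I \<subseteq> J" "I \<noteq> {}"
  shows "frac_below x u J = 0 \<Longrightarrow> frac_below x u I = 0"
    and "frac_below x u J = 1 \<Longrightarrow> frac_below x u I = 1"
proof -
  have fin: "finite I" and pos: "0 < card I" "0 < card J"
    using assms by (auto intro: finite_subset simp: card_gt_0_iff)
  show "frac_below x u I = 0" if "frac_below x u J = 0"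
  proof -
    have "card {i \<in> J. x i \<le> u} = 0"
      using that pos unfolding frac_below_def by (simp only: divide_eq_0_iff) simp
    then have "{i \<in> J. x i \<le> u} = {}"
      using assms by simp
    then have "{i \<in> I. x i \<le> u} = {}"
      using assms by auto
    then show ?thesis
      unfolding frac_below_def by (simp only: card.empty of_nat_0 div_0)
  qed
  show "frac_below x u I = 1" if "frac_below x u J = 1"
  proof -
    have "card {i \<in> J. x i \<le> u} = card J"
      using that pos by (simp add: frac_below_def divide_eq_eq)
    then have "{i \<in> J. x i \<le> u} = J"
      using assms by (intro card_subset_eq) auto
    then have "{i \<in> I. x i \<le> u} = I"
      using assms by auto
    then show ?thesis
      using pos by (simp add: frac_below_def)
  qed
qed

lemma card_hel_le_card_bkl_superset:
  assumes "finite J" "I \<subseteq> J"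
  shows "hel (frac_below x u I) (frac_below x u J) * real (card I)
      \<le> real (card I) * bkl (frac_below x u I) (frac_below x u J)"
proof (cases "I = {}")
  case False
  then have "hel (frac_below x u I) (frac_below x u J) \<le> bkl (frac_below x u I) (frac_below x u J)"
    using frac_below_subset_extreme[OF assms False]
    by (intro hel_le_bkl frac_below_nonneg frac_below_le_1) auto
  then show ?thesis
    by (simp add: mult.commute[of _ "real (card I)"] mult_left_mono)
qed simp

text \<open>
  The pointwise comparison of a proposed partition \<open>J\<close> with the true one \<open>S\<close>. Cut every
  block \<open>J j\<close> along the segments \<open>S k\<close>. Fitting the pieces separately instead of fitting
  \<open>J j\<close> as a whole gains exactly the divergences of the pieces from \<open>J j\<close>, which is the second
  sum on the left. Fitting a piece rather than using the fixed parameter \<open>q k\<close> gains its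
  divergence from \<open>q k\<close>, which is noise and at most \<open>t\<close>. Finally the log-likelihoods
  with parameter \<open>q k\<close> add up over the pieces of \<open>S k\<close> and are bounded by the maximised one.
\<close>

lemma partition_entropy_comparison:
  fixes J :: "'i \<Rightarrow> nat set" and S :: "'k \<Rightarrow> nat set"
  assumes fin: "finite A" "finite B" "finite U"
    and J: "disjoint_family_on J A" "(\<Union>j\<in>A. J j) = U"
    and S: "disjoint_family_on S B" "(\<Union>k\<in>B. S k) = U"
    and q: "\<And>k. k \<in> B \<Longrightarrow> 0 < q k" "\<And>k. k \<in> B \<Longrightarrow> q k < 1"
    and noise: "\<And>j k. j \<in> A \<Longrightarrow> k \<in> B \<Longrightarrow>
      real (card (J j \<inter> S k)) * bkl (frac_below x u (J j \<inter> S k)) (q k) \<le> t"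
  shows "(\<Sum>j\<in>A. real (card (J j)) * neg_entropy (frac_below x u (J j)))
      + (\<Sum>j\<in>A. \<Sum>k\<in>B. real (card (J j \<inter> S k)) *
            bkl (frac_below x u (J j \<inter> S k)) (frac_below x u (J j)))
    \<le> (\<Sum>k\<in>B. real (card (S k)) * neg_entropy (frac_below x u (S k))) + real (card A * card B) * t"
proof -
  let ?f = "frac_below x u" and ?c = "\<lambda>I. real (card I)"
  have finJ: "finite (J j)" if "j \<in> A" for j
    using finite_subset[of "J j" U] that fin(3) J(2) by blast
  have finS: "finite (S k)" if "k \<in> B" for k
    using finite_subset[of "S k" U] that fin(3) S(2) by blast
  have split_J: "loglik x u p (J j) = (\<Sum>k\<in>B. loglik x u p (J j \<inter> S k))" if "j \<in> A" for j p
  proof -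
    have "J j = (\<Union>k\<in>B. J j \<inter> S k)"
      using that J(2) S(2) by auto
    then have "loglik x u p (J j) = loglik x u p (\<Union>k\<in>B. J j \<inter> S k)"
      by simp
    also have "\<dots> = (\<Sum>k\<in>B. loglik x u p (J j \<inter> S k))"
      unfolding loglik_def using fin finJ[OF that] S(1)
      by (intro sum.UNION_disjoint) (auto simp: disjoint_family_on_def)
    finally show ?thesis .
  qed
  have split_S: "loglik x u p (S k) = (\<Sum>j\<in>A. loglik x u p (J j \<inter> S k))" if "k \<in> B" for k p
  proof -
    have "S k = (\<Union>j\<in>A. J j \<inter> S k)"
      using that J(2) S(2) by auto
    then have "loglik x u p (S k) = loglik x u p (\<Union>j\<in>A. J j \<inter> S k)"
      by simp
    also have "\<dots> = (\<Sum>j\<in>A. loglik x u p (J j \<inter> S k))"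
      unfolding loglik_def using fin finS[OF that] J(1)
      by (intro sum.UNION_disjoint) (auto simp: disjoint_family_on_def)
    finally show ?thesis .
  qed
  have self: "?c (J j) * neg_entropy (?f (J j)) = loglik x u (?f (J j)) (J j)" if "j \<in> A" for j
    using card_neg_entropy_eq_loglik[OF finJ[OF that], of "?f (J j)" x u]
    by (simp only: frac_below_nonneg frac_below_le_1 bkl_self mult_zero_right add_0_right simp_thms)
  have piece: "loglik x u (?f (J j)) (J j \<inter> S k) + ?c (J j \<inter> S k) * bkl (?f (J j \<inter> S k)) (?f (J j))
      \<le> loglik x u (q k) (J j \<inter> S k) + t" if "j \<in> A" "k \<in> B" for j k
  proof -
    have "loglik x u (?f (J j)) (J j \<inter> S k) + ?c (J j \<inter> S k) * bkl (?f (J j \<inter> S k)) (?f (J j))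
        = ?c (J j \<inter> S k) * neg_entropy (?f (J j \<inter> S k))"
      using finJ[OF that(1)] frac_below_subset_extreme[of "J j" "J j \<inter> S k" x u]
      by (intro card_neg_entropy_eq_loglik[symmetric] frac_below_nonneg frac_below_le_1) auto
    also have "\<dots> = loglik x u (q k) (J j \<inter> S k) + ?c (J j \<inter> S k) * bkl (?f (J j \<inter> S k)) (q k)"
      using finJ[OF that(1)] q[OF that(2)] by (intro card_neg_entropy_eq_loglik) auto
    finally show ?thesis
      using noise[OF that] by linarith
  qed
  have gibbs: "loglik x u (q k) (S k) \<le> ?c (S k) * neg_entropy (?f (S k))" if "k \<in> B" for k
  proof -
    have "0 \<le> bkl (?f (S k)) (q k)"
      using q[OF that] by (intro bkl_nonneg frac_below_nonneg frac_below_le_1) auto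
    then show ?thesis
      using card_neg_entropy_eq_loglik[OF finS[OF that], of "q k" x u] q[OF that] by simp
  qed
  have "(\<Sum>j\<in>A. ?c (J j) * neg_entropy (?f (J j)))
      + (\<Sum>j\<in>A. \<Sum>k\<in>B. ?c (J j \<inter> S k) * bkl (?f (J j \<inter> S k)) (?f (J j)))
    = (\<Sum>j\<in>A. \<Sum>k\<in>B. loglik x u (?f (J j)) (J j \<inter> S k)
        + ?c (J j \<inter> S k) * bkl (?f (J j \<inter> S k)) (?f (J j)))"
  proof -
    have "?c (J j) * neg_entropy (?f (J j)) = (\<Sum>k\<in>B. loglik x u (?f (J j)) (J j \<inter> S k))"
      if "j \<in> A" for j
      using self[OF that] split_J[OF that] by simp
    then show ?thesis
      by (simp add: sum.distrib)
  qed
  also have "\<dots> \<le> (\<Sum>j\<in>A. \<Sum>k\<in>B. loglik x u (q k) (J j \<inter> S k) + t)"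
    by (intro sum_mono piece)
  also have "\<dots> = (\<Sum>k\<in>B. loglik x u (q k) (S k)) + real (card A * card B) * t"
  proof -
    have "(\<Sum>k\<in>B. loglik x u (q k) (S k)) = (\<Sum>j\<in>A. \<Sum>k\<in>B. loglik x u (q k) (J j \<inter> S k))"
      by (subst sum.swap) (intro sum.cong refl split_S)
    then show ?thesis
      by (simp add: sum.distrib)
  qed
  also have "\<dots> \<le> (\<Sum>k\<in>B. ?c (S k) * neg_entropy (?f (S k))) + real (card A * card B) * t"
    by (intro add_right_mono sum_mono gibbs)
  finally show ?thesis .
qed

text \<open>
  The loss from a block that covers parts of two segments: whatever the common frequency of the
  block is, the triangle inequality keeps it away from one of the two.
\<close>

lemma sum_bkl_ge_hel:
  fixes J :: "'i \<Rightarrow> nat set" and S :: "'k \<Rightarrow> nat set"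
  assumes fin: "finite A" "finite B" "\<And>j. j \<in> A \<Longrightarrow> finite (J j)"
    and j: "j \<in> A" and r: "r \<in> B" "r' \<in> B" "r \<noteq> r'"
    and \<delta>: "0 \<le> \<delta>" "\<delta> \<le> real (card (J j \<inter> S r))" "\<delta> \<le> real (card (J j \<inter> S r'))"
  shows "\<delta> / 2 * hel (frac_below x u (J j \<inter> S r)) (frac_below x u (J j \<inter> S r'))
    \<le> (\<Sum>j\<in>A. \<Sum>k\<in>B. real (card (J j \<inter> S k)) *
          bkl (frac_below x u (J j \<inter> S k)) (frac_below x u (J j)))"
proof -
  let ?f = "frac_below x u"
  let ?g = "\<lambda>j k. real (card (J j \<inter> S k)) * bkl (?f (J j \<inter> S k)) (?f (J j))"
  have ge: "hel (?f (J j \<inter> S k)) (?f (J j)) * real (card (J j \<inter> S k)) \<le> ?g j k" if "j \<in> A" for j k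
    using fin(3)[OF that] by (intro card_hel_le_card_bkl_superset) auto
  have nonneg: "0 \<le> ?g j k" if "j \<in> A" for j k
    by (rule order_trans[OF mult_nonneg_nonneg[OF hel_nonneg of_nat_0_le_iff] ge[OF that]])
  have ge\<delta>: "\<delta> * hel (?f (J j \<inter> S k)) (?f (J j)) \<le> ?g j k" if "\<delta> \<le> real (card (J j \<inter> S k))" for k
  proof -
    have "\<delta> * hel (?f (J j \<inter> S k)) (?f (J j)) \<le> real (card (J j \<inter> S k)) * hel (?f (J j \<inter> S k)) (?f (J j))"
      using that by (intro mult_right_mono hel_nonneg)
    then show ?thesis
      using ge[OF j, of k] by (simp add: mult.commute)
  qed
  have "\<delta> / 2 * hel (?f (J j \<inter> S r)) (?f (J j \<inter> S r'))
      \<le> \<delta> / 2 * (2 * hel (?f (J j \<inter> S r)) (?f (J j)) + 2 * hel (?f (J j)) (?f (J j \<inter> S r')))"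
    using \<delta> by (intro mult_left_mono hel_triangle) auto
  also have "\<dots> = \<delta> * hel (?f (J j \<inter> S r)) (?f (J j)) + \<delta> * hel (?f (J j \<inter> S r')) (?f (J j))"
    by (simp add: algebra_simps hel_commute)
  also have "\<dots> \<le> ?g j r + ?g j r'"
    by (intro add_mono ge\<delta> \<delta>)
  also have "\<dots> = (\<Sum>k\<in>{r, r'}. ?g j k)"
    using r by simp
  also have "\<dots> \<le> (\<Sum>k\<in>B. ?g j k)"
    using r fin by (intro sum_mono2 nonneg) (auto simp: j)
  also have "\<dots> = (\<Sum>j\<in>{j}. \<Sum>k\<in>B. ?g j k)"
    by simp
  also have "\<dots> \<le> (\<Sum>j\<in>A. \<Sum>k\<in>B. ?g j k)"
    using j fin by (intro sum_mono2 sum_nonneg nonneg) auto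
  finally show ?thesis .
qed

section \<open>Exponential inequalities\<close>

context prob_space
begin

text \<open>
  A Chernoff bound for the divergence itself, because this is what the likelihood produces and
  because it remains sharp for probabilities near 0 and 1.

  For every value \<open>a\<close> of the empirical frequency, the likelihood ratio of the success
  probabilities \<open>a\<close> and \<open>p\<close> has expectation 1 under \<open>p\<close>, and on the event that the
  frequency is \<open>a\<close> it equals \<open>exp (m * bkl a p)\<close>. Summing the Markov bounds over the
  \<open>m + 1\<close> possible values avoids any monotonicity argument for the tails.
\<close>

lemma prob_bkl_frac_below_gt:
  fixes X :: "nat \<Rightarrow> 'a \<Rightarrow> real"
  assumes indep: "indep_vars (\<lambda>_. borel) X I" and fin: "finite I" "I \<noteq> {}"
    and p: "0 < p" "p < 1"
    and prob_le: "\<And>i. i \<in> I \<Longrightarrow> prob {\<omega> \<in> space M. X i \<omega> \<le> u} = p"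
  shows "prob {\<omega> \<in> space M. t < real (card I) * bkl (frac_below (\<lambda>i. X i \<omega>) u I) p}
    \<le> (real (card I) + 1) * exp (- t)"
proof -
  define m where "m = card I"
  have m: "0 < m"
    using fin by (simp add: m_def card_gt_0_iff)
  have [measurable]: "random_variable borel (X i)" if "i \<in> I" for i
    using indep that by (auto simp: indep_vars_def)
  define N where "N \<omega> = card {i \<in> I. X i \<omega> \<le> u}" for \<omega>
  have N_le: "N \<omega> \<le> m" for \<omega>
    using fin by (auto simp: N_def m_def intro!: card_mono)
  define E where "E k = {\<omega> \<in> space M. N \<omega> = k \<and> t < real m * bkl (real k / real m) p}" for k
  have N_eq: "real (N \<omega>) = (\<Sum>i\<in>I. if X i \<omega> \<le> u then 1 else 0)" for \<omega>
    using fin by (simp add: N_def sum.If_cases Collect_conj_eq)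
  have [measurable]: "(\<lambda>\<omega>. real (N \<omega>)) \<in> borel_measurable M"
    unfolding N_eq by measurable
  have E_sets: "E k \<in> events" for k
  proof -
    have "E k = {\<omega> \<in> space M. real (N \<omega>) = real k \<and> t < real m * bkl (real k / real m) p}"
      by (auto simp: E_def)
    also have "\<dots> \<in> events"
      by measurable
    finally show ?thesis .
  qed
  have prob_E: "prob (E k) \<le> exp (- t)" if "k \<le> m" for k
  proof (cases "t < real m * bkl (real k / real m) p")
    case True
    define a where "a = real k / real m"
    (* the likelihood ratio of a against p for a single observation *)
    have a: "0 \<le> a" "a \<le> 1"
      using that m by (auto simp: a_def)
    define Y where "Y i \<omega> = (if X i \<omega> \<le> u then a / p else (1 - a) / (1 - p))" for i \<omega>
    have Y_nonneg: "0 \<le> Y i \<omega>" for i \<omega>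
      using a p by (simp add: Y_def)
    have Y_bounded: "norm (Y i \<omega>) \<le> a / p + (1 - a) / (1 - p)" for i \<omega>
      using a p by (simp add: Y_def)
    have Y_meas [measurable]: "Y i \<in> borel_measurable M" if "i \<in> I" for i
      using that unfolding Y_def by measurable
    have Y_int: "integrable M (Y i)" if "i \<in> I" for i
      using that Y_bounded by (intro integrable_const_bound[where B = "a / p + (1 - a) / (1 - p)"]) auto
    have Y_indep: "indep_vars (\<lambda>_. borel) Y I"
      unfolding Y_def by (rule indep_vars_compose2[OF indep]) measurable
    have Y_mean: "expectation (Y i) = 1" if i: "i \<in> I" for i
    proof -
      let ?A = "{\<omega> \<in> space M. X i \<omega> \<le> u}"
      have A [measurable]: "?A \<in> events"
        using i by measurable
      have [simp]: "integrable M (indicat_real ?A)"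
        using A by (intro integrable_real_indicator) (auto simp: emeasure_eq_measure)
      have "expectation (Y i) = expectation (\<lambda>\<omega>. (1 - a) / (1 - p)
          + (a / p - (1 - a) / (1 - p)) * indicator ?A \<omega>)"
        by (intro Bochner_Integration.integral_cong) (auto simp: Y_def indicator_def)
      also have "\<dots> = (1 - a) / (1 - p) + (a / p - (1 - a) / (1 - p)) * prob ?A"
        using A by (subst Bochner_Integration.integral_add) (auto simp: prob_space)
      also have "\<dots> = (1 - a) / (1 - p) * (1 - p) + a / p * p"
        unfolding prob_le[OF i] by (simp only: algebra_simps)
      also have "\<dots> = 1"
        using p by simp
      finally show ?thesis .
    qed
    have prod_Y: "(\<Prod>i\<in>I. Y i \<omega>) = exp (real m * bkl a p)" if "N \<omega> = k" for \<omega>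
    proof -
      have pow: "r ^ j = exp (real j * ln r)" if "0 < r \<or> j = 0" for r :: real and j
        using that by (auto simp: exp_of_nat_mult)
      have "card (I \<inter> - {i. X i \<omega> \<le> u}) = m - k"
      proof -
        have "I \<inter> - {i. X i \<omega> \<le> u} = I - {i \<in> I. X i \<omega> \<le> u}"
          by auto
        then show ?thesis
          using fin that by (simp add: card_Diff_subset m_def N_def)
      qed
      moreover have "I \<inter> {i. X i \<omega> \<le> u} = {i \<in> I. X i \<omega> \<le> u}"
        by auto
      ultimately have "(\<Prod>i\<in>I. Y i \<omega>) = (a / p) ^ k * ((1 - a) / (1 - p)) ^ (m - k)"
        using fin that unfolding Y_def by (simp add: prod.If_cases N_def)
      also have "(a / p) ^ k = exp (real k * ln (a / p))"
        using p m by (intro pow) (auto simp: a_def)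
      also have "((1 - a) / (1 - p)) ^ (m - k) = exp (real (m - k) * ln ((1 - a) / (1 - p)))"
        using p m \<open>k \<le> m\<close> by (intro pow) (auto simp: a_def)
      also have "exp (real k * ln (a / p)) * exp (real (m - k) * ln ((1 - a) / (1 - p)))
          = exp (real m * bkl a p)"
      proof -
        have "real k = real m * a" "real (m - k) = real m * (1 - a)"
          using m \<open>k \<le> m\<close> by (simp_all add: a_def of_nat_diff field_simps)
        then show ?thesis
          by (simp add: bkl_def exp_add[symmetric] distrib_left)
      qed
      finally show ?thesis .
    qed
    have "prob (E k) = expectation (indicator (E k))"
      using E_sets by simp
    also have "\<dots> \<le> expectation (\<lambda>\<omega>. exp (- t) * (\<Prod>i\<in>I. Y i \<omega>))"
    proof (rule integral_mono)
      show "integrable M (\<lambda>\<omega>. exp (- t) * (\<Prod>i\<in>I. Y i \<omega>))"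
        by (intro integrable_mult_right indep_vars_integrable fin Y_indep Y_int)
      show "indicator (E k) \<omega> \<le> exp (- t) * (\<Prod>i\<in>I. Y i \<omega>)" for \<omega>
      proof (cases "\<omega> \<in> E k")
        case True
        then have "exp (- t) * (\<Prod>i\<in>I. Y i \<omega>) = exp (real m * bkl a p - t)" "t < real m * bkl a p"
          by (auto simp: E_def prod_Y exp_diff exp_minus a_def field_simps)
        then show ?thesis
          using True by simp
      qed (auto intro!: mult_nonneg_nonneg prod_nonneg Y_nonneg)
    qed (use E_sets in \<open>auto intro!: integrable_real_indicator simp: emeasure_eq_measure\<close>)
    also have "\<dots> = exp (- t) * (\<Prod>i\<in>I. expectation (Y i))"
      by (simp add: indep_vars_lebesgue_integral[OF fin(1) Y_indep Y_int])
    also have "\<dots> = exp (- t)"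
      by (simp add: Y_mean)
    finally show ?thesis .
  qed (simp add: E_def)
  have "{\<omega> \<in> space M. t < real (card I) * bkl (frac_below (\<lambda>i. X i \<omega>) u I) p} = (\<Union>k\<in>{..m}. E k)"
    using N_le by (auto simp: E_def frac_below_def m_def N_def)
  then have "prob {\<omega> \<in> space M. t < real (card I) * bkl (frac_below (\<lambda>i. X i \<omega>) u I) p}
      \<le> (\<Sum>k\<in>{..m}. prob (E k))"
    using E_sets by (simp add: finite_measure_subadditive_finite image_subset_iff)
  also have "\<dots> \<le> (\<Sum>k\<in>{..m}. exp (- t))"
    by (intro sum_mono prob_E) auto
  finally show ?thesis
    by (simp add: m_def add.commute)
qed

text \<open>
  A sum of independent variables in \<open>[0, B]\<close> rarely falls below a quarter of its mean:
  \<open>exp (- y) \<le> 1 - y / 2\<close> on \<open>[0, 1]\<close> bounds the Laplace transform at \<open>1 / B\<close>.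
\<close>

lemma prob_sum_le_quarter_mean:
  fixes Y :: "nat \<Rightarrow> 'a \<Rightarrow> real"
  assumes indep: "indep_vars (\<lambda>_. borel) Y I" and fin: "finite I"
    and Y: "\<And>i \<omega>. i \<in> I \<Longrightarrow> 0 \<le> Y i \<omega>" "\<And>i \<omega>. i \<in> I \<Longrightarrow> Y i \<omega> \<le> B" and B: "0 < B"
    and \<mu>: "\<mu> = (\<Sum>i\<in>I. expectation (Y i))"
  shows "prob {\<omega> \<in> space M. (\<Sum>i\<in>I. Y i \<omega>) \<le> \<mu> / 4} \<le> exp (- \<mu> / (4 * B))"
proof -
  have [measurable]: "Y i \<in> borel_measurable M" if "i \<in> I" for i
    using indep that by (auto simp: indep_vars_def)
  have Y_int: "integrable M (Y i)" if "i \<in> I" for i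
    using that Y by (intro integrable_const_bound[where B = B]) (auto simp: abs_le_iff intro: order_trans)
  define Z where "Z i \<omega> = exp (- (Y i \<omega> / B))" for i \<omega>
  have Z_indep: "indep_vars (\<lambda>_. borel) Z I"
    unfolding Z_def by (rule indep_vars_compose2[OF indep]) measurable
  have [measurable]: "Z i \<in> borel_measurable M" if "i \<in> I" for i
    using that unfolding Z_def by measurable
  have Z_int: "integrable M (Z i)" if "i \<in> I" for i
    using that Y B by (intro integrable_const_bound[where B = 1]) (auto simp: Z_def)
  have exp_le: "exp (- y) \<le> 1 - y / 2" if "0 \<le> y" "y \<le> 1" for y :: real
  proof -
    have "(1 - y / 2) * (1 + y) = 1 + y * (1 - y) / 2"
      by (simp add: field_simps)
    then have "1 \<le> (1 - y / 2) * (1 + y)"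
      using that by simp
    also have "\<dots> \<le> (1 - y / 2) * exp y"
      using that by (intro mult_left_mono exp_ge_add_one_self) auto
    finally show ?thesis
      by (simp add: exp_minus field_simps)
  qed
  have Z_mean: "expectation (Z i) \<le> exp (- expectation (Y i) / (2 * B))" if "i \<in> I" for i
  proof -
    have "expectation (Z i) \<le> expectation (\<lambda>\<omega>. 1 - Y i \<omega> / (2 * B))"
    proof (rule integral_mono[OF Z_int[OF that]])
      show "Z i \<omega> \<le> 1 - Y i \<omega> / (2 * B)" for \<omega>
        using exp_le[of "Y i \<omega> / B"] Y[OF that] B by (simp add: Z_def mult.commute)
    qed (use Y_int[OF that] in auto)
    also have "\<dots> = 1 - expectation (Y i) / (2 * B)"
      using Y_int[OF that] by (simp add: prob_space)
    also have "\<dots> \<le> exp (- expectation (Y i) / (2 * B))"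
      using exp_ge_add_one_self[of "- expectation (Y i) / (2 * B)"] by simp
    finally show ?thesis .
  qed
  let ?A = "{\<omega> \<in> space M. (\<Sum>i\<in>I. Y i \<omega>) \<le> \<mu> / 4}"
  have A: "?A \<in> events"
    by measurable
  have "prob ?A = expectation (indicator ?A)"
    using A by simp
  also have "\<dots> \<le> expectation (\<lambda>\<omega>. exp (\<mu> / (4 * B)) * (\<Prod>i\<in>I. Z i \<omega>))"
  proof (rule integral_mono)
    show "integrable M (\<lambda>\<omega>. exp (\<mu> / (4 * B)) * (\<Prod>i\<in>I. Z i \<omega>))"
      by (intro integrable_mult_right indep_vars_integrable fin Z_indep Z_int)
    show "indicator ?A \<omega> \<le> exp (\<mu> / (4 * B)) * (\<Prod>i\<in>I. Z i \<omega>)" for \<omega>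
    proof -
      have "exp (\<mu> / (4 * B)) * (\<Prod>i\<in>I. Z i \<omega>) = exp ((\<mu> / 4 - (\<Sum>i\<in>I. Y i \<omega>)) / B)"
        using fin by (simp add: Z_def exp_sum[symmetric] exp_add[symmetric] sum_negf
            sum_divide_distrib[symmetric] diff_divide_distrib)
      then show ?thesis
        using B by (auto simp: indicator_def)
    qed
  qed (use A in \<open>auto intro!: integrable_real_indicator simp: emeasure_eq_measure\<close>)
  also have "\<dots> = exp (\<mu> / (4 * B)) * (\<Prod>i\<in>I. expectation (Z i))"
    by (simp add: indep_vars_lebesgue_integral[OF fin Z_indep Z_int])
  also have "\<dots> \<le> exp (\<mu> / (4 * B)) * (\<Prod>i\<in>I. exp (- expectation (Y i) / (2 * B)))"
    using Z_mean by (intro mult_left_mono prod_mono conjI Bochner_Integration.integral_nonneg)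
      (auto simp: Z_def)
  also have "\<dots> = exp (\<mu> / (4 * B) - \<mu> / (2 * B))"
    using fin by (simp add: exp_sum[symmetric] exp_add[symmetric] sum_negf
        sum_divide_distrib[symmetric] \<mu>)
  also have "\<mu> / (4 * B) - \<mu> / (2 * B) = - \<mu> / (4 * B)"
    using B by (simp add: field_simps)
  finally show ?thesis .
qed

end

section \<open>The pooled distribution\<close>

lemma (in real_distribution) cdf_attains:
  assumes "continuous_on UNIV (cdf M)" "0 < s" "s < 1"
  shows "\<exists>x. cdf M x = s"
proof -
  have "eventually (\<lambda>x. cdf M x < s) at_bot" "eventually (\<lambda>x. s < cdf M x) at_top"
    using assms cdf_lim_at_bot cdf_lim_at_top_prob by (auto dest: order_tendstoD)
  then obtain a b where a: "\<And>x. x \<le> a \<Longrightarrow> cdf M x < s" and b: "\<And>x. b \<le> x \<Longrightarrow> s < cdf M x"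
    unfolding eventually_at_bot_linorder eventually_at_top_linorder by blast
  have "\<exists>x\<ge>min a b. x \<le> max a b \<and> cdf M x = s"
    using a[of "min a b"] b[of "max a b"] assms(1)
    by (intro IVT') (auto intro: continuous_on_subset less_imp_le)
  then show ?thesis
    by blast
qed

text \<open>
  Half of the probability integral transform; it measures how much of a sample lies in the
  extreme tails of its own distribution.
\<close>

lemma (in real_distribution) prob_cdf_less:
  assumes cont: "continuous_on UNIV (cdf M)" and "0 \<le> s"
  shows "measure M {u. cdf M u < s} \<le> s"
    and "measure M {u. 1 - cdf M u < s} \<le> s"
proof -
  consider "s = 0" | "0 < s" "s < 1" | "1 \<le> s"
    using assms by linarith
  then have "measure M {u. cdf M u < s} \<le> s \<and> measure M {u. 1 - cdf M u < s} \<le> s"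
  proof cases
    case 1
    then have "{u. cdf M u < s} = {}" "{u. 1 - cdf M u < s} = {}"
      using cdf_nonneg cdf_bounded_prob by (auto simp: not_less)
    then show ?thesis
      by (simp only: 1 measure_empty order_refl simp_thms)
  next
    case 2
    then obtain x where x: "cdf M x = s"
      using cdf_attains[OF cont] by blast
    have "{u. cdf M u < s} \<subseteq> {..x}"
    proof
      fix u assume "u \<in> {u. cdf M u < s}"
      then show "u \<in> {..x}"
        using cdf_nondecreasing[of x u] x by (cases "u \<le> x") auto
    qed
    then have "measure M {u. cdf M u < s} \<le> measure M {..x}"
      by (intro finite_measure_mono) auto
    then have 1: "measure M {u. cdf M u < s} \<le> s"
      using x by (simp add: cdf_def)
    obtain y where y: "cdf M y = 1 - s"
      using cdf_attains[OF cont, of "1 - s"] 2 by auto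
    have "{u. 1 - cdf M u < s} \<subseteq> UNIV - {..y}"
    proof
      fix u assume "u \<in> {u. 1 - cdf M u < s}"
      then show "u \<in> UNIV - {..y}"
        using cdf_nondecreasing[of u y] y by (cases "u \<le> y") auto
    qed
    then have "measure M {u. 1 - cdf M u < s} \<le> measure M (UNIV - {..y})"
      by (intro finite_measure_mono) auto
    also have "\<dots> = 1 - cdf M y"
      using prob_compl[of "{..y}"] by (simp add: cdf_def)
    finally show ?thesis
      using 1 y by simp
  next
    case 3
    then show ?thesis
      using prob_le_1 order_trans by blast
  qed
  then show "measure M {u. cdf M u < s} \<le> s" "measure M {u. 1 - cdf M u < s} \<le> s"
    by auto
qed

lemma (in real_distribution) interval_measure_cdf: "interval_measure (cdf M) = M"
proof (rule cdf_unique)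
  show "real_distribution (interval_measure (cdf M))"
    using cdf_nondecreasing cdf_is_right_cont cdf_lim_at_bot cdf_lim_at_top_prob
    by (intro real_distribution_interval_measure) auto
  show "cdf (interval_measure (cdf M)) = cdf M"
    using cdf_nondecreasing cdf_is_right_cont cdf_lim_at_bot
    by (intro cdf_interval_measure) auto
qed (rule real_distribution_axioms)

text \<open>
  The average of the C.D.F.s of finitely many variables is the C.D.F. of the variable with a
  uniformly drawn index.
\<close>

lemma (in prob_space) interval_measure_average_cdf:
  fixes X :: "'i \<Rightarrow> 'a \<Rightarrow> real"
  assumes fin: "finite I" "I \<noteq> {}" and X: "\<And>i. i \<in> I \<Longrightarrow> random_variable borel (X i)"
    and P: "\<And>u. P u = (\<Sum>i\<in>I. cdf (distr M borel (X i)) u) / real (card I)"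
  shows "real_distribution (interval_measure P)" "cdf (interval_measure P) = P"
    and "\<And>f. f \<in> borel_measurable borel \<Longrightarrow>
      (\<integral>\<^sup>+u. f u \<partial>interval_measure P) = (\<Sum>i\<in>I. \<integral>\<^sup>+\<omega>. f (X i \<omega>) \<partial>M) / real (card I)"
proof -
  define Y where "Y i = (if i \<in> I then X i else (\<lambda>_. 0))" for i
  define \<nu> where "\<nu> = measure_pmf (pmf_of_set I) \<bind> (\<lambda>i. distr M borel (Y i))"
  have [measurable]: "random_variable borel (Y i)" for i
    using X by (auto simp: Y_def)
  have dist: "prob_space (distr M borel (Y i))" for i
    by (intro prob_space_distr) measurable
  have ker: "(\<lambda>i. distr M borel (Y i)) \<in> measurable (measure_pmf (pmf_of_set I)) (subprob_algebra borel)"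
    using dist by (auto simp: space_subprob_algebra prob_space_imp_subprob_space)
  have sets_\<nu>: "sets \<nu> = sets borel"
    unfolding \<nu>_def by (rule sets_bind) (auto simp: sets_kernel)
  have nn: "(\<integral>\<^sup>+u. f u \<partial>\<nu>) = (\<Sum>i\<in>I. \<integral>\<^sup>+\<omega>. f (X i \<omega>) \<partial>M) / real (card I)"
    if "f \<in> borel_measurable borel" for f
  proof -
    have "(\<integral>\<^sup>+u. f u \<partial>\<nu>) = (\<Sum>i\<in>I. \<integral>\<^sup>+u. f u \<partial>distr M borel (Y i)) / real (card I)"
      unfolding \<nu>_def using fin that
      by (subst nn_integral_bind[OF _ ker]) (auto simp: nn_integral_pmf_of_set ennreal_of_nat_eq_real_of_nat)
    also have "(\<Sum>i\<in>I. \<integral>\<^sup>+u. f u \<partial>distr M borel (Y i)) = (\<Sum>i\<in>I. \<integral>\<^sup>+\<omega>. f (X i \<omega>) \<partial>M)"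
      using that by (intro sum.cong refl, subst nn_integral_distr) (auto simp: Y_def X)
    finally show ?thesis .
  qed
  have emeasure_\<nu>: "emeasure \<nu> (space \<nu>) = 1"
  proof -
    have pos: "0 < real (card I)"
      using fin by (simp add: card_gt_0_iff)
    have "emeasure \<nu> (space \<nu>) = (\<Sum>i\<in>I. \<integral>\<^sup>+\<omega>. 1 \<partial>M) / ennreal (real (card I))"
      using nn[of "\<lambda>_. 1"] by (simp only: nn_integral_const mult_1 borel_measurable_const)
    also have "(\<Sum>i\<in>I. \<integral>\<^sup>+\<omega>. 1 \<partial>M) = ennreal (real (card I))"
      by (simp only: nn_integral_const emeasure_space_1 mult_1 sum_constant mult_1_right
          ennreal_of_nat_eq_real_of_nat)
    also have "ennreal (real (card I)) / ennreal (real (card I)) = ennreal (real (card I) / real (card I))"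
      using pos by (intro divide_ennreal) auto
    also have "\<dots> = 1"
      using pos by simp
    finally show ?thesis .
  qed
  interpret \<nu>: prob_space \<nu>
    by (rule prob_spaceI[OF emeasure_\<nu>])
  interpret \<nu>: real_distribution \<nu>
    by unfold_locales (rule sets_\<nu>)
  have "cdf \<nu> u = P u" for u
  proof -
    have "ennreal (cdf \<nu> u) = emeasure \<nu> {..u}"
      by (simp add: cdf_def \<nu>.emeasure_eq_measure)
    also have "\<dots> = (\<integral>\<^sup>+v. indicator {..u} v \<partial>\<nu>)"
      by simp
    also have "\<dots> = (\<Sum>i\<in>I. \<integral>\<^sup>+\<omega>. indicator {..u} (X i \<omega>) \<partial>M) / real (card I)"
      by (rule nn) simp
    also have "(\<Sum>i\<in>I. \<integral>\<^sup>+\<omega>. indicator {..u} (X i \<omega>) \<partial>M) = (\<Sum>i\<in>I. ennreal (cdf (distr M borel (X i)) u))"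
    proof (rule sum.cong[OF refl])
      fix i assume i: "i \<in> I"
      interpret D: prob_space "distr M borel (X i)"
        using X[OF i] by (rule prob_space_distr)
      have "(\<integral>\<^sup>+\<omega>. indicator {..u} (X i \<omega>) \<partial>M) = (\<integral>\<^sup>+v. indicator {..u} v \<partial>distr M borel (X i))"
        using X[OF i] by (subst nn_integral_distr) auto
      then show "(\<integral>\<^sup>+\<omega>. indicator {..u} (X i \<omega>) \<partial>M) = ennreal (cdf (distr M borel (X i)) u)"
        by (simp add: cdf_def D.emeasure_eq_measure)
    qed
    also have "\<dots> = ennreal (\<Sum>i\<in>I. cdf (distr M borel (X i)) u)"
      by (intro sum_ennreal) (auto simp: cdf_def)
    also have "\<dots> / real (card I) = ennreal (P u)"
      using fin unfolding P by (intro divide_ennreal sum_nonneg) (auto simp: cdf_def card_gt_0_iff)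
    finally have "ennreal (cdf \<nu> u) = ennreal (P u)" .
    moreover have "0 \<le> P u"
      unfolding P by (intro divide_nonneg_nonneg sum_nonneg) (simp_all add: cdf_def)
    ultimately show ?thesis
      using ennreal_inj[of "cdf \<nu> u" "P u"] by (simp add: \<nu>.cdf_nonneg)
  qed
  then have P_eq: "P = cdf \<nu>"
    by auto
  then have "interval_measure P = \<nu>"
    using \<nu>.interval_measure_cdf by simp
  then show "real_distribution (interval_measure P)" "cdf (interval_measure P) = P"
    "\<And>f. f \<in> borel_measurable borel \<Longrightarrow>
      (\<integral>\<^sup>+u. f u \<partial>interval_measure P) = (\<Sum>i\<in>I. \<integral>\<^sup>+\<omega>. f (X i \<omega>) \<partial>M) / real (card I)"
    using nn \<nu>.real_distribution_axioms P_eq by (simp_all only: )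
qed

section \<open>Order statistics and weights\<close>

lemma sorted_nth_le_iff:
  fixes ys :: "'b::linorder list"
  assumes "sorted ys" "1 \<le> l" "l \<le> length ys"
  shows "ys ! (l - 1) \<le> u \<longleftrightarrow> l \<le> length (filter (\<lambda>y. y \<le> u) ys)"
proof
  assume *: "ys ! (l - 1) \<le> u"
  have "{..<l} \<subseteq> {i. i < length ys \<and> ys ! i \<le> u}"
  proof
    fix i assume "i \<in> {..<l}"
    moreover from this have "ys ! i \<le> ys ! (l - 1)"
      using assms by (intro sorted_nth_mono) auto
    ultimately show "i \<in> {i. i < length ys \<and> ys ! i \<le> u}"
      using * assms by simp
  qed
  then have "card {..<l} \<le> card {i. i < length ys \<and> ys ! i \<le> u}"
    by (intro card_mono) auto
  then show "l \<le> length (filter (\<lambda>y. y \<le> u) ys)"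
    by (simp add: length_filter_conv_card)
next
  assume *: "l \<le> length (filter (\<lambda>y. y \<le> u) ys)"
  show "ys ! (l - 1) \<le> u"
  proof (rule ccontr)
    assume not: "\<not> ys ! (l - 1) \<le> u"
    have "{i. i < length ys \<and> ys ! i \<le> u} \<subseteq> {..<l - 1}"
    proof
      fix i assume "i \<in> {i. i < length ys \<and> ys ! i \<le> u}"
      then have i: "i < length ys" "ys ! i \<le> u"
        by auto
      show "i \<in> {..<l - 1}"
      proof (rule ccontr)
        assume "i \<notin> {..<l - 1}"
        then have "ys ! (l - 1) \<le> ys ! i"
          using assms i by (intro sorted_nth_mono) auto
        then show False
          using not i by simp
      qed
    qed
    then have "card {i. i < length ys \<and> ys ! i \<le> u} \<le> card {..<l - 1}"
      by (intro card_mono) auto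
    then show False
      using * assms by (simp add: length_filter_conv_card)
  qed
qed

lemma order_stat_le_iff:
  assumes "1 \<le> l" "l \<le> n"
  shows "order_stat n x l \<le> u \<longleftrightarrow> l \<le> card {i \<in> {1..n}. x i \<le> u}"
proof -
  have "order_stat n x l \<le> u
      \<longleftrightarrow> l \<le> length (filter (\<lambda>y. y \<le> u) (sort (map x [1..<n + 1])))"
    unfolding order_stat_def using assms by (intro sorted_nth_le_iff) auto
  also have "length (filter (\<lambda>y. y \<le> u) (sort (map x [1..<n + 1])))
      = length (filter (\<lambda>i. x i \<le> u) [1..<n + 1])"
    by (simp add: filter_sort filter_map o_def del: upt_Suc)
  also have "\<dots> = card (set (filter (\<lambda>i. x i \<le> u) [1..<n + 1]))"
    by (rule distinct_card[symmetric]) simp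
  also have "set (filter (\<lambda>i. x i \<le> u) [1..<n + 1]) = {i \<in> {1..n}. x i \<le> u}"
    by (auto simp del: upt_Suc)
  finally show ?thesis .
qed

lemma sum_order_stat:
  fixes f :: "real \<Rightarrow> real"
  shows "(\<Sum>l = 1..n. f (order_stat n x l)) = (\<Sum>i = 1..n. f (x i))"
proof -
  let ?xs = "map x [1..<n + 1]"
  have "(\<Sum>l = 1..n. f (order_stat n x l)) = (\<Sum>l<n. f (sort ?xs ! l))"
    unfolding order_stat_def by (rule sum.reindex_bij_witness[of _ Suc "\<lambda>l. l - 1"]) auto
  also have "\<dots> = sum_list (map f (sort ?xs))"
    by (subst sum_list_sum_nth) (simp add: atLeast0LessThan del: upt_Suc)
  also have "\<dots> = sum_list (map f ?xs)"
  proof -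
    have "sum_mset (mset (map f (sort ?xs))) = sum_mset (mset (map f ?xs))"
      by (simp only: mset_map mset_sort)
    then show ?thesis
      by (simp only: sum_mset_sum_list)
  qed
  also have "\<dots> = (\<Sum>i = 1..n. f (x i))"
    by (subst map_map, subst sum_list_distinct_conv_sum_set)
      (auto simp: o_def atLeastLessThanSuc_atLeastAtMost simp del: upt_Suc)
  finally show ?thesis .
qed

text \<open>
  The weight of the threshold given by the \<open>l\<close>-th order statistic, including the leading factor
  \<open>n\<close> of the objective function. At that threshold \<open>weight n l\<close> approximates
  \<open>1 / (n * P * (1 - P))\<close> for the pooled C.D.F. \<open>P\<close>.
\<close>

definition weight :: "nat \<Rightarrow> nat \<Rightarrow> real" where
  "weight n l = real n / (real l * real (n - l))"

lemma weight_nonneg: "0 \<le> weight n l"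
  by (simp add: weight_def)

lemma harmonic_sum_le: "1 \<le> n \<Longrightarrow> (\<Sum>l = 1..n. 1 / real l) \<le> 1 + ln (real n)"
proof (induction n rule: nat_induct_at_least)
  case (Suc n)
  have "ln (real n / real (Suc n)) \<le> real n / real (Suc n) - 1"
    using Suc.hyps by (intro ln_le_minus_one) auto
  also have "\<dots> = - (1 / real (Suc n))"
    by (simp add: field_simps)
  finally have "1 / real (Suc n) \<le> ln (real (Suc n)) - ln (real n)"
    using Suc.hyps by (simp add: ln_div)
  then show ?case
    using Suc.IH by simp
qed simp

text \<open>
  Partial fractions \<open>n / (l * (n - l)) = 1 / l + 1 / (n - l)\<close> turn the sum into two
  harmonic sums.
\<close>

lemma sum_weight_le:
  assumes "3 \<le> n"
  shows "(\<Sum>l = 2..n - 1. weight n l) \<le> 4 * ln (real n)"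
proof -
  have "(\<Sum>l = 2..n - 1. weight n l) \<le> (\<Sum>l = 1..n - 1. weight n l)"
    by (intro sum_mono2 weight_nonneg) auto
  also have "\<dots> = (\<Sum>l = 1..n - 1. 1 / real l + 1 / real (n - l))"
    by (intro sum.cong) (auto simp: weight_def of_nat_diff field_simps)
  also have "\<dots> = (\<Sum>l = 1..n - 1. 1 / real l) + (\<Sum>l = 1..n - 1. 1 / real (n - l))"
    by (rule sum.distrib)
  also have "(\<Sum>l = 1..n - 1. 1 / real (n - l)) = (\<Sum>l = 1..n - 1. 1 / real l)"
    by (rule sum.reindex_bij_witness[of _ "\<lambda>l. n - l" "\<lambda>l. n - l"]) auto
  also have "(\<Sum>l = 1..n - 1. 1 / real l) \<le> 1 + ln (real (n - 1))"
    using assms by (intro harmonic_sum_le) auto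
  also have "ln (real (n - 1)) \<le> ln (real n)"
    using assms by simp
  also have "1 \<le> ln (real n)"
  proof -
    have "exp 1 \<le> real n"
      using assms exp_le by linarith
    then show ?thesis
      using assms by (subst ln_ge_iff) auto
  qed
  finally show ?thesis
    by (simp add: add_mono)
qed

section \<open>Partitions of the index range into consecutive blocks\<close>

lemma consecutive_blocks:
  fixes t :: "nat \<Rightarrow> nat"
  assumes "\<And>j. j < m \<Longrightarrow> t j \<le> t (Suc j)"
  shows "disjoint_family_on (\<lambda>j. {t j..<t (Suc j)}) {..<m}"
    and "(\<Union>j<m. {t j..<t (Suc j)}) = {t 0..<t m}"
proof -
  have "disjoint_family_on (\<lambda>j. {t j..<t (Suc j)}) {..<m}
      \<and> (\<Union>j<m. {t j..<t (Suc j)}) = {t 0..<t m} \<and> t 0 \<le> t m"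
    using assms
  proof (induction m)
    case (Suc m)
    then have IH: "disjoint_family_on (\<lambda>j. {t j..<t (Suc j)}) {..<m}"
      "(\<Union>j<m. {t j..<t (Suc j)}) = {t 0..<t m}" "t 0 \<le> t m"
      by (meson less_SucI)+
    have step: "t m \<le> t (Suc m)"
      using Suc.prems by simp
    have "(\<Union>j<Suc m. {t j..<t (Suc j)}) = {t 0..<t m} \<union> {t m..<t (Suc m)}"
      unfolding lessThan_Suc IH(2)[symmetric] by auto
    also have "\<dots> = {t 0..<t (Suc m)}"
      using IH(3) step by (intro ivl_disj_un)
    finally have "(\<Union>j<Suc m. {t j..<t (Suc j)}) = {t 0..<t (Suc m)}" .
    moreover have "disjoint_family_on (\<lambda>j. {t j..<t (Suc j)}) {..<Suc m}"
      unfolding lessThan_Suc using IH(1,2)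
      by (subst disjoint_family_on_insert) auto
    ultimately show ?case
      using IH(3) step by auto
  qed (auto simp: disjoint_family_on_def)
  then show "disjoint_family_on (\<lambda>j. {t j..<t (Suc j)}) {..<m}"
    "(\<Union>j<m. {t j..<t (Suc j)}) = {t 0..<t m}"
    by auto
qed

lemma R_obj_eq_weighted_sum:
  assumes "\<And>j. j \<le> Suc (length ts) \<Longrightarrow> (1 # ts @ [n + 1]) ! j = t j"
  shows "R_obj n x ts = (\<Sum>l = 2..n - 1. weight n l *
    (\<Sum>j<Suc (length ts). real (card {t j..<t (Suc j)}) *
      neg_entropy (frac_below x (order_stat n x l) {t j..<t (Suc j)})))"
proof -
  have *: "(1 # ts @ [n + 1]) ! k = t k \<and> (1 # ts @ [n + 1]) ! (k + 1) = t (Suc k)"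
    if "k \<in> {0..length ts}" for k
    using that assms[of k] assms[of "Suc k"] by simp
  have "R_obj n x ts = real n * (\<Sum>k = 0..length ts. \<Sum>l = 2..n - 1.
       real (t (Suc k) - t k) *
       neg_entropy (ecdf x (t k) (t (Suc k)) (order_stat n x l)) / (real l * real (n - l)))"
    unfolding R_obj_def Let_def
    by (intro arg_cong2[of _ _ _ _ "(*)"] refl sum.cong) (simp_all only: *)
  also have "\<dots> = (\<Sum>l = 2..n - 1. weight n l * (\<Sum>k = 0..length ts. real (t (Suc k) - t k) *
       neg_entropy (ecdf x (t k) (t (Suc k)) (order_stat n x l))))"
    by (subst sum.swap) (simp add: sum_distrib_left weight_def mult.assoc)
  finally show ?thesis
    by (simp add: ecdf_eq_frac_below atLeast0AtMost lessThan_Suc_atMost)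
qed

section \<open>Samples whose segments are uniformly well fitted\<close>

lemma card_above:
  fixes x :: "nat \<Rightarrow> real"
  shows "card {i \<in> {1..n}. u < x i} = n - card {i \<in> {1..n}. x i \<le> u}"
proof -
  have "{i \<in> {1..n}. u < x i} = {1..n} - {i \<in> {1..n}. x i \<le> u}"
    by auto
  moreover have "card ({1..n} - {i \<in> {1..n}. x i \<le> u}) = card {1..n} - card {i \<in> {1..n}. x i \<le> u}"
    by (intro card_Diff_subset) auto
  ultimately show ?thesis
    by simp
qed

definition change_points :: "nat \<Rightarrow> (nat \<Rightarrow> nat) \<Rightarrow> nat list" where
  "change_points K \<tau> = map \<tau> [1..<K + 1]"

lemma nth_candidate_mono:
  assumes "ts \<in> candidates n L" "0 < n" "i < j" "j \<le> Suc L"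
  shows "(1 # ts @ [n + 1]) ! i < (1 # ts @ [n + 1]) ! j"
proof -
  have "sorted_wrt (<) (1 # ts @ [n + 1])"
    using assms by (auto simp: candidates_def sorted_wrt_append)
  from sorted_wrt_nth_less[OF this, of i j] show ?thesis
    using assms by (auto simp: candidates_def)
qed

text \<open>
  The given C.D.F.s are numbered from 1, but the segments from 0 like the blocks of a candidate
  list. So segment \<open>j\<close> has C.D.F. \<open>F (Suc j)\<close> below.
\<close>

locale segmentation =
  fixes n K :: nat and \<tau> :: "nat \<Rightarrow> nat"
  assumes n3: "3 \<le> n"
    and tau_first: "\<tau> 0 = 1" and tau_last: "\<tau> (Suc K) = n + 1"
    and tau_step: "\<And>j. j \<le> K \<Longrightarrow> \<tau> j < \<tau> (Suc j)"
begin

abbreviation segment :: "nat \<Rightarrow> nat set" where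
  "segment j \<equiv> {\<tau> j..<\<tau> (Suc j)}"

lemma segments_partition:
  "disjoint_family_on segment {..<Suc K}" "(\<Union>j<Suc K. segment j) = {1..<n + 1}"
  using consecutive_blocks[of "Suc K" \<tau>] tau_step tau_first tau_last by (auto simp: less_imp_le)

lemma tau_mono: "i < j \<Longrightarrow> j \<le> Suc K \<Longrightarrow> \<tau> i < \<tau> j"
proof (induction j)
  case (Suc j)
  then show ?case
    using tau_step[of j] by (cases "i = j") auto
qed simp

lemma tau_ge_1: "j \<le> Suc K \<Longrightarrow> 1 \<le> \<tau> j"
  using tau_mono[of 0 j] tau_first by (cases "j = 0") auto

lemma tau_le: "j \<le> Suc K \<Longrightarrow> \<tau> j \<le> n + 1"
  using tau_mono[of j "Suc K"] tau_last by (cases "j = Suc K") auto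

lemma length_change_points: "length (change_points K \<tau>) = K"
  by (simp add: change_points_def del: upt_Suc)

lemma nth_change_points:
  assumes "j \<le> Suc K"
  shows "(1 # change_points K \<tau> @ [n + 1]) ! j = \<tau> j"
proof (cases j)
  case 0
  then show ?thesis
    using tau_first by simp
next
  case (Suc i)
  show ?thesis
  proof (cases "i < K")
    case True
    then have "(change_points K \<tau> @ [n + 1]) ! i = \<tau> ([1..<K + 1] ! i)"
      by (simp add: nth_append length_change_points del: upt_Suc)
        (simp add: change_points_def del: upt_Suc)
    also have "[1..<K + 1] ! i = Suc i"
      using True by (subst nth_upt) auto
    finally show ?thesis
      by (simp add: Suc)
  next
    case False
    then have "i = K"
      using assms Suc by simp
    then show ?thesis
      using tau_last by (simp add: Suc nth_append length_change_points)
  qed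
qed

lemma change_points_candidate: "change_points K \<tau> \<in> candidates n K"
proof -
  have "1 < \<tau> j \<and> \<tau> j \<le> n" if "1 \<le> j" "j \<le> K" for j
    using tau_mono[of 0 j] tau_mono[of j "Suc K"] tau_first tau_last that by auto
  moreover have "sorted_wrt (<) (map \<tau> [1..<K + 1])"
    using tau_mono by (auto simp: sorted_wrt_iff_nth_less simp del: upt_Suc)
  ultimately show ?thesis
    by (auto simp: candidates_def change_points_def less_Suc_eq_le simp del: upt_Suc)
qed

lemma pooled_cdf_eq: "real n * pooled_cdf n K \<tau> F u = (\<Sum>j<Suc K. real (card (segment j)) * F (Suc j) u)"
proof -
  have "(\<Sum>k = 1..K + 1. real (\<tau> k - \<tau> (k - 1)) * F k u) = (\<Sum>j<Suc K. real (card (segment j)) * F (Suc j) u)"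
    by (rule sum.reindex_bij_witness[of _ Suc "\<lambda>k. k - 1"]) auto
  then show ?thesis
    using n3 by (simp add: pooled_cdf_def)
qed

lemma sum_card_segments: "(\<Sum>j<Suc K. real (card (segment j))) = real n"
proof -
  have "card (\<Union>j<Suc K. segment j) = (\<Sum>j<Suc K. card (segment j))"
    using segments_partition(1) by (intro card_UN_disjoint) (auto simp: disjoint_family_on_def)
  moreover have "card {1..<n + 1} = n"
    by simp
  ultimately have "(\<Sum>j<Suc K. card (segment j)) = n"
    unfolding segments_partition(2) by (simp only:)
  then show ?thesis
    by (metis of_nat_sum)
qed

end

text \<open>
  Deterministic conditions on a sample \<open>x 1, \<dots>, x n\<close> under which the estimator is
  controlled: on every stretch \<open>a, \<dots>, b - 1\<close> inside a true segment the empirical frequency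
  of every half-line is within divergence \<open>s / (b - a)\<close> of a number \<open>q\<close> near the true
  probability. The number \<open>q\<close> takes the place of \<open>F (Suc j) u\<close> because the
  latter may be too close to 0 or 1 for a uniform bound.
\<close>

locale well_fitted_sample = segmentation +
  fixes F :: "nat \<Rightarrow> real \<Rightarrow> real" and x :: "nat \<Rightarrow> real" and s :: real
  assumes s_nonneg: "0 \<le> s"
    and F_nonneg: "\<And>j u. j \<le> K \<Longrightarrow> 0 \<le> F (Suc j) u"
    and F_le_1: "\<And>j u. j \<le> K \<Longrightarrow> F (Suc j) u \<le> 1"
    and fit: "\<And>j u. j \<le> K \<Longrightarrow> \<exists>q. 0 < q \<and> q < 1 \<and> \<bar>q - F (Suc j) u\<bar> \<le> 2 / real n \<and>
      (\<forall>a b. \<tau> j \<le> a \<longrightarrow> a < b \<longrightarrow> b \<le> \<tau> (Suc j) \<longrightarrow>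
        real (b - a) * bkl (frac_below x u {a..<b}) q \<le> s)"
begin

text \<open>
  The detour over \<open>q\<close> ends here: the distance \<open>hel\<close> of \<open>q\<close> from the true probability is at most
  \<open>4 / n\<close>, and a stretch has at most \<open>n\<close> observations.
\<close>

lemma card_hel_le:
  assumes "j \<le> K" "\<tau> j \<le> a" "a < b" "b \<le> \<tau> (Suc j)"
  shows "real (b - a) * hel (frac_below x u {a..<b}) (F (Suc j) u) \<le> 2 * s + 8"
proof -
  let ?p = "frac_below x u {a..<b}" and ?m = "real (b - a)"
  obtain q where q: "0 < q" "q < 1" "\<bar>q - F (Suc j) u\<bar> \<le> 2 / real n"
    and le: "?m * bkl ?p q \<le> s"
    using fit[OF assms(1), of u] assms by blast
  have "b - a \<le> n"
    using assms tau_ge_1[of j] tau_le[of "Suc j"] by linarith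
  then have m: "?m \<le> real n" "0 < ?m"
    using assms by auto
  have "?m * hel ?p (F (Suc j) u) \<le> ?m * (2 * hel ?p q + 2 * hel q (F (Suc j) u))"
    by (intro mult_left_mono hel_triangle) auto
  also have "\<dots> = 2 * (?m * hel ?p q) + 2 * (?m * hel q (F (Suc j) u))"
    by (simp add: algebra_simps)
  also have "?m * hel ?p q \<le> ?m * bkl ?p q"
    using q by (intro mult_left_mono hel_le_bkl frac_below_nonneg frac_below_le_1) auto
  also have "\<dots> \<le> s"
    by (rule le)
  also have "?m * hel q (F (Suc j) u) \<le> real n * (2 * (2 / real n))"
    using m q F_nonneg[OF assms(1)] F_le_1[OF assms(1)]
    by (intro mult_mono order_trans[OF hel_le_abs_diff] mult_left_mono hel_nonneg) auto
  also have "real n * (2 * (2 / real n)) = 4"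
    using n3 by simp
  finally show ?thesis
    by (simp add: mult_left_mono)
qed

section \<open>The objective function compared with its value at the true change-points\<close>

text \<open>
  What the proposal \<open>ts\<close> loses at the threshold \<open>u\<close> by not separating the segments inside its
  blocks.
\<close>

definition loss :: "nat list \<Rightarrow> real \<Rightarrow> real" where
  "loss ts u = (let t = (\<lambda>k. (1 # ts @ [n + 1]) ! k) in
    \<Sum>j<Suc (length ts). \<Sum>k<Suc K. real (card ({t j..<t (Suc j)} \<inter> segment k)) *
      bkl (frac_below x u ({t j..<t (Suc j)} \<inter> segment k)) (frac_below x u {t j..<t (Suc j)}))"

lemma candidate_blocks:
  assumes "ts \<in> candidates n L" and t: "t = (\<lambda>k. (1 # ts @ [n + 1]) ! k)"
  shows "disjoint_family_on (\<lambda>j. {t j..<t (Suc j)}) {..<Suc L}"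
    and "(\<Union>j<Suc L. {t j..<t (Suc j)}) = {1..<n + 1}"
proof -
  have "t j \<le> t (Suc j)" if "j < Suc L" for j
    using nth_candidate_mono[OF assms(1), of j "Suc j"] that t n3 by auto
  moreover have "t 0 = 1" "t (Suc L) = n + 1"
    using assms by (auto simp: candidates_def nth_append)
  ultimately show "disjoint_family_on (\<lambda>j. {t j..<t (Suc j)}) {..<Suc L}"
    "(\<Union>j<Suc L. {t j..<t (Suc j)}) = {1..<n + 1}"
    using consecutive_blocks[of "Suc L" t] by auto
qed

lemma loss_nonneg: "ts \<in> candidates n L \<Longrightarrow> 0 \<le> loss ts u"
  unfolding loss_def Let_def
  by (intro sum_nonneg order_trans[OF mult_nonneg_nonneg[OF hel_nonneg of_nat_0_le_iff]
        card_hel_le_card_bkl_superset]) auto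

lemma R_obj_plus_loss_le:
  assumes ts: "ts \<in> candidates n L"
  shows "R_obj n x ts + (\<Sum>l = 2..n - 1. weight n l * loss ts (order_stat n x l))
    \<le> R_obj n x (change_points K \<tau>) + 4 * ln (real n) * (real (Suc L * Suc K) * s)"
proof -
  define t where "t = (\<lambda>k. (1 # ts @ [n + 1]) ! k)"
  have len: "length ts = L"
    using ts by (simp add: candidates_def)
  let ?J = "\<lambda>j. {t j..<t (Suc j)}"
  have pointwise: "(\<Sum>j<Suc L. real (card (?J j)) * neg_entropy (frac_below x u (?J j))) + loss ts u
      \<le> (\<Sum>k<Suc K. real (card (segment k)) * neg_entropy (frac_below x u (segment k)))
        + real (Suc L * Suc K) * s" for u
  proof -
    have "\<exists>q. \<forall>k\<in>{..<Suc K}. 0 < q k \<and> q k < 1 \<and> (\<forall>a b. \<tau> k \<le> a \<longrightarrow> a < b \<longrightarrow> b \<le> \<tau> (Suc k) \<longrightarrow>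
        real (b - a) * bkl (frac_below x u {a..<b}) (q k) \<le> s)"
    proof (intro bchoice ballI)
      fix k assume "k \<in> {..<Suc K}"
      then show "\<exists>q. 0 < q \<and> q < 1 \<and> (\<forall>a b. \<tau> k \<le> a \<longrightarrow> a < b \<longrightarrow> b \<le> \<tau> (Suc k) \<longrightarrow>
          real (b - a) * bkl (frac_below x u {a..<b}) q \<le> s)"
        using fit[of k u] by (auto simp only: lessThan_iff less_Suc_eq_le)
    qed
    then obtain q where q: "\<And>k. k \<in> {..<Suc K} \<Longrightarrow> 0 < q k" "\<And>k. k \<in> {..<Suc K} \<Longrightarrow> q k < 1"
      and q_le: "\<And>k a b. k \<in> {..<Suc K} \<Longrightarrow> \<tau> k \<le> a \<Longrightarrow> a < b \<Longrightarrow> b \<le> \<tau> (Suc k) \<Longrightarrow>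
        real (b - a) * bkl (frac_below x u {a..<b}) (q k) \<le> s"
      by metis
    have noise: "real (card (?J j \<inter> segment k)) * bkl (frac_below x u (?J j \<inter> segment k)) (q k) \<le> s"
      if "k \<in> {..<Suc K}" for j k
    proof (cases "max (t j) (\<tau> k) < min (t (Suc j)) (\<tau> (Suc k))")
      case True
      then show ?thesis
        using q_le[OF that, of "max (t j) (\<tau> k)" "min (t (Suc j)) (\<tau> (Suc k))"] by simp
    next
      case False
      then have "?J j \<inter> segment k = {}"
        by auto
      then show ?thesis
        using s_nonneg by (simp only: card.empty of_nat_0 mult_zero_left)
    qed
    have "(\<Sum>j<Suc L. real (card (?J j)) * neg_entropy (frac_below x u (?J j)))
      + (\<Sum>j<Suc L. \<Sum>k<Suc K. real (card (?J j \<inter> segment k)) *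
          bkl (frac_below x u (?J j \<inter> segment k)) (frac_below x u (?J j)))
      \<le> (\<Sum>k<Suc K. real (card (segment k)) * neg_entropy (frac_below x u (segment k)))
        + real (card {..<Suc L} * card {..<Suc K}) * s"
      by (rule partition_entropy_comparison[OF _ _ _ candidate_blocks[OF ts t_def] segments_partition
            q noise]) auto
    then show ?thesis
      by (simp only: loss_def Let_def len t_def card_lessThan)
  qed
  have R: "R_obj n x ts = (\<Sum>l = 2..n - 1. weight n l *
      (\<Sum>j<Suc L. real (card (?J j)) * neg_entropy (frac_below x (order_stat n x l) (?J j))))"
    using R_obj_eq_weighted_sum[of ts n t x] by (simp only: len t_def)
  have R0: "R_obj n x (change_points K \<tau>) = (\<Sum>l = 2..n - 1. weight n l *
      (\<Sum>k<Suc K. real (card (segment k)) * neg_entropy (frac_below x (order_stat n x l) (segment k))))"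
    using R_obj_eq_weighted_sum[of "change_points K \<tau>" n \<tau> x] nth_change_points
    by (simp only: length_change_points)
  have "R_obj n x ts + (\<Sum>l = 2..n - 1. weight n l * loss ts (order_stat n x l))
      \<le> (\<Sum>l = 2..n - 1. weight n l * ((\<Sum>k<Suc K. real (card (segment k)) *
          neg_entropy (frac_below x (order_stat n x l) (segment k))) + real (Suc L * Suc K) * s))"
    unfolding R sum.distrib[symmetric] distrib_left[symmetric]
    by (intro sum_mono mult_left_mono pointwise weight_nonneg)
  also have "\<dots> = R_obj n x (change_points K \<tau>) + (\<Sum>l = 2..n - 1. weight n l) * (real (Suc L * Suc K) * s)"
    unfolding R0 by (simp only: distrib_left sum.distrib sum_distrib_right)
  also have "\<dots> \<le> R_obj n x (change_points K \<tau>) + 4 * ln (real n) * (real (Suc L * Suc K) * s)"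
    using s_nonneg by (intro add_left_mono mult_right_mono sum_weight_le n3) auto
  finally show ?thesis .
qed

lemma R_obj_le:
  assumes ts: "ts \<in> candidates n L"
  shows "R_obj n x ts \<le> R_obj n x (change_points K \<tau>) + 4 * ln (real n) * (real (Suc L * Suc K) * s)"
proof -
  have "0 \<le> (\<Sum>l = 2..n - 1. weight n l * loss ts (order_stat n x l))"
    by (intro sum_nonneg mult_nonneg_nonneg weight_nonneg loss_nonneg[OF ts])
  then show ?thesis
    using R_obj_plus_loss_le[OF ts] by linarith
qed

text \<open>
  Pigeonhole: the \<open>\<delta>\<close>-neighbourhoods of the change-points are disjoint, and there are fewer
  candidates than neighbourhoods.
\<close>

lemma missed_change_point:
  assumes ts: "ts \<in> candidates n L" and "L < K" and \<delta>: "\<And>j. j \<le> K \<Longrightarrow> 2 * \<delta> \<le> \<tau> (Suc j) - \<tau> j"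
  shows "\<exists>r<K. \<forall>t\<in>set ts. t \<le> \<tau> (Suc r) - \<delta> \<or> \<tau> (Suc r) + \<delta> \<le> t"
proof (rule ccontr)
  assume "\<not> ?thesis"
  then have "\<forall>r\<in>{..<K}. \<exists>t. t \<in> set ts \<and> \<tau> (Suc r) - \<delta> < t \<and> t < \<tau> (Suc r) + \<delta>"
    by (auto simp: not_le)
  then obtain f where f: "\<And>r. r < K \<Longrightarrow> f r \<in> set ts \<and> \<tau> (Suc r) - \<delta> < f r \<and> f r < \<tau> (Suc r) + \<delta>"
    by (metis bchoice lessThan_iff)
  have far: "\<tau> (Suc r) + 2 * \<delta> \<le> \<tau> (Suc r')" if "r < r'" "r' < K" for r r'
  proof -
    have "\<tau> (Suc r) \<le> \<tau> r'"
      using tau_mono[of "Suc r" r'] that by (cases "Suc r = r'") auto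
    then show ?thesis
      using \<delta>[of r'] tau_mono[of r' "Suc r'"] that by auto
  qed
  have less: "f r < f r'" if "r < r'" "r' < K" for r r'
    using far[OF that] f[of r] f[of r'] that by linarith
  have "inj_on f {..<K}"
    by (rule linorder_inj_onI) (use less in force)+
  then have "K = card (f ` {..<K})"
    by (simp add: card_image)
  also have "\<dots> \<le> card (set ts)"
    using f by (intro card_mono) auto
  also have "\<dots> \<le> L"
    using ts card_length[of ts] by (auto simp: candidates_def)
  finally show False
    using \<open>L < K\<close> by simp
qed

lemma covering_block:
  assumes ts: "ts \<in> candidates n L" and "1 \<le> a" "a < b" "b \<le> n + 1"
    and free: "\<forall>t\<in>set ts. t \<le> a \<or> b \<le> t"
  shows "\<exists>j<Suc L. {a..<b} \<subseteq> {(1 # ts @ [n + 1]) ! j..<(1 # ts @ [n + 1]) ! Suc j}"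
proof -
  define t where "t = (\<lambda>k. (1 # ts @ [n + 1]) ! k)"
  have len: "length ts = L"
    using ts by (simp add: candidates_def)
  have "a \<in> (\<Union>j<Suc L. {t j..<t (Suc j)})"
    unfolding candidate_blocks(2)[OF ts t_def] using assms by auto
  then obtain j where j: "j < Suc L" "t j \<le> a" "a < t (Suc j)"
    by auto
  have "t (Suc j) \<in> set (1 # ts @ [n + 1])"
    unfolding t_def using j len by (intro nth_mem) auto
  then have "b \<le> t (Suc j)"
    using free j assms by auto
  then show ?thesis
    using j by (intro exI[of _ j]) (auto simp: t_def)
qed

text \<open>
  The block around a missed change-point covers at least \<open>\<delta>\<close> observations on either side of it.
  There the empirical frequencies differ about as much as the true C.D.F.s do: two triangle
  inequalities cost the factor 4, so that \<open>\<delta> / 2\<close> becomes \<open>\<delta> / 8\<close>, and the two fit errors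
  cost at most \<open>(2 * s + 8) * 3 / 4\<close> altogether.
\<close>

lemma loss_ge:
  assumes ts: "ts \<in> candidates n L" and r: "r < K" and "0 < \<delta>"
    and \<delta>: "\<And>j. j \<le> K \<Longrightarrow> 2 * \<delta> \<le> \<tau> (Suc j) - \<tau> j"
    and free: "\<forall>t\<in>set ts. t \<le> \<tau> (Suc r) - \<delta> \<or> \<tau> (Suc r) + \<delta> \<le> t"
  shows "real \<delta> / 8 * hel (F (Suc r) u) (F (Suc (Suc r)) u) - (2 * s + 8) \<le> loss ts u"
proof -
  define t where "t = (\<lambda>k. (1 # ts @ [n + 1]) ! k)"
  have len: "length ts = L"
    using ts by (simp add: candidates_def)
  have pos: "\<tau> r + 2 * \<delta> \<le> \<tau> (Suc r)" "\<tau> (Suc r) + 2 * \<delta> \<le> \<tau> (Suc (Suc r))"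
    using \<delta>[of r] \<delta>[of "Suc r"] tau_step[of r] tau_step[of "Suc r"] r by auto
  have "\<exists>j<Suc L. {\<tau> (Suc r) - \<delta>..<\<tau> (Suc r) + \<delta>} \<subseteq> {t j..<t (Suc j)}"
    unfolding t_def
    using pos tau_ge_1[of r] tau_le[of "Suc (Suc r)"] \<open>0 < \<delta>\<close> r by (intro covering_block[OF ts _ _ _ free]) auto
  then obtain j where j: "j < Suc L" and sub: "{\<tau> (Suc r) - \<delta>..<\<tau> (Suc r) + \<delta>} \<subseteq> {t j..<t (Suc j)}"
    by blast
  have tj: "t j \<le> \<tau> (Suc r) - \<delta>" "\<tau> (Suc r) + \<delta> \<le> t (Suc j)"
    using sub \<open>0 < \<delta>\<close> pos by (auto simp: atLeastLessThan_subset_iff)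
  let ?J = "\<lambda>j. {t j..<t (Suc j)}"
  let ?a = "max (t j) (\<tau> r)" and ?b = "min (t (Suc j)) (\<tau> (Suc (Suc r)))"
  have I1: "?J j \<inter> segment r = {?a..<\<tau> (Suc r)}" and I2: "?J j \<inter> segment (Suc r) = {\<tau> (Suc r)..<?b}"
    using tj by auto
  let ?p = "frac_below x u {?a..<\<tau> (Suc r)}" and ?q = "frac_below x u {\<tau> (Suc r)..<?b}"
  have "real \<delta> / 2 * hel (frac_below x u (?J j \<inter> segment r)) (frac_below x u (?J j \<inter> segment (Suc r)))
      \<le> (\<Sum>j<Suc L. \<Sum>k<Suc K. real (card (?J j \<inter> segment k)) *
          bkl (frac_below x u (?J j \<inter> segment k)) (frac_below x u (?J j)))"
    using j r pos tj by (intro sum_bkl_ge_hel) (auto simp: I1 I2)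
  then have loss: "real \<delta> / 2 * hel ?p ?q \<le> loss ts u"
    by (simp only: loss_def Let_def len t_def[symmetric] I1 I2)
  have e1: "real \<delta> * hel ?p (F (Suc r) u) \<le> 2 * s + 8"
  proof -
    have "real \<delta> * hel ?p (F (Suc r) u) \<le> real (\<tau> (Suc r) - ?a) * hel ?p (F (Suc r) u)"
      using tj pos by (intro mult_right_mono hel_nonneg) auto
    also have "\<dots> \<le> 2 * s + 8"
      using tj pos r \<open>0 < \<delta>\<close> by (intro card_hel_le) auto
    finally show ?thesis .
  qed
  have e2: "real \<delta> * hel ?q (F (Suc (Suc r)) u) \<le> 2 * s + 8"
  proof -
    have "real \<delta> * hel ?q (F (Suc (Suc r)) u) \<le> real (?b - \<tau> (Suc r)) * hel ?q (F (Suc (Suc r)) u)"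
      using tj pos by (intro mult_right_mono hel_nonneg) auto
    also have "\<dots> \<le> 2 * s + 8"
      using tj pos r \<open>0 < \<delta>\<close> by (intro card_hel_le) auto
    finally show ?thesis .
  qed
  have "hel (F (Suc r) u) (F (Suc (Suc r)) u)
      \<le> 2 * hel (F (Suc r) u) ?p + 2 * hel ?p (F (Suc (Suc r)) u)"
    by (rule hel_triangle)
  also have "hel ?p (F (Suc (Suc r)) u) \<le> 2 * hel ?p ?q + 2 * hel ?q (F (Suc (Suc r)) u)"
    by (rule hel_triangle)
  finally have "hel (F (Suc r) u) (F (Suc (Suc r)) u)
      \<le> 2 * hel ?p (F (Suc r) u) + 4 * hel ?p ?q + 4 * hel ?q (F (Suc (Suc r)) u)"
    by (simp add: hel_commute)
  then have "real \<delta> / 8 * hel (F (Suc r) u) (F (Suc (Suc r)) u)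
      \<le> real \<delta> / 8 * (2 * hel ?p (F (Suc r) u) + 4 * hel ?p ?q + 4 * hel ?q (F (Suc (Suc r)) u))"
    by (intro mult_left_mono) auto
  also have "\<dots> = (real \<delta> * hel ?p (F (Suc r) u)) / 4 + real \<delta> / 2 * hel ?p ?q
      + (real \<delta> * hel ?q (F (Suc (Suc r)) u)) / 2"
    by (simp add: algebra_simps)
  also have "\<dots> \<le> (2 * s + 8) / 4 + loss ts u + (2 * s + 8) / 2"
    using e1 e2 loss by (intro add_mono divide_right_mono) auto
  finally have "real \<delta> / 8 * hel (F (Suc r) u) (F (Suc (Suc r)) u)
      \<le> (2 * s + 8) / 4 + loss ts u + (2 * s + 8) / 2" .
  moreover have "(2 * s + 8) / 4 + (2 * s + 8) / 2 \<le> 2 * s + 8"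
    using s_nonneg by simp
  ultimately show ?thesis
    by linarith
qed

lemma R_obj_le_of_missing:
  assumes ts: "ts \<in> candidates n L" and "L < K" "0 < \<delta>"
    and \<delta>: "\<And>j. j \<le> K \<Longrightarrow> 2 * \<delta> \<le> \<tau> (Suc j) - \<tau> j"
    and signal: "\<And>r. r < K \<Longrightarrow>
      G \<le> (\<Sum>l = 2..n - 1. weight n l * hel (F (Suc r) (order_stat n x l)) (F (Suc (Suc r)) (order_stat n x l)))"
  shows "R_obj n x ts \<le> R_obj n x (change_points K \<tau>)
    + 4 * ln (real n) * (real (Suc L * Suc K) * s + (2 * s + 8)) - real \<delta> / 8 * G"
proof -
  obtain r where r: "r < K" and free: "\<forall>t\<in>set ts. t \<le> \<tau> (Suc r) - \<delta> \<or> \<tau> (Suc r) + \<delta> \<le> t"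
    using missed_change_point[OF ts \<open>L < K\<close> \<delta>] by blast
  let ?g = "\<lambda>l. hel (F (Suc r) (order_stat n x l)) (F (Suc (Suc r)) (order_stat n x l))"
  have "real \<delta> / 8 * G - 4 * ln (real n) * (2 * s + 8)
      \<le> real \<delta> / 8 * (\<Sum>l = 2..n - 1. weight n l * ?g l) - (\<Sum>l = 2..n - 1. weight n l) * (2 * s + 8)"
    using s_nonneg
    by (intro diff_mono mult_left_mono mult_right_mono signal r sum_weight_le n3) auto
  also have "\<dots> = (\<Sum>l = 2..n - 1. weight n l * (real \<delta> / 8 * ?g l - (2 * s + 8)))"
    unfolding sum_distrib_left sum_distrib_right sum_subtractf[symmetric]
    by (intro sum.cong refl) (simp add: algebra_simps)
  also have "\<dots> \<le> (\<Sum>l = 2..n - 1. weight n l * loss ts (order_stat n x l))"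
    by (intro sum_mono mult_left_mono loss_ge[OF ts r \<open>0 < \<delta>\<close> \<delta> free] weight_nonneg) auto
  finally show ?thesis
    using R_obj_plus_loss_le[OF ts] by (simp add: algebra_simps)
qed

section \<open>Ranks and the pooled C.D.F.\<close>

text \<open>
  The multiplicative bounds for the segments are added up; the additive errors of the
  \<open>Suc K\<close> segments make up \<open>T\<close>.
\<close>

lemma count_le_pooled:
  defines "T \<equiv> real (Suc K) * (4 * s + 16)"
  shows "real (card {i \<in> {1..n}. x i \<le> u}) \<le> 2 * (real n * pooled_cdf n K \<tau> F u) + T"
    and "real (card {i \<in> {1..n}. u < x i}) \<le> 2 * (real n * (1 - pooled_cdf n K \<tau> F u)) + T"
proof -
  let ?f = "\<lambda>j. frac_below x u (segment j)" and ?c = "\<lambda>j. real (card (segment j))"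
  have bounds: "?c j * ?f j \<le> 2 * (?c j * F (Suc j) u) + (4 * s + 16)"
      "?c j * (1 - ?f j) \<le> 2 * (?c j * (1 - F (Suc j) u)) + (4 * s + 16)" if "j \<in> {..<Suc K}" for j
  proof -
    have h: "?c j * hel (?f j) (F (Suc j) u) \<le> 2 * s + 8"
    proof -
      have "j \<le> K"
        using that by simp
      then show ?thesis
        unfolding card_atLeastLessThan by (intro card_hel_le tau_step order_refl)
    qed
    have F01: "0 \<le> F (Suc j) u" "F (Suc j) u \<le> 1"
      using that F_nonneg F_le_1 by auto
    have "?c j * ?f j \<le> ?c j * (2 * F (Suc j) u + 2 * hel (?f j) (F (Suc j) u))"
      by (intro mult_left_mono le_twice_plus_hel frac_below_nonneg frac_below_le_1 F01) auto
    then show "?c j * ?f j \<le> 2 * (?c j * F (Suc j) u) + (4 * s + 16)"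
      using h by (simp add: algebra_simps)
    have "?c j * (1 - ?f j) \<le> ?c j * (2 * (1 - F (Suc j) u) + 2 * hel (?f j) (F (Suc j) u))"
      by (intro mult_left_mono le_twice_plus_hel frac_below_nonneg frac_below_le_1 F01) auto
    then show "?c j * (1 - ?f j) \<le> 2 * (?c j * (1 - F (Suc j) u)) + (4 * s + 16)"
      using h by (simp add: algebra_simps)
  qed
  have count: "real (card {i \<in> {1..n}. x i \<le> u}) = (\<Sum>j<Suc K. ?c j * ?f j)"
  proof -
    have U: "{1..n} = (\<Union>j<Suc K. segment j)"
      unfolding segments_partition(2) by auto
    have "{i \<in> {1..n}. x i \<le> u} = (\<Union>j<Suc K. {i \<in> segment j. x i \<le> u})"
      unfolding U by blast
    moreover have "card (\<Union>j<Suc K. {i \<in> segment j. x i \<le> u}) = (\<Sum>j<Suc K. card {i \<in> segment j. x i \<le> u})"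
    proof (rule card_UN_disjoint)
      show "\<forall>j\<in>{..<Suc K}. \<forall>j'\<in>{..<Suc K}. j \<noteq> j' \<longrightarrow>
          {i \<in> segment j. x i \<le> u} \<inter> {i \<in> segment j'. x i \<le> u} = {}"
        using segments_partition(1) unfolding disjoint_family_on_def by blast
    qed auto
    ultimately have "card {i \<in> {1..n}. x i \<le> u} = (\<Sum>j<Suc K. card {i \<in> segment j. x i \<le> u})"
      by (rule ssubst)
    then show ?thesis
      by (simp only: of_nat_sum card_times_frac_below finite_atLeastLessThan)
  qed
  have total: "(\<Sum>j<Suc K. 2 * a j + (4 * s + 16)) = 2 * (\<Sum>j<Suc K. a j) + T" for a :: "nat \<Rightarrow> real"
  proof -
    have "(\<Sum>j<Suc K. 2 * a j + (4 * s + 16)) = (\<Sum>j<Suc K. 2 * a j) + (\<Sum>j<Suc K. 4 * s + 16)"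
      by (rule sum.distrib)
    also have "(\<Sum>j<Suc K. 2 * a j) = 2 * (\<Sum>j<Suc K. a j)"
      by (rule sum_distrib_left[symmetric])
    also have "(\<Sum>j<Suc K. 4 * s + 16) = T"
      unfolding T_def sum_constant card_lessThan by (rule refl)
    finally show ?thesis .
  qed
  have "(\<Sum>j<Suc K. ?c j * ?f j) \<le> (\<Sum>j<Suc K. 2 * (?c j * F (Suc j) u) + (4 * s + 16))"
    by (intro sum_mono bounds)
  also have "\<dots> = 2 * (real n * pooled_cdf n K \<tau> F u) + T"
    unfolding pooled_cdf_eq by (rule total)
  finally show "real (card {i \<in> {1..n}. x i \<le> u}) \<le> 2 * (real n * pooled_cdf n K \<tau> F u) + T"
    unfolding count .
  have "card {i \<in> {1..n}. x i \<le> u} \<le> card {1..n}"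
    by (intro card_mono) auto
  then have "real (card {i \<in> {1..n}. u < x i}) = real n - real (card {i \<in> {1..n}. x i \<le> u})"
    unfolding card_above by (subst of_nat_diff) auto
  also have "\<dots> = (\<Sum>j<Suc K. ?c j) - (\<Sum>j<Suc K. ?c j * ?f j)"
    by (simp only: count sum_card_segments)
  also have "\<dots> = (\<Sum>j<Suc K. ?c j * (1 - ?f j))"
    by (simp only: sum_subtractf[symmetric] right_diff_distrib mult_1_right)
  also have "\<dots> \<le> (\<Sum>j<Suc K. 2 * (?c j * (1 - F (Suc j) u)) + (4 * s + 16))"
    by (intro sum_mono bounds)
  also have "\<dots> = 2 * (\<Sum>j<Suc K. ?c j * (1 - F (Suc j) u)) + T"
    by (rule total)
  also have "(\<Sum>j<Suc K. ?c j * (1 - F (Suc j) u)) = real n * (1 - pooled_cdf n K \<tau> F u)"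
  proof -
    have "(\<Sum>j<Suc K. ?c j * (1 - F (Suc j) u)) = (\<Sum>j<Suc K. ?c j) - (\<Sum>j<Suc K. ?c j * F (Suc j) u)"
      by (simp only: sum_subtractf[symmetric] right_diff_distrib mult_1_right)
    also have "\<dots> = real n - real n * pooled_cdf n K \<tau> F u"
      by (simp only: sum_card_segments pooled_cdf_eq)
    finally show ?thesis
      by (simp only: right_diff_distrib mult_1_right)
  qed
  finally show "real (card {i \<in> {1..n}. u < x i}) \<le> 2 * (real n * (1 - pooled_cdf n K \<tau> F u)) + T" .
qed

text \<open>
  In the region where \<open>n P\<close> and \<open>n (1 - P)\<close> exceed the noise level \<open>T\<close>, the
  ranks \<open>l\<close> and \<open>n - l\<close> of an observation are at most three times their nominal
  values, so the weight of rank \<open>l\<close> is at least \<open>1 / (9 n P (1 - P))\<close>. The two extreme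
  ranks, which carry no weight, account for the correction \<open>2 * B\<close>.
\<close>

lemma weighted_sum_ge:
  fixes g :: "real \<Rightarrow> real" and B :: real
  defines "P \<equiv> pooled_cdf n K \<tau> F" and "T \<equiv> real (Suc K) * (4 * s + 16)"
  defines "\<phi> \<equiv> \<lambda>u. if T \<le> real n * P u \<and> T \<le> real n * (1 - P u) then g u / (P u * (1 - P u)) else 0"
  assumes g: "\<And>u. 0 \<le> g u" and cont: "continuous_on UNIV P" and B: "\<And>u. \<phi> u \<le> B"
  shows "(\<Sum>i = 1..n. \<phi> (x i)) - 2 * B \<le> 9 * real n * (\<Sum>l = 2..n - 1. weight n l * g (order_stat n x l))"
proof -
  have T: "0 < T"
    using s_nonneg by (simp add: T_def)
  have \<phi>_le: "\<phi> (order_stat n x l) \<le> 9 * real n * (weight n l * g (order_stat n x l))"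
    if l: "l \<in> {2..n - 1}" for l
  proof -
    define u where "u = order_stat n x l"
    have l': "1 \<le> l" "l \<le> n" "l < n"
      using l n3 by auto
    show ?thesis
    proof (cases "T \<le> real n * P u \<and> T \<le> real n * (1 - P u)")
      case True
      have "l \<le> card {i \<in> {1..n}. x i \<le> u}"
        using order_stat_le_iff[OF l'(1,2), of x u] by (simp add: u_def)
      then have "real l \<le> 2 * (real n * P u) + T"
        using count_le_pooled(1)[of u] unfolding P_def T_def by linarith
      then have upper: "real l \<le> 3 * (real n * P u)"
        using True by linarith
      (* Thresholds strictly below the observation exclude it even if there are ties; the bound
         then extends to u because P is continuous. *)
      have below: "real (n - l) \<le> 2 * (real n * (1 - P v)) + T" if "v < u" for v
      proof -
        have "card {i \<in> {1..n}. x i \<le> v} < l"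
          using order_stat_le_iff[OF l'(1,2), of x v] that by (simp add: u_def)
        moreover have "card {i \<in> {1..n}. v < x i} = n - card {i \<in> {1..n}. x i \<le> v}"
          by (rule card_above)
        ultimately have "n - l \<le> card {i \<in> {1..n}. v < x i}"
          by linarith
        then show ?thesis
          using count_le_pooled(2)[of v] unfolding P_def T_def by linarith
      qed
      have "(P \<longlongrightarrow> P u) (at_left u)"
      proof (rule tendsto_within_subset)
        show "(P \<longlongrightarrow> P u) (at u within UNIV)"
          using cont unfolding continuous_on_def by blast
      qed simp
      then have "((\<lambda>v. 2 * (real n * (1 - P v)) + T) \<longlongrightarrow> 2 * (real n * (1 - P u)) + T) (at_left u)"
        by (intro tendsto_intros)
      moreover have "eventually (\<lambda>v. real (n - l) \<le> 2 * (real n * (1 - P v)) + T) (at_left u)"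
        using below by (auto simp: eventually_at_filter)
      ultimately have "real (n - l) \<le> 2 * (real n * (1 - P u)) + T"
        by (rule tendsto_lowerbound) simp
      then have lower: "real (n - l) \<le> 3 * (real n * (1 - P u))"
        using True by linarith
      have pos: "0 < P u" "0 < 1 - P u"
        using order.strict_trans2[OF T conjunct1[OF True]] order.strict_trans2[OF T conjunct2[OF True]]
        by (auto simp: zero_less_mult_iff)
      have "real l * real (n - l) \<le> 3 * (real n * P u) * (3 * (real n * (1 - P u)))"
        using upper lower pos by (intro mult_mono) auto
      also have "\<dots> = 9 * real n * real n * (P u * (1 - P u))"
        by simp
      finally have le: "real l * real (n - l) \<le> 9 * real n * real n * (P u * (1 - P u))" .
      have "g u / (P u * (1 - P u)) = 9 * real n * real n * g u / (9 * real n * real n * (P u * (1 - P u)))"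
        using n3 by simp
      also have "\<dots> \<le> 9 * real n * real n * g u / (real l * real (n - l))"
        using le g l' by (intro divide_left_mono) (use pos n3 in \<open>auto intro!: mult_pos_pos\<close>)
      also have "\<dots> = 9 * real n * (weight n l * g u)"
        by (simp add: weight_def)
      finally show ?thesis
        using True by (simp add: \<phi>_def u_def)
    next
      case False
      then have "\<phi> (order_stat n x l) = 0"
        by (auto simp: \<phi>_def u_def)
      then show ?thesis
        using g weight_nonneg by simp
    qed
  qed
  have "(\<Sum>i = 1..n. \<phi> (x i)) = (\<Sum>l = 1..n. \<phi> (order_stat n x l))"
    by (rule sum_order_stat[symmetric])
  also have "(\<Sum>l = 1..n. \<phi> (order_stat n x l))
      = \<phi> (order_stat n x 1) + (\<phi> (order_stat n x n) + (\<Sum>l = 2..n - 1. \<phi> (order_stat n x l)))"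
  proof -
    have "{1..n} = insert 1 (insert n {2..n - 1})"
      using n3 by auto
    moreover have "(\<Sum>l\<in>insert 1 (insert n {2..n - 1}). \<phi> (order_stat n x l))
      = \<phi> (order_stat n x 1) + (\<phi> (order_stat n x n) + (\<Sum>l = 2..n - 1. \<phi> (order_stat n x l)))"
      using n3 by (subst sum.insert; simp)+
    ultimately show ?thesis
      by (simp only:)
  qed
  also have "\<dots> \<le> B + (B + (\<Sum>l = 2..n - 1. 9 * real n * (weight n l * g (order_stat n x l))))"
    by (intro add_mono sum_mono B \<phi>_le)
  finally show ?thesis
    by (simp add: sum_distrib_left)
qed

end

section \<open>Independent observations fit their segments with high probability\<close>

text \<open>
  A grid point next to \<open>p\<close>, on the side away from the nearer end point of the unit interval, so
  that it lies strictly between 0 and 1 even if \<open>p\<close> does not.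
\<close>

definition grid_point :: "nat \<Rightarrow> real \<Rightarrow> real" where
  "grid_point n p =
    (if p \<le> 1 / 2 then (of_int \<lfloor>real n * p\<rfloor> + 1) / real n else (of_int \<lfloor>real n * p\<rfloor> - 1) / real n)"

text \<open>
  From finitely many thresholds to all of them. Let \<open>F\<close> be a C.D.F., \<open>H\<close> an empirical one and
  \<open>v\<close> the quantiles of \<open>F\<close> of levels \<open>k / n\<close>. An arbitrary \<open>u\<close> lies between two of the
  quantiles, so \<open>H u\<close> lies between the values of \<open>H\<close> there. The lower level is
  taken one step further down than necessary, which makes both inequalities with \<open>F u\<close> strict; they
  then determine the order of \<open>u\<close> and the quantiles even where \<open>F\<close> is flat.
\<close>

lemma bkl_grid_point_le:
  fixes F H :: "real \<Rightarrow> real" and v :: "nat \<Rightarrow> real"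
  assumes n: "8 \<le> n" and "mono F" "mono H"
    and F: "\<And>u. 0 \<le> F u" "\<And>u. F u \<le> 1" and H: "\<And>u. 0 \<le> H u" "\<And>u. H u \<le> 1"
    and v: "\<And>k. k \<in> {1..<n} \<Longrightarrow> F (v k) = real k / real n"
    and fit: "\<And>k. k \<in> {1..<n} \<Longrightarrow> m * bkl (H (v k)) (real k / real n) \<le> t"
    and m: "0 < m" "m \<le> real n" and "0 \<le> t"
  shows "m * bkl (H u) (grid_point n (F u)) \<le> t + 8"
    and "0 < grid_point n (F u)" "grid_point n (F u) < 1" "\<bar>grid_point n (F u) - F u\<bar> \<le> 2 / real n"
proof -
  define p where "p = F u"
  define i where "i = \<lfloor>real n * p\<rfloor>"
  define lo where "lo = (of_int i - 1) / real n"
  define hi where "hi = (of_int i + 1) / real n"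
  have n0: "0 < real n"
    using n by simp
  have i: "of_int i \<le> real n * p" "real n * p < of_int i + 1"
    unfolding i_def by linarith+
  have lo_p: "lo < p" and p_hi: "p < hi"
    using i n0 by (simp_all add: lo_def hi_def field_simps)
  have gap: "hi - lo = 2 / real n"
    using n0 by (simp add: lo_def hi_def field_simps)
  have small: "2 / real n \<le> 1 / 4"
    using n by (simp add: field_simps)
  have gap': "m * (4 * (hi - lo)) \<le> 8"
    using m n0 by (simp add: gap field_simps)
  have p01: "0 \<le> p" "p \<le> 1"
    using F by (simp_all add: p_def)
  have i0: "0 \<le> i"
    unfolding i_def using p01 n0 by simp
  have order: "u \<le> w" if "F u < F w" for u w
    using \<open>mono F\<close> that by (meson linorder_not_le monoD order_less_imp_le)
  have upper: "\<exists>w. H u \<le> H w \<and> m * bkl (H w) hi \<le> t" if "hi < 1"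
  proof -
    define k where "k = nat (i + 1)"
    have k: "real k = of_int i + 1"
      using i0 by (simp add: k_def)
    then have "real k < real n"
      using that n0 by (simp add: hi_def field_simps)
    then have k_in: "k \<in> {1..<n}"
      using i0 by (auto simp: k_def)
    have hi_k: "hi = real k / real n"
      by (simp add: hi_def k)
    have "u \<le> v k"
      using p_hi by (intro order) (simp add: v[OF k_in] hi_k p_def)
    then show ?thesis
      using fit[OF k_in] \<open>mono H\<close> unfolding hi_k by (auto dest: monoD)
  qed
  have lower: "\<exists>w. H w \<le> H u \<and> m * bkl (H w) lo \<le> t" if "0 < lo"
  proof -
    define k where "k = nat (i - 1)"
    have i1: "1 < i"
      using that n0 by (simp add: lo_def zero_less_divide_iff)
    then have k: "real k = of_int i - 1"
      by (simp add: k_def)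
    have lo_k: "lo = real k / real n"
      by (simp add: lo_def k)
    have "real k < real n * p"
      using lo_p n0 by (simp add: lo_k pos_divide_less_eq mult.commute)
    moreover have "real n * p \<le> real n * 1"
      using p01 n0 by (intro mult_left_mono) auto
    ultimately have "real k < real n"
      by linarith
    then have k_in: "k \<in> {1..<n}"
      using i1 by (auto simp: k_def)
    have "v k \<le> u"
      using lo_p by (intro order) (simp add: v[OF k_in] lo_k p_def)
    then show ?thesis
      using fit[OF k_in] \<open>mono H\<close> unfolding lo_k by (auto dest: monoD)
  qed
  have "m * bkl (H u) (grid_point n p) \<le> t + 8 \<and> 0 < grid_point n p \<and> grid_point n p < 1
      \<and> \<bar>grid_point n p - p\<bar> \<le> 2 / real n"
  proof (cases "p \<le> 1 / 2")
    case True
    have q: "grid_point n p = hi"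
      using True by (simp add: grid_point_def hi_def i_def)
    have hi: "0 < hi" "hi \<le> 3 / 4"
      using p01 p_hi lo_p gap small True by linarith+
    obtain w where w: "H u \<le> H w" "m * bkl (H w) hi \<le> t"
      using upper hi by fastforce
    obtain w' where w': "0 \<le> w'" "w' \<le> H u" "0 < lo \<longrightarrow> m * bkl w' lo \<le> t"
    proof (cases "0 < lo")
      case True
      then obtain w where "H w \<le> H u" "m * bkl (H w) lo \<le> t"
        using lower by blast
      then show thesis
        using that[of "H w"] H by blast
    qed (use that[of 0] H in auto)
    have "bkl (H u) hi \<le> t / m + 4 * (hi - lo)"
      using w w' hi lo_p p_hi H m \<open>0 \<le> t\<close>
      by (intro bkl_le_of_grid[where alo = w' and ahi = "H w"])
        (auto simp: pos_le_divide_eq mult.commute)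
    then have "m * bkl (H u) hi \<le> m * (t / m + 4 * (hi - lo))"
      using m by (intro mult_left_mono) auto
    also have "\<dots> = t + m * (4 * (hi - lo))"
      using m by (simp add: distrib_left)
    finally show ?thesis
      unfolding q using gap' hi p_hi lo_p gap by (auto simp: abs_le_iff)
  next
    case False
    have q: "grid_point n p = lo"
      using False by (simp add: grid_point_def lo_def i_def)
    have lo: "1 / 4 \<le> lo" "lo < 1"
      using p01 p_hi lo_p gap small False by linarith+
    obtain w where w: "H w \<le> H u" "m * bkl (H w) lo \<le> t"
      using lower lo by fastforce
    obtain w' where w': "H u \<le> w'" "w' \<le> 1" "hi < 1 \<longrightarrow> m * bkl w' hi \<le> t"
    proof (cases "hi < 1")
      case True
      then obtain w where "H u \<le> H w" "m * bkl (H w) hi \<le> t"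
        using upper by blast
      then show thesis
        using that[of "H w"] H by blast
    qed (use that[of 1] H in auto)
    have "bkl (1 - H u) (1 - lo) \<le> t / m + 4 * ((1 - lo) - (1 - hi))"
      using w w' lo lo_p p_hi H m \<open>0 \<le> t\<close>
      by (intro bkl_le_of_grid[where alo = "1 - w'" and ahi = "1 - H w"])
        (auto simp: pos_le_divide_eq mult.commute bkl_reflect)
    then have "bkl (H u) lo \<le> t / m + 4 * (hi - lo)"
      by (simp add: bkl_reflect)
    then have "m * bkl (H u) lo \<le> m * (t / m + 4 * (hi - lo))"
      using m by (intro mult_left_mono) auto
    also have "\<dots> = t + m * (4 * (hi - lo))"
      using m by (simp add: distrib_left)
    finally show ?thesis
      unfolding q using gap' lo p_hi lo_p gap by (auto simp: abs_le_iff)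
  qed
  then show "m * bkl (H u) (grid_point n (F u)) \<le> t + 8"
    and "0 < grid_point n (F u)" "grid_point n (F u) < 1" "\<bar>grid_point n (F u) - F u\<bar> \<le> 2 / real n"
    by (simp_all add: p_def)
qed

text \<open>
  The random sample of one fixed size \<open>n\<close>. The lower bound on \<open>n\<close> makes the distance \<open>2 / n\<close> of the
  two grid levels around a probability at most \<open>1 / 4\<close>, which keeps the grid point in use at least
  \<open>1 / 4\<close> away from the more distant end point of the unit interval.
\<close>

locale change_point_model = segmentation + prob_space +
  fixes F :: "nat \<Rightarrow> real \<Rightarrow> real" and X :: "nat \<Rightarrow> 'a \<Rightarrow> real"
  assumes n8: "8 \<le> n"
    and indep: "indep_vars (\<lambda>_. borel) X {1..n}"
    and distr_X: "\<And>j i. j \<le> K \<Longrightarrow> i \<in> segment j \<Longrightarrow> cdf (distr M borel (X i)) = F (Suc j)"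
    and cont: "\<And>j. j \<le> K \<Longrightarrow> continuous_on UNIV (F (Suc j))"
begin

lemma rv_X [measurable]: "i \<in> {1..n} \<Longrightarrow> X i \<in> borel_measurable M"
  using indep by (auto simp: indep_vars_def)

lemma segment_subset: "j \<le> K \<Longrightarrow> segment j \<subseteq> {1..n}"
  using tau_ge_1[of j] tau_le[of "Suc j"] by auto

lemma real_distribution_X: "i \<in> {1..n} \<Longrightarrow> real_distribution (distr M borel (X i))"
  by (intro real_distribution_distr) measurable

lemma F_eq_cdf:
  assumes "j \<le> K"
  shows "real_distribution (distr M borel (X (\<tau> j)))" "F (Suc j) = cdf (distr M borel (X (\<tau> j)))"
proof -
  have "\<tau> j \<in> segment j"
    using tau_step[OF assms] by simp
  then show "real_distribution (distr M borel (X (\<tau> j)))" "F (Suc j) = cdf (distr M borel (X (\<tau> j)))"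
    using real_distribution_X segment_subset[OF assms] distr_X[OF assms] by auto
qed

lemma F_bounds:
  assumes "j \<le> K"
  shows "0 \<le> F (Suc j) u" "F (Suc j) u \<le> 1" "mono (F (Suc j))"
proof -
  interpret D: real_distribution "distr M borel (X (\<tau> j))"
    by (rule F_eq_cdf[OF assms])
  show "0 \<le> F (Suc j) u" "F (Suc j) u \<le> 1" "mono (F (Suc j))"
    unfolding F_eq_cdf(2)[OF assms]
    by (auto intro!: D.cdf_nonneg D.cdf_bounded_prob monoI D.cdf_nondecreasing)
qed

lemma prob_X_le:
  assumes "j \<le> K" "i \<in> segment j"
  shows "prob {\<omega> \<in> space M. X i \<omega> \<le> u} = F (Suc j) u"
proof -
  have i: "i \<in> {1..n}"
    using segment_subset assms by blast
  have "F (Suc j) u = measure (distr M borel (X i)) {..u}"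
    by (simp add: distr_X[OF assms, symmetric] cdf_def)
  also have "\<dots> = prob {\<omega> \<in> space M. X i \<omega> \<le> u}"
    using rv_X[OF i] by (subst measure_distr) (auto intro!: arg_cong[where f = prob])
  finally show ?thesis ..
qed

definition quantile :: "nat \<Rightarrow> nat \<Rightarrow> real" where
  "quantile j k = (SOME v. F (Suc j) v = real k / real n)"

lemma F_quantile:
  assumes "j \<le> K" "k \<in> {1..<n}"
  shows "F (Suc j) (quantile j k) = real k / real n"
proof -
  interpret D: real_distribution "distr M borel (X (\<tau> j))"
    by (rule F_eq_cdf[OF assms(1)])
  have "\<exists>v. F (Suc j) v = real k / real n"
    unfolding F_eq_cdf(2)[OF assms(1)]
    using assms cont[OF assms(1)] n3 unfolding F_eq_cdf(2)[OF assms(1)]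
    by (intro D.cdf_attains) auto
  then show ?thesis
    unfolding quantile_def by (rule someI_ex)
qed

text \<open>
  The finitely many divergences that have to be small, indexed by a segment, a quantile of its
  C.D.F. and the end points of a stretch of the segment.
\<close>

definition deviation :: "nat \<times> nat \<times> nat \<times> nat \<Rightarrow> 'a \<Rightarrow> real" where
  "deviation = (\<lambda>(j, k, a, b) \<omega>.
    real (b - a) * bkl (frac_below (\<lambda>i. X i \<omega>) (quantile j k) {a..<b}) (real k / real n))"

definition deviation_indices :: "(nat \<times> nat \<times> nat \<times> nat) set" where
  "deviation_indices = {(j, k, a, b). j \<le> K \<and> k \<in> {1..<n} \<and> \<tau> j \<le> a \<and> a < b \<and> b \<le> \<tau> (Suc j)}"

lemma K_less_n: "Suc K \<le> n"
proof -
  have "real (Suc K) = (\<Sum>j<Suc K. 1)"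
    by simp
  also have "\<dots> \<le> (\<Sum>j<Suc K. real (card (segment j)))"
  proof (rule sum_mono)
    fix j assume "j \<in> {..<Suc K}"
    then have "\<tau> j < \<tau> (Suc j)"
      by (intro tau_step) auto
    then show "1 \<le> real (card (segment j))"
      by simp
  qed
  finally show ?thesis
    unfolding sum_card_segments by simp
qed

lemma deviation_indices_subset:
  "deviation_indices \<subseteq> {..<n} \<times> {1..<n} \<times> {1..n} \<times> {1..n + 1}"
proof (rule subsetI)
  fix z assume "z \<in> deviation_indices"
  then obtain j k a b where z: "z = (j, k, a, b)" "j \<le> K" "k \<in> {1..<n}" "\<tau> j \<le> a" "a < b" "b \<le> \<tau> (Suc j)"
    by (auto simp: deviation_indices_def)
  then show "z \<in> {..<n} \<times> {1..<n} \<times> {1..n} \<times> {1..n + 1}"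
    using tau_ge_1[of j] tau_le[of "Suc j"] K_less_n by auto
qed

lemma finite_deviation_indices: "finite deviation_indices"
  by (rule finite_subset[OF deviation_indices_subset]) simp

lemma card_deviation_indices: "card deviation_indices \<le> n * n * n * (n + 1)"
proof -
  have "card deviation_indices \<le> card ({..<n} \<times> {1..<n} \<times> {1..n} \<times> {1..n + 1})"
    by (intro card_mono deviation_indices_subset) simp
  also have "\<dots> = n * ((n - 1) * (n * (n + 1)))"
    by (simp add: card_cartesian_product)
  also have "\<dots> \<le> n * (n * (n * (n + 1)))"
    by (intro mult_le_mono) auto
  finally show ?thesis
    by (simp add: algebra_simps)
qed

lemma bkl_measurable [measurable]: "(\<lambda>p. bkl p q) \<in> borel_measurable borel"
  unfolding bkl_def by measurable

lemma frac_below_measurable: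
  assumes "I \<subseteq> {1..n}"
  shows "(\<lambda>\<omega>. frac_below (\<lambda>i. X i \<omega>) u I) \<in> borel_measurable M"
proof -
  have fin: "finite I"
    using assms by (rule finite_subset) simp
  have "(\<lambda>\<omega>. frac_below (\<lambda>i. X i \<omega>) u I) = (\<lambda>\<omega>. (\<Sum>i\<in>I. if X i \<omega> \<le> u then 1 else 0) / real (card I))"
    using fin by (auto simp: frac_below_def sum.If_cases Collect_conj_eq)
  also have "\<dots> \<in> borel_measurable M"
    using assms by (intro borel_measurable_divide borel_measurable_sum measurable_If) (auto intro!: rv_X)
  finally show ?thesis .
qed

lemma deviation_measurable:
  assumes "z \<in> deviation_indices"
  shows "deviation z \<in> borel_measurable M"
proof -
  obtain j k a b where z: "z = (j, k, a, b)" "j \<le> K" "\<tau> j \<le> a" "b \<le> \<tau> (Suc j)"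
    using assms by (auto simp: deviation_indices_def)
  have "{a..<b} \<subseteq> {1..n}"
    using segment_subset[OF z(2)] z(3,4) by auto
  then have "(\<lambda>\<omega>. frac_below (\<lambda>i. X i \<omega>) (quantile j k) {a..<b}) \<in> borel_measurable M"
    by (rule frac_below_measurable)
  from measurable_compose[OF this bkl_measurable] show ?thesis
    unfolding deviation_def z by simp
qed

lemma prob_deviation_gt:
  assumes "z \<in> deviation_indices"
  shows "prob {\<omega> \<in> space M. t < deviation z \<omega>} \<le> (real n + 1) * exp (- t)"
proof -
  obtain j k a b where z: "z = (j, k, a, b)" "j \<le> K" "k \<in> {1..<n}" "\<tau> j \<le> a" "a < b" "b \<le> \<tau> (Suc j)"
    using assms by (auto simp: deviation_indices_def)
  have sub: "{a..<b} \<subseteq> segment j"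
    using z by auto
  have len: "b - a \<le> n"
    using card_mono[OF _ order_trans[OF sub segment_subset[OF z(2)]]] by simp
  have "prob {\<omega> \<in> space M. t < real (card {a..<b}) *
      bkl (frac_below (\<lambda>i. X i \<omega>) (quantile j k) {a..<b}) (real k / real n)}
    \<le> (real (card {a..<b}) + 1) * exp (- t)"
  proof (rule prob_bkl_frac_below_gt)
    show "indep_vars (\<lambda>_. borel) X {a..<b}"
      using sub segment_subset[OF z(2)] by (intro indep_vars_subset[OF indep]) blast
    show "prob {\<omega> \<in> space M. X i \<omega> \<le> quantile j k} = real k / real n" if "i \<in> {a..<b}" for i
      using sub that by (subst prob_X_le[OF z(2)]) (auto simp: F_quantile[OF z(2,3)])
  qed (use z in auto)
  also have "\<dots> \<le> (real n + 1) * exp (- t)"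
    using len by (intro mult_right_mono) auto
  finally show ?thesis
    by (simp add: deviation_def z(1))
qed

definition fit_event :: "real \<Rightarrow> 'a set" where
  "fit_event t = {\<omega> \<in> space M. \<forall>z\<in>deviation_indices. deviation z \<omega> \<le> t}"

lemma fit_event_sets: "fit_event t \<in> events"
  unfolding fit_event_def
  by (intro sets.sets_Collect_finite_All finite_deviation_indices borel_measurable_le
      deviation_measurable borel_measurable_const)

lemma prob_fit_event:
  "1 - real (n * n * n * (n + 1)) * ((real n + 1) * exp (- t)) \<le> prob (fit_event t)"
proof -
  define B where "B z = {\<omega> \<in> space M. t < deviation z \<omega>}" for z
  have B: "B z \<in> events" if "z \<in> deviation_indices" for z
    unfolding B_def using deviation_measurable[OF that] by measurable
  have "prob (\<Union>z\<in>deviation_indices. B z) \<le> (\<Sum>z\<in>deviation_indices. prob (B z))"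
    using B by (intro finite_measure_subadditive_finite finite_deviation_indices) auto
  also have "\<dots> \<le> (\<Sum>z\<in>deviation_indices. (real n + 1) * exp (- t))"
    unfolding B_def by (intro sum_mono prob_deviation_gt)
  also have "\<dots> = real (card deviation_indices) * ((real n + 1) * exp (- t))"
    by simp
  also have "\<dots> \<le> real (n * n * n * (n + 1)) * ((real n + 1) * exp (- t))"
    by (intro mult_right_mono of_nat_mono card_deviation_indices) simp
  finally have "prob (\<Union>z\<in>deviation_indices. B z) \<le> real (n * n * n * (n + 1)) * ((real n + 1) * exp (- t))" .
  moreover have "fit_event t = space M - (\<Union>z\<in>deviation_indices. B z)"
    by (auto simp: fit_event_def B_def not_less)
  then have "prob (fit_event t) = 1 - prob (\<Union>z\<in>deviation_indices. B z)"
    using B finite_deviation_indices by (simp add: prob_compl sets.finite_UN)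
  ultimately show ?thesis
    by linarith
qed

lemma well_fitted_on_fit_event:
  assumes \<omega>: "\<omega> \<in> fit_event t" and "0 \<le> t"
  shows "well_fitted_sample n K \<tau> F (\<lambda>i. X i \<omega>) (t + 8)"
proof
  show "0 \<le> t + 8"
    using \<open>0 \<le> t\<close> by simp
  show "0 \<le> F (Suc j) u" "F (Suc j) u \<le> 1" if "j \<le> K" for j u
    using F_bounds[OF that] by auto
  fix j u assume j: "j \<le> K"
  let ?q = "grid_point n (F (Suc j) u)"
  have step: "real (b - a) * bkl (frac_below (\<lambda>i. X i \<omega>) u {a..<b}) ?q \<le> t + 8
      \<and> 0 < ?q \<and> ?q < 1 \<and> \<bar>?q - F (Suc j) u\<bar> \<le> 2 / real n"
    if ab: "\<tau> j \<le> a" "a < b" "b \<le> \<tau> (Suc j)" for a b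
  proof -
    have len: "b - a \<le> n"
      using tau_ge_1[of j] tau_le[of "Suc j"] j ab by linarith
    have dev: "real (b - a) * bkl (frac_below (\<lambda>i. X i \<omega>) (quantile j k) {a..<b}) (real k / real n) \<le> t"
      if "k \<in> {1..<n}" for k
    proof -
      have "(j, k, a, b) \<in> deviation_indices"
        using j ab that by (simp add: deviation_indices_def)
      then have "deviation (j, k, a, b) \<omega> \<le> t"
        using \<omega> by (simp add: fit_event_def)
      then show ?thesis
        by (simp add: deviation_def)
    qed
    have "mono (\<lambda>u. frac_below (\<lambda>i. X i \<omega>) u {a..<b})"
      by (intro monoI frac_below_mono)
    note grid = bkl_grid_point_le[OF n8 F_bounds(3)[OF j] this F_bounds(1)[OF j] F_bounds(2)[OF j]
        frac_below_nonneg frac_below_le_1 F_quantile[OF j] dev _ _ \<open>0 \<le> t\<close>]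
    show ?thesis
      using ab len by (intro conjI grid) auto
  qed
  show "\<exists>q. 0 < q \<and> q < 1 \<and> \<bar>q - F (Suc j) u\<bar> \<le> 2 / real n \<and>
      (\<forall>a b. \<tau> j \<le> a \<longrightarrow> a < b \<longrightarrow> b \<le> \<tau> (Suc j) \<longrightarrow>
        real (b - a) * bkl (frac_below (\<lambda>i. X i \<omega>) u {a..<b}) q \<le> t + 8)"
    using step step[OF order_refl tau_step[OF j] order_refl] by (intro exI[of _ ?q] conjI allI impI) blast+
qed

end

section \<open>The weighted signal is bounded below with high probability\<close>

context change_point_model
begin

abbreviation P :: "real \<Rightarrow> real" where
  "P \<equiv> pooled_cdf n K \<tau> F"

definition signal :: "nat \<Rightarrow> real \<Rightarrow> real" where
  "signal r u = hel (F (Suc r) u) (F (Suc (Suc r)) u)"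

lemma pooled_eq_average:
  "P u = (\<Sum>i\<in>{1..n}. cdf (distr M borel (X i)) u) / real (card {1..n})"
proof -
  have U: "{1..n} = (\<Union>j<Suc K. segment j)"
    unfolding segments_partition(2) by auto
  have "(\<Sum>i\<in>{1..n}. cdf (distr M borel (X i)) u)
      = (\<Sum>j<Suc K. \<Sum>i\<in>segment j. cdf (distr M borel (X i)) u)"
    unfolding U
  proof (rule sum.UNION_disjoint)
    show "\<forall>j\<in>{..<Suc K}. \<forall>j'\<in>{..<Suc K}. j \<noteq> j' \<longrightarrow> segment j \<inter> segment j' = {}"
      using segments_partition(1) unfolding disjoint_family_on_def by blast
  qed auto
  also have "\<dots> = (\<Sum>j<Suc K. \<Sum>i\<in>segment j. F (Suc j) u)"
    by (intro sum.cong refl) (simp only: distr_X lessThan_iff less_Suc_eq_le)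
  also have "\<dots> = real n * P u"
    unfolding pooled_cdf_eq by (simp only: sum_constant)
  finally show ?thesis
    using n3 by simp
qed

lemma pooled_distribution:
  "real_distribution (interval_measure P)" "cdf (interval_measure P) = P"
  "f \<in> borel_measurable borel \<Longrightarrow>
    (\<integral>\<^sup>+u. f u \<partial>interval_measure P) = (\<Sum>i\<in>{1..n}. \<integral>\<^sup>+\<omega>. f (X i \<omega>) \<partial>M) / ennreal (real n)"
proof -
  have ne: "{1..n} \<noteq> {}"
    using n3 by simp
  note avg = interval_measure_average_cdf[OF finite_atLeastAtMost ne rv_X pooled_eq_average]
  show "real_distribution (interval_measure P)" "cdf (interval_measure P) = P"
    by (rule avg; assumption)+
  show "f \<in> borel_measurable borel \<Longrightarrow>
    (\<integral>\<^sup>+u. f u \<partial>interval_measure P) = (\<Sum>i\<in>{1..n}. \<integral>\<^sup>+\<omega>. f (X i \<omega>) \<partial>M) / ennreal (real n)"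
    using avg(3)[of f] by (simp only: card_atLeastAtMost diff_Suc_1 simp_thms)
qed

lemma P_bounds: "0 \<le> P u" "P u \<le> 1"
proof -
  interpret D: real_distribution "interval_measure P"
    by (rule pooled_distribution(1))
  show "0 \<le> P u" "P u \<le> 1"
    using D.cdf_nonneg[of u] D.cdf_bounded_prob[of u] by (simp_all only: pooled_distribution(2))
qed

lemma P_cont: "continuous_on UNIV P"
proof -
  have "P u = (\<Sum>j<Suc K. real (card (segment j)) * F (Suc j) u) / real n" for u
    unfolding pooled_cdf_eq[symmetric] using n3 by simp
  then have P_eq: "P = (\<lambda>u. (\<Sum>j<Suc K. real (card (segment j)) * F (Suc j) u) / real n)"
    by (rule ext)
  have "continuous_on UNIV (\<lambda>u. (\<Sum>j<Suc K. real (card (segment j)) * F (Suc j) u) / real n)"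
    by (intro continuous_intros cont) (use n3 in auto)
  then show ?thesis
    by (simp only: P_eq)
qed

lemma P_measurable [measurable]: "P \<in> borel_measurable borel"
  using P_cont by (rule borel_measurable_continuous_onI)

lemma F_measurable: "j \<le> K \<Longrightarrow> F (Suc j) \<in> borel_measurable borel"
  using cont by (intro borel_measurable_continuous_onI)

lemma signal_measurable: "r < K \<Longrightarrow> signal r \<in> borel_measurable borel"
  unfolding signal_def[abs_def] hel_def
  using F_measurable[of r] F_measurable[of "Suc r"] by measurable

lemma signal_nonneg: "0 \<le> signal r u"
  by (simp add: signal_def hel_nonneg)

text \<open>
  The integrand of the signal strength is twice the Jensen-Shannon divergence of two neighbouring
  segments, which is equivalent to their Hellinger distance up to constant factors.
\<close>

lemma eta_r_bounds:
  assumes "r < K"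
  shows "0 \<le> eta_r F (Suc r) u" "eta_r F (Suc r) u \<le> 2 * signal r u"
proof -
  define p where "p = F (Suc r) u"
  define q where "q = F (Suc (Suc r)) u"
  define m where "m = (p + q) / 2"
  have pq: "0 \<le> p" "p \<le> 1" "0 \<le> q" "q \<le> 1"
    using F_bounds(1,2)[of r u] F_bounds(1,2)[of "Suc r" u] assms by (auto simp: p_def q_def)
  have "mix_cdf (1 / 2) (F (Suc r)) (F (Suc r + 1)) u = m"
    by (simp add: mix_cdf_def m_def p_def q_def)
  then have eq: "eta_r F (Suc r) u = bkl p m + bkl q m"
    by (simp add: eta_r_def eta_def bkl_def p_def q_def)
  have "0 \<le> bkl p m" "0 \<le> bkl q m"
    using pq by (intro bkl_nonneg; simp add: m_def)+
  then show "0 \<le> eta_r F (Suc r) u"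
    by (simp add: eq)
  show "eta_r F (Suc r) u \<le> 2 * signal r u"
    unfolding eq signal_def p_def[symmetric] q_def[symmetric]
    by (rule bkl_midpoint_le_hel[OF pq m_def])
qed

context
  fixes len :: real
  assumes len_pos: "0 < len" and len_le: "\<And>j. j \<le> K \<Longrightarrow> len \<le> real (card (segment j))"
begin

lemma F_le_pooled:
  assumes "j \<le> K"
  shows "len * F (Suc j) u \<le> real n * P u" "len * (1 - F (Suc j) u) \<le> real n * (1 - P u)"
proof -
  have j: "j \<in> {..<Suc K}"
    using assms by simp
  have "len * F (Suc j) u \<le> real (card (segment j)) * F (Suc j) u"
    by (intro mult_right_mono len_le assms F_bounds)
  also have "\<dots> \<le> (\<Sum>j<Suc K. real (card (segment j)) * F (Suc j) u)"
    using j by (rule member_le_sum) (auto intro!: mult_nonneg_nonneg F_bounds)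
  finally show "len * F (Suc j) u \<le> real n * P u"
    unfolding pooled_cdf_eq .
  have "len * (1 - F (Suc j) u) \<le> real (card (segment j)) * (1 - F (Suc j) u)"
    using F_bounds(2)[OF assms, of u] by (intro mult_right_mono len_le assms) auto
  also have "\<dots> \<le> (\<Sum>j<Suc K. real (card (segment j)) * (1 - F (Suc j) u))"
    using j by (rule member_le_sum) (auto intro!: mult_nonneg_nonneg simp: F_bounds)
  also have "\<dots> = (\<Sum>j<Suc K. real (card (segment j))) - (\<Sum>j<Suc K. real (card (segment j)) * F (Suc j) u)"
    by (simp only: sum_subtractf[symmetric] right_diff_distrib mult_1_right)
  also have "\<dots> = real n - real n * P u"
    by (simp only: sum_card_segments pooled_cdf_eq)
  finally show "len * (1 - F (Suc j) u) \<le> real n * (1 - P u)"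
    by (simp only: right_diff_distrib mult_1_right)
qed

text \<open>
  A segment makes up at least the fraction \<open>len / n\<close> of the sample, so the signal is at most of
  the order \<open>n / len\<close> relative to \<open>P (1 - P)\<close>. This bounds both the contribution of
  the extreme tails and the size of the summands in the exponential inequality.
\<close>

lemma signal_ratio_le:
  assumes "r < K"
  shows "signal r u / (P u * (1 - P u)) \<le> 4 * real n / len"
proof -
  let ?p = "F (Suc r) u" and ?q = "F (Suc (Suc r)) u"
  have r: "r \<le> K" "Suc r \<le> K"
    using assms by auto
  have pq: "0 \<le> ?p" "?p \<le> 1" "0 \<le> ?q" "?q \<le> 1"
    using F_bounds[OF r(1)] F_bounds[OF r(2)] by auto
  have "len * signal r u \<le> len * (2 * max ?p ?q)"
    unfolding signal_def using len_pos by (intro mult_left_mono hel_le_max(1) pq) auto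
  also have "\<dots> \<le> 2 * (real n * P u)"
    using F_le_pooled(1)[OF r(1), of u] F_le_pooled(1)[OF r(2), of u] by (simp add: max_def)
  finally have le1: "len * signal r u \<le> 2 * (real n * P u)" .
  have "len * signal r u \<le> len * (2 * max (1 - ?p) (1 - ?q))"
    unfolding signal_def using len_pos by (intro mult_left_mono hel_le_max(2) pq) auto
  also have "\<dots> \<le> 2 * (real n * (1 - P u))"
    using F_le_pooled(2)[OF r(1), of u] F_le_pooled(2)[OF r(2), of u] by (simp add: max_def)
  finally have le2: "len * signal r u \<le> 2 * (real n * (1 - P u))" .
  have "len * signal r u = P u * (len * signal r u) + (1 - P u) * (len * signal r u)"
    by (simp add: algebra_simps)
  also have "\<dots> \<le> P u * (2 * (real n * (1 - P u))) + (1 - P u) * (2 * (real n * P u))"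
    using P_bounds[of u] by (intro add_mono mult_left_mono le1 le2) auto
  also have "\<dots> = 4 * real n * (P u * (1 - P u))"
    by (simp add: algebra_simps)
  finally have le: "len * signal r u \<le> 4 * real n * (P u * (1 - P u))" .
  show ?thesis
  proof (cases "P u * (1 - P u) = 0")
    case False
    then have "0 < P u * (1 - P u)"
      using P_bounds[of u] by (simp add: order_less_le)
    then show ?thesis
      using le len_pos by (simp add: pos_divide_le_eq pos_le_divide_eq mult.commute mult.left_commute)
  next
    case True
    then show ?thesis
      using len_pos by (simp only: True div_by_0) simp
  qed
qed

text \<open>
  The signal relative to \<open>P (1 - P)\<close>, restricted to the region in which the ranks are reliable.
\<close>

definition trimmed_signal :: "real \<Rightarrow> nat \<Rightarrow> real \<Rightarrow> real" where
  "trimmed_signal T r u =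
    (if T \<le> real n * P u \<and> T \<le> real n * (1 - P u) then signal r u / (P u * (1 - P u)) else 0)"

lemma trimmed_signal_bounds:
  assumes "r < K"
  shows "0 \<le> trimmed_signal T r u" "trimmed_signal T r u \<le> 4 * real n / len"
  using signal_ratio_le[OF assms, of u] signal_nonneg[of r u] P_bounds[of u] len_pos
  by (auto simp: trimmed_signal_def intro!: divide_nonneg_nonneg mult_nonneg_nonneg)

lemma trimmed_signal_measurable: "r < K \<Longrightarrow> trimmed_signal T r \<in> borel_measurable borel"
  unfolding trimmed_signal_def[abs_def] using signal_measurable[of r] by measurable

lemma integrable_trimmed_signal:
  assumes "r < K" "i \<in> {1..n}"
  shows "integrable M (\<lambda>\<omega>. trimmed_signal T r (X i \<omega>))"
proof (rule integrable_const_bound[where B = "4 * real n / len"])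
  show "(\<lambda>\<omega>. trimmed_signal T r (X i \<omega>)) \<in> borel_measurable M"
    using rv_X[OF assms(2)] trimmed_signal_measurable[OF assms(1)] by (rule measurable_compose)
qed (use trimmed_signal_bounds[OF assms(1)] in auto)

text \<open>
  The observations are distributed according to \<open>P\<close> on average, so their mean trimmed signal is an
  integral with respect to \<open>P\<close>. The region removed by trimming has pooled probability at most
  \<open>2 T / n\<close>, and the integrand is at most \<open>8 n / len\<close> there.
\<close>

lemma mean_trimmed_signal_ge:
  assumes r: "r < K" and "0 \<le> T" and "0 < \<epsilon>"
    and eta: "\<epsilon> \<le> (\<integral>u. eta_r F (Suc r) u / (P u * (1 - P u)) \<partial>interval_measure P)"
  shows "real n / 2 * (\<epsilon> - 16 * T / len) \<le> (\<Sum>i\<in>{1..n}. expectation (\<lambda>\<omega>. trimmed_signal T r (X i \<omega>)))"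
proof -
  interpret D: real_distribution "interval_measure P"
    by (rule pooled_distribution(1))
  let ?h = "\<lambda>u. eta_r F (Suc r) u / (P u * (1 - P u))"
  let ?B = "4 * real n / len"
  let ?L = "{u. P u < T / real n}" and ?U = "{u. 1 - P u < T / real n}"
  let ?\<mu> = "\<Sum>i\<in>{1..n}. expectation (\<lambda>\<omega>. trimmed_signal T r (X i \<omega>))"
  have n0: "0 < real n"
    using n3 by simp
  have B: "0 \<le> ?B"
    using len_pos by simp
  have PP: "0 \<le> P u * (1 - P u)" for u
    using P_bounds[of u] by simp
  have h: "0 \<le> ?h u \<and> ?h u \<le> 2 * trimmed_signal T r u + 2 * ?B * (indicator ?L u + indicator ?U u)" for u
  proof
    show "0 \<le> ?h u"
      using eta_r_bounds(1)[OF r] PP by (intro divide_nonneg_nonneg)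
    have "?h u \<le> 2 * signal r u / (P u * (1 - P u))"
      using eta_r_bounds(2)[OF r] PP by (intro divide_right_mono)
    also have "\<dots> = 2 * (signal r u / (P u * (1 - P u)))"
      by simp
    also have "\<dots> \<le> 2 * trimmed_signal T r u + 2 * ?B * (indicator ?L u + indicator ?U u)"
    proof (cases "T \<le> real n * P u \<and> T \<le> real n * (1 - P u)")
      case True
      then have "trimmed_signal T r u = signal r u / (P u * (1 - P u))"
        by (simp only: trimmed_signal_def simp_thms if_True)
      moreover have "0 \<le> 2 * ?B * (indicat_real ?L u + indicator ?U u)"
        using B by (intro mult_nonneg_nonneg add_nonneg_nonneg) auto
      ultimately show ?thesis
        by linarith
    next
      case False
      then have "u \<in> ?L \<or> u \<in> ?U"
        using n0 by (auto simp: pos_less_divide_eq mult.commute)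
      then have "1 \<le> indicat_real ?L u + indicator ?U u"
        by (auto simp: indicator_def)
      then have "2 * ?B * 1 \<le> 2 * ?B * (indicat_real ?L u + indicator ?U u)"
        using B by (intro mult_left_mono) auto
      then show ?thesis
        using signal_ratio_le[OF r, of u] trimmed_signal_bounds(1)[OF r, of T u] by linarith
    qed
    finally show "?h u \<le> 2 * trimmed_signal T r u + 2 * ?B * (indicator ?L u + indicator ?U u)" .
  qed
  (* otherwise the integral would have the default value 0 *)
  have "integrable (interval_measure P) ?h"
    using eta \<open>0 < \<epsilon>\<close> not_integrable_integral_eq by fastforce
  then have "ennreal (norm (\<integral>u. ?h u \<partial>interval_measure P)) \<le> (\<integral>\<^sup>+u. norm (?h u) \<partial>interval_measure P)"
    by (rule integral_norm_bound_ennreal)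
  moreover have "ennreal \<epsilon> \<le> ennreal (norm (\<integral>u. ?h u \<partial>interval_measure P))"
    using eta by (intro ennreal_leI) auto
  ultimately have "ennreal \<epsilon> \<le> (\<integral>\<^sup>+u. norm (?h u) \<partial>interval_measure P)"
    by order
  also have "\<dots> \<le> (\<integral>\<^sup>+u. ennreal 2 * ennreal (trimmed_signal T r u)
      + (ennreal (2 * ?B) * indicator ?L u + ennreal (2 * ?B) * indicator ?U u) \<partial>interval_measure P)"
  proof (rule nn_integral_mono)
    fix u
    have "norm (?h u) = ?h u"
      using h[of u] by (simp only: real_norm_def abs_of_nonneg)
    also have "\<dots> \<le> 2 * trimmed_signal T r u + (2 * ?B * indicator ?L u + 2 * ?B * indicator ?U u)"
      using conjunct2[OF h[of u]] by (simp only: distrib_left)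
    finally have "ennreal (norm (?h u)) \<le> ennreal (2 * trimmed_signal T r u
        + (2 * ?B * indicator ?L u + 2 * ?B * indicator ?U u))"
      by (rule ennreal_leI)
    also have "\<dots> = ennreal (2 * trimmed_signal T r u)
        + (ennreal (2 * ?B * indicator ?L u) + ennreal (2 * ?B * indicator ?U u))"
      using trimmed_signal_bounds(1)[OF r] B by (simp only: ennreal_plus mult_nonneg_nonneg
          add_nonneg_nonneg indicator_pos_le zero_le_numeral)
    also have "ennreal (2 * ?B * indicator ?L u) = ennreal (2 * ?B) * indicator ?L u"
      by (simp add: indicator_def)
    also have "ennreal (2 * ?B * indicator ?U u) = ennreal (2 * ?B) * indicator ?U u"
      by (simp add: indicator_def)
    also have "ennreal (2 * trimmed_signal T r u) = ennreal 2 * ennreal (trimmed_signal T r u)"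
      using trimmed_signal_bounds(1)[OF r] by (intro ennreal_mult) auto
    finally show "ennreal (norm (?h u)) \<le> ennreal 2 * ennreal (trimmed_signal T r u)
      + (ennreal (2 * ?B) * indicator ?L u + ennreal (2 * ?B) * indicator ?U u)" .
  qed
  also have "\<dots> = ennreal 2 * (\<integral>\<^sup>+u. ennreal (trimmed_signal T r u) \<partial>interval_measure P)
      + (ennreal (2 * ?B) * emeasure (interval_measure P) ?L + ennreal (2 * ?B) * emeasure (interval_measure P) ?U)"
  proof -
    have [measurable]: "trimmed_signal T r \<in> borel_measurable borel"
      by (rule trimmed_signal_measurable[OF r])
    have [measurable]: "?L \<in> sets borel" "?U \<in> sets borel"
      by measurable
    show ?thesis
      by (simp add: nn_integral_add nn_integral_cmult nn_integral_cmult_indicator)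
  qed
  also have "(\<integral>\<^sup>+u. ennreal (trimmed_signal T r u) \<partial>interval_measure P) = ennreal (?\<mu> / real n)"
  proof -
    have "(\<lambda>u. ennreal (trimmed_signal T r u)) \<in> borel_measurable borel"
      using trimmed_signal_measurable[OF r] by measurable
    then have "(\<integral>\<^sup>+u. ennreal (trimmed_signal T r u) \<partial>interval_measure P)
        = (\<Sum>i\<in>{1..n}. \<integral>\<^sup>+\<omega>. ennreal (trimmed_signal T r (X i \<omega>)) \<partial>M) / ennreal (real n)"
      by (rule pooled_distribution(3))
    also have "(\<Sum>i\<in>{1..n}. \<integral>\<^sup>+\<omega>. ennreal (trimmed_signal T r (X i \<omega>)) \<partial>M)
        = (\<Sum>i\<in>{1..n}. ennreal (expectation (\<lambda>\<omega>. trimmed_signal T r (X i \<omega>))))"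
      using integrable_trimmed_signal[OF r] trimmed_signal_bounds(1)[OF r]
      by (intro sum.cong refl nn_integral_eq_integral) auto
    also have "\<dots> = ennreal ?\<mu>"
      using trimmed_signal_bounds(1)[OF r] by (intro sum_ennreal Bochner_Integration.integral_nonneg)
    also have "ennreal ?\<mu> / ennreal (real n) = ennreal (?\<mu> / real n)"
      using n0 trimmed_signal_bounds(1)[OF r]
      by (intro divide_ennreal sum_nonneg Bochner_Integration.integral_nonneg)
    finally show ?thesis .
  qed
  also have "emeasure (interval_measure P) ?L = ennreal (measure (interval_measure P) ?L)"
    by (rule D.emeasure_eq_measure)
  also have "emeasure (interval_measure P) ?U = ennreal (measure (interval_measure P) ?U)"
    by (rule D.emeasure_eq_measure)
  also have "ennreal 2 * ennreal (?\<mu> / real n)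
      + (ennreal (2 * ?B) * ennreal (measure (interval_measure P) ?L)
         + ennreal (2 * ?B) * ennreal (measure (interval_measure P) ?U))
    = ennreal (2 * (?\<mu> / real n) + (2 * ?B * measure (interval_measure P) ?L + 2 * ?B * measure (interval_measure P) ?U))"
  proof -
    have "0 \<le> ?\<mu> / real n"
      using n0 trimmed_signal_bounds(1)[OF r]
      by (intro divide_nonneg_nonneg sum_nonneg Bochner_Integration.integral_nonneg) auto
    then show ?thesis
      using B by (simp only: ennreal_mult[symmetric] ennreal_plus[symmetric] mult_nonneg_nonneg
          add_nonneg_nonneg measure_nonneg zero_le_numeral)
  qed
  finally have "\<epsilon> \<le> 2 * (?\<mu> / real n) + (2 * ?B * measure (interval_measure P) ?L + 2 * ?B * measure (interval_measure P) ?U)"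
    (is "_ \<le> ?rhs")
  proof -
    assume le: "ennreal \<epsilon> \<le> ennreal ?rhs"
    have "0 < ?rhs"
    proof (rule ccontr)
      assume "\<not> 0 < ?rhs"
      then have "ennreal ?rhs = 0"
        by (intro ennreal_neg) simp
      then show False
        using le \<open>0 < \<epsilon>\<close> by simp
    qed
    then show ?thesis
      using le by simp
  qed
  also have "2 * ?B * measure (interval_measure P) ?L \<le> 2 * ?B * (T / real n)"
    using D.prob_cdf_less(1)[unfolded pooled_distribution(2), OF P_cont, of "T / real n"] B \<open>0 \<le> T\<close> n0
    by (intro mult_left_mono) auto
  also have "2 * ?B * measure (interval_measure P) ?U \<le> 2 * ?B * (T / real n)"
    using D.prob_cdf_less(2)[unfolded pooled_distribution(2), OF P_cont, of "T / real n"] B \<open>0 \<le> T\<close> n0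
    by (intro mult_left_mono) auto
  finally have "\<epsilon> \<le> 2 * (?\<mu> / real n) + (2 * ?B * (T / real n) + 2 * ?B * (T / real n))"
    by simp
  also have "\<dots> = 2 * (?\<mu> / real n) + 16 * T / len"
    using n0 len_pos by (simp add: field_simps)
  finally have "\<epsilon> - 16 * T / len \<le> 2 * (?\<mu> / real n)"
    by simp
  then have "real n / 2 * (\<epsilon> - 16 * T / len) \<le> real n / 2 * (2 * (?\<mu> / real n))"
    by (intro mult_left_mono) auto
  also have "\<dots> = ?\<mu>"
    using n0 by simp
  finally show ?thesis .
qed

definition signal_event :: "real \<Rightarrow> real \<Rightarrow> 'a set" where
  "signal_event \<epsilon> T = {\<omega> \<in> space M. \<forall>r\<in>{..<K}. real n * \<epsilon> / 16 < (\<Sum>i\<in>{1..n}. trimmed_signal T r (X i \<omega>))}"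

lemma signal_sum_measurable:
  assumes "r < K"
  shows "(\<lambda>\<omega>. \<Sum>i\<in>{1..n}. trimmed_signal T r (X i \<omega>)) \<in> borel_measurable M"
  by (intro borel_measurable_sum measurable_compose[OF rv_X trimmed_signal_measurable[OF assms]])

lemma signal_event_sets: "signal_event \<epsilon> T \<in> events"
  unfolding signal_event_def
  by (intro sets.sets_Collect_finite_All borel_measurable_less signal_sum_measurable
      borel_measurable_const) auto

text \<open>
  The exponential inequality for each of the change-points, with mean at least \<open>n * \<epsilon> / 4\<close> and
  summands at most \<open>4 * n / len\<close>.
\<close>

lemma prob_signal_event:
  assumes "0 \<le> T" "0 < \<epsilon>" and T: "32 * T \<le> \<epsilon> * len"
    and eta: "\<And>r. r < K \<Longrightarrow>
      \<epsilon> \<le> (\<integral>u. eta_r F (Suc r) u / (P u * (1 - P u)) \<partial>interval_measure P)"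
  shows "1 - real n * exp (- (\<epsilon> * len / 64)) \<le> prob (signal_event \<epsilon> T)"
proof -
  define B where "B r = {\<omega> \<in> space M. (\<Sum>i\<in>{1..n}. trimmed_signal T r (X i \<omega>)) \<le> real n * \<epsilon> / 16}" for r
  have B: "B r \<in> events" if "r < K" for r
    unfolding B_def using signal_sum_measurable[OF that] by measurable
  have prob_B: "prob (B r) \<le> exp (- (\<epsilon> * len / 64))" if r: "r < K" for r
  proof -
    define \<mu> where "\<mu> = (\<Sum>i\<in>{1..n}. expectation (\<lambda>\<omega>. trimmed_signal T r (X i \<omega>)))"
    have "16 * T / len \<le> \<epsilon> / 2"
      using T len_pos by (simp add: field_simps)
    then have "real n / 2 * (\<epsilon> / 2) \<le> real n / 2 * (\<epsilon> - 16 * T / len)"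
      by (intro mult_left_mono) auto
    also have "\<dots> \<le> \<mu>"
      unfolding \<mu>_def using assms by (intro mean_trimmed_signal_ge r eta) auto
    finally have \<mu>: "real n * \<epsilon> / 4 \<le> \<mu>"
      by simp
    have "prob (B r) \<le> prob {\<omega> \<in> space M. (\<Sum>i\<in>{1..n}. trimmed_signal T r (X i \<omega>)) \<le> \<mu> / 4}"
      unfolding B_def using signal_sum_measurable[OF r, of T] \<mu>
      by (intro finite_measure_mono) (auto intro: order_trans)
    also have "\<dots> \<le> exp (- \<mu> / (4 * (4 * real n / len)))"
    proof (rule prob_sum_le_quarter_mean)
      show "indep_vars (\<lambda>_. borel) (\<lambda>i \<omega>. trimmed_signal T r (X i \<omega>)) {1..n}"
        by (rule indep_vars_compose2[OF indep]) (rule trimmed_signal_measurable[OF r])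
    qed (use trimmed_signal_bounds[OF r] len_pos n3 in \<open>auto simp: \<mu>_def\<close>)
    also have "\<dots> \<le> exp (- (\<epsilon> * len / 64))"
    proof -
      have "\<epsilon> * len / 64 = (real n * \<epsilon> / 4) / (4 * (4 * real n / len))"
        using n3 by simp
      also have "\<dots> \<le> \<mu> / (4 * (4 * real n / len))"
        using \<mu> len_pos by (intro divide_right_mono) auto
      finally show ?thesis
        by simp
    qed
    finally show ?thesis .
  qed
  have "prob (\<Union>r\<in>{..<K}. B r) \<le> (\<Sum>r\<in>{..<K}. prob (B r))"
    using B by (intro finite_measure_subadditive_finite) auto
  also have "\<dots> \<le> (\<Sum>r\<in>{..<K}. exp (- (\<epsilon> * len / 64)))"
    using prob_B by (intro sum_mono) auto
  also have "\<dots> \<le> real n * exp (- (\<epsilon> * len / 64))"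
    using K_less_n by (simp add: mult_right_mono)
  finally have "prob (\<Union>r\<in>{..<K}. B r) \<le> real n * exp (- (\<epsilon> * len / 64))" .
  moreover have "signal_event \<epsilon> T = space M - (\<Union>r\<in>{..<K}. B r)"
    unfolding signal_event_def B_def not_less[symmetric] by blast
  then have "prob (signal_event \<epsilon> T) = 1 - prob (\<Union>r\<in>{..<K}. B r)"
    using B by (simp add: prob_compl sets.finite_UN)
  ultimately show ?thesis
    by linarith
qed

text \<open>
  Dividing \<open>n * \<epsilon> / 16\<close>, half of which pays for the two extreme ranks, by the factor \<open>9 * n\<close> of the
  comparison between ranks and \<open>P\<close> gives \<open>\<epsilon> / 288\<close>.
\<close>

lemma weighted_signal_ge:
  assumes fit: "\<omega> \<in> fit_event t" and "0 \<le> t"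
    and sig: "\<omega> \<in> signal_event \<epsilon> (real (Suc K) * (4 * (t + 8) + 16))"
    and "256 \<le> \<epsilon> * len" and r: "r < K"
  shows "\<epsilon> / 288 \<le> (\<Sum>l = 2..n - 1. weight n l *
      hel (F (Suc r) (order_stat n (\<lambda>i. X i \<omega>) l)) (F (Suc (Suc r)) (order_stat n (\<lambda>i. X i \<omega>) l)))"
proof -
  interpret W: well_fitted_sample n K \<tau> F "\<lambda>i. X i \<omega>" "t + 8"
    by (rule well_fitted_on_fit_event[OF fit \<open>0 \<le> t\<close>])
  let ?T = "real (Suc K) * (4 * (t + 8) + 16)"
  let ?W = "\<Sum>l = 2..n - 1. weight n l * signal r (order_stat n (\<lambda>i. X i \<omega>) l)"
  have "real n * \<epsilon> / 16 < (\<Sum>i = 1..n. trimmed_signal ?T r (X i \<omega>))"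
    using sig r unfolding signal_event_def by blast
  then have "real n * \<epsilon> / 16 - 2 * (4 * real n / len)
      \<le> (\<Sum>i = 1..n. trimmed_signal ?T r (X i \<omega>)) - 2 * (4 * real n / len)"
    by linarith
  also have "\<dots> \<le> 9 * real n * ?W"
    using trimmed_signal_bounds(2)[OF r, of ?T]
    unfolding trimmed_signal_def
    by (intro W.weighted_sum_ge[where g = "signal r" and B = "4 * real n / len"]
        signal_nonneg P_cont)
  finally have "real n * (\<epsilon> / 16 - 8 / len) \<le> real n * (9 * ?W)"
    by (simp add: algebra_simps)
  then have "\<epsilon> / 16 - 8 / len \<le> 9 * ?W"
    using n3 by simp
  moreover have "8 / len \<le> \<epsilon> / 32"
    using \<open>256 \<le> \<epsilon> * len\<close> len_pos by (simp add: field_simps)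
  ultimately show ?thesis
    by (simp add: signal_def)
qed

end

end

section \<open>Measurability of the estimator\<close>

lemma finite_candidates: "finite (candidates n L)"
proof (rule finite_subset)
  show "candidates n L \<subseteq> {ts. set ts \<subseteq> {..n} \<and> length ts = L}"
    by (auto simp: candidates_def)
qed (simp add: finite_lists_length_eq)

lemma candidates_nonempty:
  assumes "L < n"
  shows "candidates n L \<noteq> {}"
proof -
  have "[2..<L + 2] \<in> candidates n L"
    using assms by (auto simp: candidates_def simp del: upt_Suc)
  then show ?thesis
    by blast
qed

lemma real_card_eq_sum_if:
  assumes "finite I"
  shows "real (card {i \<in> I. Q i}) = (\<Sum>i\<in>I. if Q i then 1 else 0)"
  using assms by (simp add: sum.inter_filter[symmetric])

text \<open>
  The value of \<open>arg_min\<close> is a choice from the set of minimisers, and there are only finitely many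
  possibilities for that set.
\<close>

lemma arg_min_set_measurable:
  fixes f :: "nat \<Rightarrow> 'a \<Rightarrow> real"
  assumes fin: "finite I" and f: "\<And>L. L \<in> I \<Longrightarrow> f L \<in> borel_measurable M"
    and Q: "\<And>L. Q L \<longleftrightarrow> L \<in> I"
  shows "{\<omega> \<in> space M. arg_min (\<lambda>L. f L \<omega>) Q = k} \<in> sets M"
proof -
  define S where "S \<omega> = {L \<in> I. \<forall>L'\<in>I. f L \<omega> \<le> f L' \<omega>}" for \<omega>
  have arg_min: "arg_min (\<lambda>L. f L \<omega>) Q = (SOME L. L \<in> S \<omega>)" for \<omega>
    unfolding arg_min_def is_arg_min_def S_def Q
    by (rule arg_cong[where f = Eps]) (auto simp: fun_eq_iff not_less)
  have ev: "{\<omega> \<in> space M. S \<omega> = A} \<in> sets M" if "A \<subseteq> I" for A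
  proof -
    have "{\<omega> \<in> space M. S \<omega> = A} = {\<omega> \<in> space M. \<forall>L\<in>I. (\<forall>L'\<in>I. f L \<omega> \<le> f L' \<omega>) \<longleftrightarrow> L \<in> A}"
      using that unfolding S_def by blast
    also have "\<dots> \<in> sets M"
    proof (intro sets.sets_Collect_finite_All[OF _ fin])
      fix L assume L: "L \<in> I"
      have *: "{\<omega> \<in> space M. \<forall>L'\<in>I. f L \<omega> \<le> f L' \<omega>} \<in> sets M"
        using f L by (intro sets.sets_Collect_finite_All fin borel_measurable_le) auto
      show "{\<omega> \<in> space M. (\<forall>L'\<in>I. f L \<omega> \<le> f L' \<omega>) \<longleftrightarrow> L \<in> A} \<in> sets M"
        using * sets.sets_Collect_neg[OF *] by (cases "L \<in> A") (simp_all only: simp_thms)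
    qed
    finally show ?thesis .
  qed
  have "{\<omega> \<in> space M. arg_min (\<lambda>L. f L \<omega>) Q = k}
      = (\<Union>A\<in>{A \<in> Pow I. (SOME L. L \<in> A) = k}. {\<omega> \<in> space M. S \<omega> = A})"
    unfolding arg_min by (auto simp: S_def)
  also have "\<dots> \<in> sets M"
    using fin by (intro sets.finite_UN ev) auto
  finally show ?thesis .
qed

context
  fixes M :: "'a measure" and X :: "nat \<Rightarrow> 'a \<Rightarrow> real" and n :: nat
  assumes X: "\<And>i. i \<in> {1..n} \<Longrightarrow> X i \<in> borel_measurable M"
begin

lemma order_stat_measurable:
  assumes "1 \<le> l" "l \<le> n"
  shows "(\<lambda>\<omega>. order_stat n (\<lambda>i. X i \<omega>) l) \<in> borel_measurable M"
  unfolding borel_measurable_iff_le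
proof (intro allI)
  fix u
  have "order_stat n (\<lambda>i. X i \<omega>) l \<le> u \<longleftrightarrow> real l \<le> (\<Sum>i\<in>{1..n}. if X i \<omega> \<le> u then 1 else 0)" for \<omega>
    unfolding order_stat_le_iff[OF assms] by (subst real_card_eq_sum_if[symmetric]) simp_all
  then have "{\<omega> \<in> space M. order_stat n (\<lambda>i. X i \<omega>) l \<le> u}
      = {\<omega> \<in> space M. real l \<le> (\<Sum>i\<in>{1..n}. if X i \<omega> \<le> u then 1 else 0)}"
    by simp
  also have "\<dots> \<in> sets M"
    by (intro borel_measurable_le borel_measurable_sum borel_measurable_const measurable_If X) auto
  finally show "{\<omega> \<in> space M. order_stat n (\<lambda>i. X i \<omega>) l \<le> u} \<in> sets M" .
qed

lemma ecdf_measurable: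
  assumes "1 \<le> a" "b \<le> n + 1" and u: "u \<in> borel_measurable M"
  shows "(\<lambda>\<omega>. ecdf (\<lambda>i. X i \<omega>) a b (u \<omega>)) \<in> borel_measurable M"
proof -
  have "ecdf (\<lambda>i. X i \<omega>) a b (u \<omega>) = (\<Sum>i\<in>{a..<b}. if X i \<omega> \<le> u \<omega> then 1 else 0) / real (b - a)" for \<omega>
    unfolding ecdf_def by (subst real_card_eq_sum_if) simp_all
  moreover have "(\<lambda>\<omega>. (\<Sum>i\<in>{a..<b}. if X i \<omega> \<le> u \<omega> then 1 else 0) / real (b - a)) \<in> borel_measurable M"
  proof (intro borel_measurable_divide borel_measurable_sum borel_measurable_const measurable_If)
    fix i assume "i \<in> {a..<b}"
    then have "X i \<in> borel_measurable M"
      using assms by (intro X) auto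
    then show "{\<omega> \<in> space M. X i \<omega> \<le> u \<omega>} \<in> sets M"
      using u by (intro borel_measurable_le)
  qed
  ultimately show ?thesis
    by (simp only:)
qed

lemma R_obj_measurable:
  assumes ts: "ts \<in> candidates n L"
  shows "(\<lambda>\<omega>. R_obj n (\<lambda>i. X i \<omega>) ts) \<in> borel_measurable M"
proof (cases "n = 0")
  case False
  have range: "1 \<le> (1 # ts @ [n + 1]) ! k \<and> (1 # ts @ [n + 1]) ! k \<le> n + 1"
    if "k \<le> length ts + 1" for k
  proof -
    have "(1 # ts @ [n + 1]) ! k \<in> set (1 # ts @ [n + 1])"
      using that by (intro nth_mem) auto
    then show ?thesis
      using ts by (auto simp: candidates_def)
  qed
  have [measurable]: "neg_entropy \<in> borel_measurable borel"
    unfolding neg_entropy_def[abs_def] by measurable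
  show ?thesis
    unfolding R_obj_def Let_def
  proof (intro borel_measurable_times borel_measurable_const borel_measurable_sum borel_measurable_divide)
    fix k l assume k: "k \<in> {0..length ts}" and l: "l \<in> {2..n - 1}"
    have "(\<lambda>\<omega>. ecdf (\<lambda>i. X i \<omega>) ((1 # ts @ [n + 1]) ! k) ((1 # ts @ [n + 1]) ! (k + 1))
        (order_stat n (\<lambda>i. X i \<omega>) l)) \<in> borel_measurable M"
      using range[of k] range[of "k + 1"] k l by (intro ecdf_measurable order_stat_measurable) auto
    then show "(\<lambda>\<omega>. neg_entropy (ecdf (\<lambda>i. X i \<omega>) ((1 # ts @ [n + 1]) ! k) ((1 # ts @ [n + 1]) ! (k + 1))
        (order_stat n (\<lambda>i. X i \<omega>) l))) \<in> borel_measurable M"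
      by measurable
  qed
qed (simp add: R_obj_def)

lemma K_hat_measurable: "{\<omega> \<in> space M. K_hat n \<zeta> Kbar (\<lambda>i. X i \<omega>) = k} \<in> sets M"
proof -
  have "(\<lambda>\<omega>. BIC n \<zeta> (\<lambda>i. X i \<omega>) L) \<in> borel_measurable M" for L
  proof -
    have "(\<lambda>\<omega>. Max ((\<lambda>ts. R_obj n (\<lambda>i. X i \<omega>) ts) ` candidates n L)) \<in> borel_measurable M"
      by (intro borel_measurable_Max finite_candidates R_obj_measurable)
    then show ?thesis
      unfolding BIC_def by measurable
  qed
  then show ?thesis
    unfolding K_hat_def by (intro arg_min_set_measurable[where I = "{1..Kbar}"]) auto
qed

end

section \<open>Consistency for a fixed sample size\<close>

lemma K_hat_eqI:
  assumes "1 \<le> K" "K \<le> Kbar"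
    and less: "\<And>L. 1 \<le> L \<Longrightarrow> L \<le> Kbar \<Longrightarrow> L \<noteq> K \<Longrightarrow> BIC n \<zeta> x K < BIC n \<zeta> x L"
  shows "K_hat n \<zeta> Kbar x = K"
  unfolding K_hat_def arg_min_def
proof (rule some_equality)
  show "is_arg_min (BIC n \<zeta> x) (\<lambda>L. 1 \<le> L \<and> L \<le> Kbar) K"
    unfolding is_arg_min_def using assms(1,2) less by (metis less_asym less_irrefl)
  show "L = K" if "is_arg_min (BIC n \<zeta> x) (\<lambda>L. 1 \<le> L \<and> L \<le> Kbar) L" for L
    using that assms(1,2) less[of L] unfolding is_arg_min_def by metis
qed

text \<open>
  Additional change-points gain at most the noise, which one penalty \<open>\<zeta>\<close> outweighs. With too few
  of them the loss at a missed change-point outweighs the noise and all the penalties saved. The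
  factor \<open>4 * Kbar\<^sup>2\<close> bounds the number of pairs of a proposed block and a true segment.
\<close>

lemma (in well_fitted_sample) K_hat_eq:
  assumes K: "1 \<le> K" "K \<le> Kbar" and "Kbar < n" "0 < \<delta>"
    and \<delta>: "\<And>j. j \<le> K \<Longrightarrow> 2 * \<delta> \<le> \<tau> (Suc j) - \<tau> j"
    and signal: "\<And>r. r < K \<Longrightarrow>
      G \<le> (\<Sum>l = 2..n - 1. weight n l * hel (F (Suc r) (order_stat n x l)) (F (Suc (Suc r)) (order_stat n x l)))"
    and "0 \<le> \<zeta>"
    and over: "4 * ln (real n) * (4 * real Kbar ^ 2 * s) < \<zeta>"
    and under: "4 * ln (real n) * (4 * real Kbar ^ 2 * s + (2 * s + 8)) + real Kbar * \<zeta> < real \<delta> / 8 * G"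
  shows "K_hat n \<zeta> Kbar x = K"
proof (rule K_hat_eqI[OF K])
  fix L assume L: "1 \<le> L" "L \<le> Kbar" "L \<noteq> K"
  let ?R = "R_obj n x"
  have ln0: "0 \<le> 4 * ln (real n)"
    using n3 by simp
  have "Max (?R ` candidates n L) \<in> ?R ` candidates n L"
    using L \<open>Kbar < n\<close> by (intro Max_in) (auto simp: finite_candidates candidates_nonempty)
  then obtain ts where ts: "ts \<in> candidates n L" and max: "Max (?R ` candidates n L) = ?R ts"
    by auto
  have BIC_L: "BIC n \<zeta> x L = - ?R ts + real L * \<zeta>"
    by (simp add: BIC_def max)
  have "?R (change_points K \<tau>) \<le> Max (?R ` candidates n K)"
    by (intro Max_ge finite_imageI finite_candidates imageI change_points_candidate)
  then have BIC_K: "BIC n \<zeta> x K \<le> - ?R (change_points K \<tau>) + real K * \<zeta>"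
    by (simp add: BIC_def)
  have pairs: "real (Suc L * Suc K) * s \<le> 4 * real Kbar ^ 2 * s"
  proof -
    have "Suc L * Suc K \<le> (2 * Kbar) * (2 * Kbar)"
      using L K by (intro mult_le_mono) auto
    then have "real (Suc L * Suc K) \<le> real ((2 * Kbar) * (2 * Kbar))"
      by (rule of_nat_mono)
    then show ?thesis
      using s_nonneg by (intro mult_right_mono) (simp_all add: power2_eq_square)
  qed
  show "BIC n \<zeta> x K < BIC n \<zeta> x L"
  proof (cases "K < L")
    case True
    then have "(real K + 1) * \<zeta> \<le> real L * \<zeta>"
      using \<open>0 \<le> \<zeta>\<close> by (intro mult_right_mono) auto
    then have "real K * \<zeta> + \<zeta> \<le> real L * \<zeta>"
      by (simp add: distrib_right)
    moreover have "?R ts \<le> ?R (change_points K \<tau>) + 4 * ln (real n) * (4 * real Kbar ^ 2 * s)"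
      using R_obj_le[OF ts] mult_left_mono[OF pairs ln0] by linarith
    ultimately show ?thesis
      using BIC_L BIC_K over by linarith
  next
    case False
    then have "L < K"
      using L by simp
    have "real K * \<zeta> \<le> real Kbar * \<zeta>" "0 \<le> real L * \<zeta>"
      using K \<open>0 \<le> \<zeta>\<close> by (auto intro!: mult_right_mono)
    moreover have "?R ts \<le> ?R (change_points K \<tau>)
        + 4 * ln (real n) * (4 * real Kbar ^ 2 * s + (2 * s + 8)) - real \<delta> / 8 * G"
      using R_obj_le_of_missing[OF ts \<open>L < K\<close> \<open>0 < \<delta>\<close> \<delta> signal]
        mult_left_mono[OF add_right_mono[OF pairs, of "2 * s + 8"] ln0] by linarith
    ultimately show ?thesis
      using BIC_L BIC_K under by linarith
  qed
qed

text \<open>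
  With divergence bound \<open>t = 6 * ln n\<close> the fit fails with probability of order
  \<open>n\<^sup>5 * n powr - 6\<close>. The total noise is then of order \<open>Kbar\<^sup>2 * (ln n)\<^sup>2\<close>, which is why the
  penalty has to exceed a multiple of that. A missed change-point costs about
  \<open>m / 4 / 8 * (\<epsilon> / 288) = \<epsilon> * m / 9216\<close> and has to exceed \<open>4 * Kbar * \<zeta>\<close>; this explains the
  constant \<open>36864 = 4 * 9216\<close>.
\<close>

lemma (in change_point_model) prob_K_hat_eq_ge:
  fixes m Kbar :: nat and \<zeta> \<epsilon> :: real
  assumes K: "1 \<le> K" "K \<le> Kbar" and Kbar: "2 \<le> Kbar" and "0 < \<epsilon>"
    and m: "\<And>j. j \<le> K \<Longrightarrow> m \<le> \<tau> (Suc j) - \<tau> j"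
    and eta: "\<And>r. r < K \<Longrightarrow>
      \<epsilon> \<le> (\<integral>u. eta_r F (Suc r) u / (P u * (1 - P u)) \<partial>interval_measure P)"
    and \<zeta>: "1000 * real Kbar ^ 3 * ln (real n) ^ 2 \<le> \<zeta>"
    and rate: "real Kbar * \<zeta> \<le> real m" "36864 * (real Kbar * \<zeta>) \<le> \<epsilon> * real m"
  shows "1 - 5 / real n \<le> prob {\<omega> \<in> space M. K_hat n \<zeta> Kbar (\<lambda>i. X i \<omega>) = K}"
proof -
  define l where "l = ln (real n)"
  define k where "k = real Kbar"
  define t where "t = 6 * l"
  define T where "T = real (Suc K) * (4 * (t + 8) + 16)"
  have l1: "1 \<le> l"
  proof -
    have "exp 1 \<le> real n"
      using n8 exp_le by linarith
    then show ?thesis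
      using n8 by (simp add: l_def ln_ge_iff)
  qed
  have k2: "2 \<le> k"
    using Kbar by (simp add: k_def)
  have ll: "l \<le> l\<^sup>2" "1 \<le> l\<^sup>2"
    using l1 mult_mono[of 1 l 1 l] by (auto simp: power2_eq_square)
  have kl: "2 * (k\<^sup>2 * l\<^sup>2) \<le> k ^ 3 * l\<^sup>2" "4 * l\<^sup>2 \<le> k\<^sup>2 * l\<^sup>2"
  proof -
    have "2 * (k\<^sup>2 * l\<^sup>2) \<le> k * (k\<^sup>2 * l\<^sup>2)"
      using k2 by (intro mult_right_mono) auto
    then show "2 * (k\<^sup>2 * l\<^sup>2) \<le> k ^ 3 * l\<^sup>2"
      by (simp add: power3_eq_cube power2_eq_square mult.assoc)
    have "2\<^sup>2 \<le> k\<^sup>2"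
      using k2 by (intro power_mono) auto
    then show "4 * l\<^sup>2 \<le> k\<^sup>2 * l\<^sup>2"
      by (intro mult_right_mono) auto
  qed
  have \<zeta>_ge: "2000 * (k\<^sup>2 * l\<^sup>2) \<le> \<zeta>" "8000 * l\<^sup>2 \<le> \<zeta>"
    using \<zeta> kl unfolding l_def[symmetric] k_def[symmetric] by linarith+
  have \<zeta>_l: "8000 * l \<le> \<zeta>" "8000 \<le> \<zeta>"
    using \<zeta>_ge ll by linarith+
  have k\<zeta>: "2 * \<zeta> \<le> k * \<zeta>" "8000 * (k * l) \<le> k * \<zeta>"
  proof -
    show "2 * \<zeta> \<le> k * \<zeta>"
      using k2 \<zeta>_l by (intro mult_right_mono) auto
    have "k * (8000 * l) \<le> k * \<zeta>"
      using k2 \<zeta>_l by (intro mult_left_mono) auto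
    then show "8000 * (k * l) \<le> k * \<zeta>"
      by simp
  qed
  have rate': "k * \<zeta> \<le> real m" "36864 * (k * \<zeta>) \<le> \<epsilon> * real m"
    using rate by (simp_all add: k_def)
  have m4: "4 \<le> m"
    using rate'(1) k\<zeta> \<zeta>_l by linarith
  have m_card: "real m \<le> real (card (segment j))" if "j \<le> K" for j
    using m[OF that] by simp
  have "m \<le> n"
    using m[of 0] tau_first tau_le[of "Suc 0"] by simp
  have "k * 1 < k * \<zeta>"
    using k2 \<zeta>_l by (intro mult_strict_left_mono) auto
  then have Kbar_n: "Kbar < n"
    using rate'(1) \<open>m \<le> n\<close> by (simp add: k_def)
  have m0: "0 < real m"
    using m4 by simp
  have T_le: "32 * T \<le> \<epsilon> * real m"
  proof -
    have "T \<le> (2 * k) * (72 * l)"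
      unfolding T_def t_def using K l1 k2 by (intro mult_mono) (auto simp: k_def)
    then have "T \<le> 144 * (k * l)"
      by simp
    moreover have "0 \<le> k * l"
      using k2 l1 by simp
    ultimately show ?thesis
      using rate' k\<zeta> by linarith
  qed
  have T0: "0 \<le> T"
    using l1 by (simp add: T_def t_def)
  let ?A = "fit_event t \<inter> signal_event \<epsilon> T"
  have K_hat: "K_hat n \<zeta> Kbar (\<lambda>i. X i \<omega>) = K" if \<omega>: "\<omega> \<in> ?A" for \<omega>
  proof -
    have fit: "\<omega> \<in> fit_event t" and t0: "0 \<le> t"
      using \<omega> l1 by (simp_all add: t_def)
    interpret W: well_fitted_sample n K \<tau> F "\<lambda>i. X i \<omega>" "t + 8"
      by (rule well_fitted_on_fit_event[OF fit t0])
    have noise: "4 * l * (4 * k\<^sup>2 * (t + 8)) \<le> 224 * (k\<^sup>2 * l\<^sup>2)"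
    proof -
      have "4 * l * (4 * k\<^sup>2 * (t + 8)) \<le> 4 * l * (4 * k\<^sup>2 * (14 * l))"
        unfolding t_def using l1 by (intro mult_left_mono) auto
      then show ?thesis
        by (simp add: power2_eq_square mult_ac)
    qed
    have noise2: "4 * l * (2 * (t + 8) + 8) \<le> 144 * l\<^sup>2"
    proof -
      have "4 * l * (2 * (t + 8) + 8) \<le> 4 * l * (36 * l)"
        unfolding t_def using l1 by (intro mult_left_mono) auto
      then show ?thesis
        by (simp add: power2_eq_square mult_ac)
    qed
    have sig: "256 \<le> \<epsilon> * real m"
      using rate' k\<zeta> \<zeta>_l by linarith
    show ?thesis
    proof (rule W.K_hat_eq[where \<delta> = "m div 2" and G = "\<epsilon> / 288"])
      show "2 * (m div 2) \<le> \<tau> (Suc j) - \<tau> j" if "j \<le> K" for j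
        using m[OF that] by linarith
      show "\<epsilon> / 288 \<le> (\<Sum>l = 2..n - 1. weight n l *
          hel (F (Suc r) (order_stat n (\<lambda>i. X i \<omega>) l)) (F (Suc (Suc r)) (order_stat n (\<lambda>i. X i \<omega>) l)))"
        if "r < K" for r
        by (rule weighted_signal_ge[OF m0 m_card fit t0 _ sig]) (use \<omega> that in \<open>auto simp: T_def\<close>)
      show "4 * ln (real n) * (4 * (real Kbar)\<^sup>2 * (t + 8)) < \<zeta>"
        using noise \<zeta>_ge \<zeta>_l unfolding l_def[symmetric] k_def[symmetric] by linarith
      have "4 * l * (4 * k\<^sup>2 * (t + 8) + (2 * (t + 8) + 8)) + k * \<zeta> < 4 * (k * \<zeta>)"
        using noise noise2 \<zeta>_ge \<zeta>_l k\<zeta>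
        unfolding distrib_left[of "4 * l" "4 * k\<^sup>2 * (t + 8)"] by linarith
      also have "4 * (k * \<zeta>) \<le> real m / 4 / 8 * (\<epsilon> / 288)"
        using rate'(2) by (simp add: mult.commute)
      also have "\<dots> \<le> real (m div 2) / 8 * (\<epsilon> / 288)"
      proof -
        have "m \<le> 4 * (m div 2)"
          using m4 by linarith
        then have "real m / 4 \<le> real (m div 2)"
          by linarith
        then show ?thesis
          using \<open>0 < \<epsilon>\<close> by (intro mult_right_mono divide_right_mono) auto
      qed
      finally show "4 * ln (real n) * (4 * (real Kbar)\<^sup>2 * (t + 8) + (2 * (t + 8) + 8)) + real Kbar * \<zeta>
          < real (m div 2) / 8 * (\<epsilon> / 288)"
        unfolding l_def k_def .
    qed (use K Kbar_n m4 \<zeta>_l in auto)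
  qed
  have "1 - real (n * n * n * (n + 1)) * ((real n + 1) * exp (- t)) \<le> prob (fit_event t)"
    by (rule prob_fit_event)
  moreover have "real (n * n * n * (n + 1)) * ((real n + 1) * exp (- t)) \<le> 4 / real n"
  proof -
    define N where "N = real n"
    have N: "1 \<le> N"
      using n8 by (simp add: N_def)
    have "exp t = exp l ^ 6"
      unfolding t_def using exp_of_nat_mult[of 6 l] by simp
    also have "exp l = N"
      using n8 by (simp add: l_def N_def)
    finally have exp_t: "exp (- t) = 1 / N ^ 6"
      by (simp add: exp_minus inverse_eq_divide)
    have "real (n * n * n * (n + 1)) * (real n + 1) = N ^ 3 * ((N + 1) * (N + 1))"
      by (simp add: N_def power3_eq_cube algebra_simps)
    also have "\<dots> \<le> N ^ 3 * ((2 * N) * (2 * N))"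
      using N by (intro mult_left_mono mult_mono) auto
    also have "\<dots> = 4 * N ^ 5"
      by (simp add: power_numeral_reduce)
    finally have "real (n * n * n * (n + 1)) * (real n + 1) * exp (- t) \<le> 4 * N ^ 5 * (1 / N ^ 6)"
      unfolding exp_t using N by (intro mult_right_mono) auto
    also have "N ^ 6 = N ^ 5 * N"
      by (simp add: power_numeral_reduce)
    also have "4 * N ^ 5 * (1 / (N ^ 5 * N)) = 4 / N"
      using N by simp
    finally show ?thesis
      by (simp only: N_def mult.assoc)
  qed
  ultimately have 1: "1 - 4 / real n \<le> prob (fit_event t)"
    by linarith
  have "1 - real n * exp (- (\<epsilon> * real m / 64)) \<le> prob (signal_event \<epsilon> T)"
    by (rule prob_signal_event[OF m0 m_card T0 \<open>0 < \<epsilon>\<close> T_le eta])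
  moreover have "real n * exp (- (\<epsilon> * real m / 64)) \<le> 1 / real n"
  proof -
    have "2 * l \<le> \<epsilon> * real m / 64"
      using rate' k\<zeta> \<zeta>_l l1 by linarith
    then have "exp (- (\<epsilon> * real m / 64)) \<le> exp (- (2 * l))"
      by simp
    also have "exp (- (2 * l)) = 1 / (real n * real n)"
    proof -
      have "exp (2 * l) = exp l ^ 2"
        using exp_of_nat_mult[of 2 l] by simp
      also have "exp l = real n"
        using n8 by (simp add: l_def)
      finally show ?thesis
        by (simp add: exp_minus inverse_eq_divide power2_eq_square)
    qed
    finally have "real n * exp (- (\<epsilon> * real m / 64)) \<le> real n * (1 / (real n * real n))"
      by (intro mult_left_mono) auto
    then show ?thesis
      using n8 by simp
  qed
  ultimately have 2: "1 - 1 / real n \<le> prob (signal_event \<epsilon> T)"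
    by linarith
  have sets: "fit_event t \<in> events" "signal_event \<epsilon> T \<in> events"
    by (rule fit_event_sets) (rule signal_event_sets[OF m0 m_card])
  have "prob (fit_event t \<union> signal_event \<epsilon> T) = prob (fit_event t) + prob (signal_event \<epsilon> T) - prob ?A"
    using sets by (intro measure_Un3) (simp_all add: fmeasurable_eq_sets)
  moreover have "5 / real n = 4 / real n + 1 / real n"
    by simp
  ultimately have "1 - 5 / real n \<le> prob ?A"
    using 1 2 prob_le_1[of "fit_event t \<union> signal_event \<epsilon> T"] by linarith
  also have "prob ?A \<le> prob {\<omega> \<in> space M. K_hat n \<zeta> Kbar (\<lambda>i. X i \<omega>) = K}"
  proof (rule finite_measure_mono)
    show "{\<omega> \<in> space M. K_hat n \<zeta> Kbar (\<lambda>i. X i \<omega>) = K} \<in> events"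
      by (rule K_hat_measurable[OF rv_X])
    show "?A \<subseteq> {\<omega> \<in> space M. K_hat n \<zeta> Kbar (\<lambda>i. X i \<omega>) = K}"
      using K_hat sets.sets_into_space[OF sets(1)] by blast
  qed
  finally show ?thesis .
qed

section \<open>Consistency of the number of change-points\<close>

lemma K_hat_single_candidate: "K_hat n \<zeta> 1 x = 1"
  by (rule K_hat_eqI) auto

lemma min_segment_le:
  assumes "j \<le> K"
  shows "min_segment K \<tau> \<le> \<tau> (Suc j) - \<tau> j"
proof -
  have "min_segment K \<tau> \<le> (\<lambda>k. \<tau> k - \<tau> (k - 1)) (Suc j)"
    unfolding min_segment_def using assms by (intro Min_le imageI finite_imageI) auto
  then show ?thesis
    by simp
qed

lemma eta_min_le:
  assumes "r < K" "\<epsilon> \<le> eta_min n K \<tau> F"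
  shows "\<epsilon> \<le> (\<integral>u. eta_r F (Suc r) u / (pooled_cdf n K \<tau> F u * (1 - pooled_cdf n K \<tau> F u))
      \<partial>interval_measure (pooled_cdf n K \<tau> F))"
proof -
  have "eta_min n K \<tau> F \<le> (\<lambda>r. \<integral>u. eta_r F r u / (pooled_cdf n K \<tau> F u * (1 - pooled_cdf n K \<tau> F u))
      \<partial>interval_measure (pooled_cdf n K \<tau> F)) (Suc r)"
    unfolding eta_min_def Let_def using assms by (intro Min_le imageI finite_imageI) auto
  then show ?thesis
    using assms(2) by simp
qed

text \<open>
  The factor \<open>(ln n) powr c\<close> of the penalty exceeds every constant, and \<open>(ln k)\<^sup>2 \<ge> 1 / 4\<close>.
\<close>

lemma zeta_ge_eventually:
  assumes "0 < c"
  shows "eventually (\<lambda>n. \<forall>k\<ge>2. 1000 * real k ^ 3 * ln (real n) ^ 2 \<le> zeta c k n) sequentially"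
proof -
  have "filterlim (\<lambda>n. ln (real n)) at_top sequentially"
    by (rule filterlim_compose[OF ln_at_top filterlim_real_sequentially])
  then have "eventually (\<lambda>n. 4000 powr (1 / c) \<le> ln (real n)) sequentially"
    unfolding filterlim_at_top by blast
  then have "eventually (\<lambda>n. 4000 \<le> ln (real n) powr c) sequentially"
  proof eventually_elim
    case (elim n)
    have "(4000 powr (1 / c)) powr c \<le> ln (real n) powr c"
      using elim assms by (intro powr_mono2) auto
    then show ?case
      using assms by (simp add: powr_powr)
  qed
  then show ?thesis
    using eventually_ge_at_top[of 3]
  proof eventually_elim
    case (elim n)
    have l: "0 < ln (real n)"
      using elim by simp
    show ?case
    proof (intro allI impI)
      fix k :: nat assume k: "2 \<le> k"
      have "1 / 2 \<le> ln (2 :: real)"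
        using ln_2_less_1 ln_ge_iff[of 2 "1 / 2"] exp_half_le2 by simp
      also have "\<dots> \<le> ln (real k)"
        using k by simp
      finally have "(1 / 2)\<^sup>2 \<le> (ln (real k))\<^sup>2"
        by (intro power_mono) auto
      then have "1 / 4 * (ln (real n) ^ 2 * 4000) \<le> (ln (real k))\<^sup>2 * (ln (real n) ^ 2 * ln (real n) powr c)"
        using elim l by (intro mult_mono) (auto simp: power2_eq_square)
      then have "real k ^ 3 * (1000 * ln (real n) ^ 2)
          \<le> real k ^ 3 * ((ln (real k))\<^sup>2 * (ln (real n) ^ 2 * ln (real n) powr c))"
        by (intro mult_left_mono) auto
      also have "ln (real n) ^ 2 * ln (real n) powr c = ln (real n) powr (2 + c)"
        using l by (simp add: powr_add powr_numeral)
      finally show "1000 * real k ^ 3 * ln (real n) ^ 2 \<le> zeta c k n"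
        by (simp add: zeta_def mult_ac)
    qed
  qed
qed

theorem theorem2:
  fixes M :: "'a measure"
    and X :: "nat \<Rightarrow> nat \<Rightarrow> 'a \<Rightarrow> real"
    and K Kbar :: "nat \<Rightarrow> nat"
    and \<tau> :: "nat \<Rightarrow> nat \<Rightarrow> nat"
    and F :: "nat \<Rightarrow> nat \<Rightarrow> real \<Rightarrow> real"
    and c :: real
  assumes prob: "prob_space M"
    and indep: "\<And>n. n \<ge> 2 \<Longrightarrow> prob_space.indep_vars M (\<lambda>_. borel) (X n) {1..n}"
    and K_pos: "\<And>n. n \<ge> 2 \<Longrightarrow> 1 \<le> K n"
    and tau_first: "\<And>n. n \<ge> 2 \<Longrightarrow> \<tau> n 0 = 1"
    and tau_last: "\<And>n. n \<ge> 2 \<Longrightarrow> \<tau> n (K n + 1) = n + 1"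
    and tau_mono: "\<And>n. n \<ge> 2 \<Longrightarrow> strict_mono_on {0..K n + 1} (\<tau> n)"
    and distr: "\<And>n k i. n \<ge> 2 \<Longrightarrow> k \<in> {1..K n + 1} \<Longrightarrow> i \<in> {\<tau> n (k - 1)..\<tau> n k - 1} \<Longrightarrow>
                  cdf (distr M borel (X n i)) = F n k"
    and A1_cont: "\<And>n k. n \<ge> 2 \<Longrightarrow> k \<in> {1..K n + 1} \<Longrightarrow> continuous_on UNIV (F n k)"
    and A1_neq: "\<And>n k. n \<ge> 2 \<Longrightarrow> k \<in> {1..K n} \<Longrightarrow> F n k \<noteq> F n (k + 1)"
    and A2: "filterlim (\<lambda>n. min_segment (K n) (\<tau> n)) at_top sequentially"
    and A3: "AE \<omega> in M. uniform_limit UNIV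
               (\<lambda>n u. ecdf (\<lambda>i. X n i \<omega>) 1 (n + 1) u - pooled_cdf n (K n) (\<tau> n) (F n) u)
               (\<lambda>u. 0) sequentially"
    and A4: "\<exists>\<epsilon>>0. eventually (\<lambda>n. \<epsilon> \<le> eta_min n (K n) (\<tau> n) (F n)) sequentially"
    and Kbar: "\<And>n. n \<ge> 2 \<Longrightarrow> K n \<le> Kbar n"
    and c_pos: "c > 0"
    and rate: "(\<lambda>n. ereal (real (min_segment (K n) (\<tau> n))) /
                    ereal (real (Kbar n) * zeta c (Kbar n) n)) \<longlonglongrightarrow> \<infinity>"
  shows "(\<lambda>n. measure M {\<omega> \<in> space M.
            K_hat n (zeta c (Kbar n) n) (Kbar n) (\<lambda>i. X n i \<omega>) = K n}) \<longlonglongrightarrow> 1"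
proof -
  interpret prob_space M
    by (rule prob)
  obtain \<epsilon> where "0 < \<epsilon>" and eta: "eventually (\<lambda>n. \<epsilon> \<le> eta_min n (K n) (\<tau> n) (F n)) sequentially"
    using A4 by blast
  define C where "C = max 1 (36864 / \<epsilon>)"
  have "eventually (\<lambda>n. ereal C < ereal (real (min_segment (K n) (\<tau> n))) /
      ereal (real (Kbar n) * zeta c (Kbar n) n)) sequentially"
    using rate unfolding tendsto_PInfty by blast
  then have lower: "eventually (\<lambda>n. 1 - 5 / real n \<le> measure M {\<omega> \<in> space M.
      K_hat n (zeta c (Kbar n) n) (Kbar n) (\<lambda>i. X n i \<omega>) = K n}) sequentially"
    using eta zeta_ge_eventually[OF c_pos] eventually_ge_at_top[of 8]
  proof eventually_elim
    case (elim n)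
    let ?m = "min_segment (K n) (\<tau> n)" and ?\<zeta> = "zeta c (Kbar n) n"
    have n2: "2 \<le> n"
      using elim by simp
    have Kn: "1 \<le> K n" "K n \<le> Kbar n"
      using K_pos[OF n2] Kbar[OF n2] by auto
    show ?case
    (* For Kbar n = 1 the penalty vanishes because ln 1 = 0, so the rate condition says nothing;
       but then 1 is the only admissible number of change-points. *)
    proof (cases "Kbar n = 1")
      case True
      then have "K n = 1"
        using Kn by simp
      then have "{\<omega> \<in> space M. K_hat n ?\<zeta> (Kbar n) (\<lambda>i. X n i \<omega>) = K n} = space M"
        by (simp only: True K_hat_single_candidate) simp
      then show ?thesis
        by (simp only: prob_space) simp
    next
      case False
      then have Kbar2: "2 \<le> Kbar n"
        using Kn by linarith
      interpret change_point_model n "K n" "\<tau> n" M "F n" "X n"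
      proof unfold_locales
        show "\<tau> n 0 = 1" "\<tau> n (Suc (K n)) = n + 1"
          using tau_first[OF n2] tau_last[OF n2] by simp_all
        show "\<tau> n j < \<tau> n (Suc j)" if "j \<le> K n" for j
          using that by (intro strict_mono_onD[OF tau_mono[OF n2]]) auto
        show "cdf (distr M borel (X n i)) = F n (Suc j)" if "j \<le> K n" "i \<in> {\<tau> n j..<\<tau> n (Suc j)}" for i j
          using that by (intro distr n2) auto
        show "continuous_on UNIV (F n (Suc j))" if "j \<le> K n" for j
          using that by (intro A1_cont n2) auto
        show "indep_vars (\<lambda>_. borel) (X n) {1..n}"
          by (rule indep[OF n2])
      qed (use elim in auto)
      have \<zeta>_ge: "1000 * real (Kbar n) ^ 3 * ln (real n) ^ 2 \<le> ?\<zeta>"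
        using elim Kbar2 by blast
      have "0 < 1000 * real (Kbar n) ^ 3 * ln (real n) ^ 2"
        using Kbar2 elim by simp
      then have pos': "0 < real (Kbar n) * ?\<zeta>"
        using \<zeta>_ge Kbar2 by simp
      then have "real (Kbar n) * ?\<zeta> \<noteq> 0"
        by (rule less_imp_neq[THEN not_sym])
      with elim(1) have "C < real ?m / (real (Kbar n) * ?\<zeta>)"
        by (simp only: ereal_divide if_False less_ereal.simps(1))
      then have rate_n: "C * (real (Kbar n) * ?\<zeta>) < real ?m"
        using pos' by (simp add: pos_less_divide_eq)
      have pos: "0 \<le> real (Kbar n) * ?\<zeta>"
        using pos' by simp
      have "1 * (real (Kbar n) * ?\<zeta>) \<le> C * (real (Kbar n) * ?\<zeta>)"
        using pos by (intro mult_right_mono) (simp_all add: C_def)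
      then have rate1: "real (Kbar n) * ?\<zeta> \<le> real ?m"
        using rate_n by linarith
      have "36864 / \<epsilon> * (real (Kbar n) * ?\<zeta>) \<le> C * (real (Kbar n) * ?\<zeta>)"
        using pos by (intro mult_right_mono) (simp_all add: C_def)
      then have "\<epsilon> * (36864 / \<epsilon> * (real (Kbar n) * ?\<zeta>)) \<le> \<epsilon> * real ?m"
        using rate_n \<open>0 < \<epsilon>\<close> by (intro mult_left_mono) auto
      then have rate2: "36864 * (real (Kbar n) * ?\<zeta>) \<le> \<epsilon> * real ?m"
        using \<open>0 < \<epsilon>\<close> by simp
      show ?thesis
        using elim by (intro prob_K_hat_eq_ge[OF Kn Kbar2 \<open>0 < \<epsilon>\<close> _ _ \<zeta>_ge rate1 rate2]
            min_segment_le eta_min_le) auto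
    qed
  qed
  show ?thesis
  proof (rule tendsto_sandwich[OF lower])
    show "(\<lambda>n. 1 - 5 / real n) \<longlonglongrightarrow> 1"
      using tendsto_diff[OF tendsto_const[of 1] lim_const_over_n[of "5 :: real"]] by simp
    show "eventually (\<lambda>n. measure M {\<omega> \<in> space M.
        K_hat n (zeta c (Kbar n) n) (Kbar n) (\<lambda>i. X n i \<omega>) = K n} \<le> 1) sequentially"
      by simp
  qed simp
qed

end
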